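(* For every initial word $h$, $$\phi([[h]])=\sum_{T} K_{\lambda(T)},$$ where the sum is over all increasing shifted tableaux $T$ with $\mathfrak{row}(T)\ \hat\equiv\ h$, and $\lambda(T)$ is the shape of $T$.
   Context: Order $1'<1<2'<2<\cdots$. Shifted shape of strict $\lambda$: boxes $(i,j)$ with $i\le j\le i+\lambda_i-1$; $(i,i)$ main diagonal. Increasing shifted tableau: entries strictly increase along rows and down columns; $\mathfrak{row}(T)$ reads rows left to right from bottom to top. A weak set-valued shifted tableau of shape $\lambda$ is a filling with finite nonempty multisets of primed/unprimed positive integers such that: (1) smallest element of each box $\ge$ largest element of the box to its left; (2) smallest element of each box $\ge$ largest element of the box above; (3) no primed entries on the main diagonal; (4) each unprimed integer in at most one box per column; (5) each primed integer in at most one box per row. $x^T=\prod_i x_i^{a_i}$ with $a_i$ the number of occurrences of $i$ and $i'$; $K_\lambda=\sum_Tx^T$ over such tableaux of shape $\lambda$. A word is initial if its letter set is $[k]$ for some $k$. Weak $K$-Knuth equivalence $\hat\equiv$ is generated by ($\mathbf u,\mathbf v$ arbitrary words, $a<b<c$): $\mathbf u aa\mathbf v\hat\equiv\mathbf u a\mathbf v$; $\mathbf u aba\mathbf v\hat\equiv\mathbf u bab\mathbf v$; $\mathbf u bac\mathbf v\hat\equiv\mathbf u bca\mathbf v$; $\mathbf u acb\mathbf v\hat\equiv\mathbf u cab\mathbf v$; $ab\mathbf u\hat\equiv ba\mathbf u$. $[[h]]=\sum_{w\hat\equiv h}w$, and $\phi([[h]])=\sum_{w\hat\equiv h}f_{\mathcal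 D(w)}$, where for $w=w_1\cdots w_\ell$, $\mathcal D(w)=\{i:w_i>w_{i+1}\}$ and $f_{\mathcal D}=\sum x_{i_1}\cdots x_{i_\ell}$ over $i_1\le\dots\le i_\ell$ with $i_j<i_{j+1}$ for $j\in\mathcal D$. *)

theory Defs
  imports Main "HOL-Library.Multiset"
begin

text \<open>A monomial x_{i_1} ... x_{i_l} is represented by the multiset of its variable
indices (positive integers). A formal power series with natural coefficients is a
function from monomials to coefficients.\<close>

type_synonym fps_inf = "nat multiset \<Rightarrow> nat"

text \<open>Formal sum of a (locally finite) family of power series: coefficient-wise sum
over the indices contributing a nonzero coefficient.\<close>
definition fsum :: "'i set \<Rightarrow> ('i \<Rightarrow> fps_inf) \<Rightarrow> fps_inf" where
  "fsum I F = (\<lambda>M. \<Sum>i\<in>{i\<in>I. F i M \<noteq> 0}. F i M)"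

definition descents :: "nat list \<Rightarrow> nat set" where
  "descents w = {j. Suc j < length w \<and> w ! j > w ! Suc j}"

definition fundamental :: "nat \<Rightarrow> nat set \<Rightarrow> fps_inf" where
  "fundamental l D = fsum
     {i::nat list. length i = l \<and> sorted i \<and> (\<forall>x\<in>set i. 1 \<le> x)
        \<and> (\<forall>j\<in>D. Suc j < l \<longrightarrow> i ! j < i ! Suc j)}
     (\<lambda>i M. if mset i = M then 1 else 0)"

definition initial_word :: "nat list \<Rightarrow> bool" where
  "initial_word h \<longleftrightarrow> (\<exists>k. set h = {1..k})"

inductive kk_step :: "nat list \<Rightarrow> nat list \<Rightarrow> bool" where
  idem:  "kk_step (u @ [a, a] @ v) (u @ [a] @ v)"
| braid: "a < b \<Longrightarrow> kk_step (u @ [a, b, a] @ v) (u @ [b, a, b] @ v)"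
| knuth1: "a < b \<Longrightarrow> b < c \<Longrightarrow> kk_step (u @ [b, a, c] @ v) (u @ [b, c, a] @ v)"
| knuth2: "a < b \<Longrightarrow> b < c \<Longrightarrow> kk_step (u @ [a, c, b] @ v) (u @ [c, a, b] @ v)"
| first:  "a < b \<Longrightarrow> kk_step ([a, b] @ u) ([b, a] @ u)"

definition weak_kk_equiv :: "nat list \<Rightarrow> nat list \<Rightarrow> bool" where
  "weak_kk_equiv = equivclp kk_step"

definition phi_class :: "nat list \<Rightarrow> fps_inf" where
  "phi_class h = fsum {w. weak_kk_equiv w h} (\<lambda>w. fundamental (length w) (descents w))"

definition strict_partition :: "nat list \<Rightarrow> bool" where
  "strict_partition lam \<longleftrightarrow> sorted_wrt (>) lam \<and> 0 \<notin> set lam"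

definition shifted_diagram :: "nat list \<Rightarrow> (nat \<times> nat) set" where
  "shifted_diagram lam = {(i, j). 1 \<le> i \<and> i \<le> length lam \<and> i \<le> j \<and> j < i + lam ! (i - 1)}"

definition inc_shifted_tableau :: "nat list \<Rightarrow> (nat \<times> nat \<Rightarrow> nat) \<Rightarrow> bool" where
  "inc_shifted_tableau lam T \<longleftrightarrow>
     (\<forall>b. b \<notin> shifted_diagram lam \<longrightarrow> T b = 0) \<and>
     (\<forall>b\<in>shifted_diagram lam. 1 \<le> T b) \<and>
     (\<forall>i j j'. (i, j) \<in> shifted_diagram lam \<longrightarrow> (i, j') \<in> shifted_diagram lam \<longrightarrow> j < j'
        \<longrightarrow> T (i, j) < T (i, j')) \<and>
     (\<forall>i i' j. (i, j) \<in> shifted_diagram lam \<longrightarrow> (i', j) \<in> shifted_diagram lam \<longrightarrow> i < i'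
        \<longrightarrow> T (i, j) < T (i', j))"

definition row_word :: "nat list \<Rightarrow> (nat \<times> nat \<Rightarrow> nat) \<Rightarrow> nat list" where
  "row_word lam T = concat (map (\<lambda>i. map (\<lambda>j. T (i, j)) [i..<i + lam ! (i - 1)])
                                 (rev [1..<Suc (length lam)]))"

text \<open>Primed/unprimed letters: (n, True) is n', (n, False) is n. Order
1' < 1 < 2' < 2 < ... is given by the key pval.\<close>
type_synonym pletter = "nat \<times> bool"

definition pval :: "pletter \<Rightarrow> nat" where
  "pval x = 2 * fst x - (if snd x then 1 else 0)"

definition weak_sv_tableau :: "nat list \<Rightarrow> (nat \<times> nat \<Rightarrow> pletter multiset) \<Rightarrow> bool" where
  "weak_sv_tableau lam S \<longleftrightarrow>
     (\<forall>b. b \<notin> shifted_diagram lam \<longrightarrow> S b = {#}) \<and>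
     (\<forall>b\<in>shifted_diagram lam. S b \<noteq> {#} \<and> (\<forall>x\<in>#S b. 1 \<le> fst x)) \<and>
     \<comment> \<open>(1) box vs. box to its left\<close>
     (\<forall>i j. (i, j) \<in> shifted_diagram lam \<longrightarrow> (i, Suc j) \<in> shifted_diagram lam \<longrightarrow>
        Max (pval ` set_mset (S (i, j))) \<le> Min (pval ` set_mset (S (i, Suc j)))) \<and>
     \<comment> \<open>(2) box vs. box above\<close>
     (\<forall>i j. (i, j) \<in> shifted_diagram lam \<longrightarrow> (Suc i, j) \<in> shifted_diagram lam \<longrightarrow>
        Max (pval ` set_mset (S (i, j))) \<le> Min (pval ` set_mset (S (Suc i, j)))) \<and>
     \<comment> \<open>(3) no primed entries on the main diagonal\<close>
     (\<forall>i. \<forall>x\<in>#S (i, i). \<not> snd x) \<and>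
     \<comment> \<open>(4) each unprimed integer in at most one box per column\<close>
     (\<forall>n j. card {i. (i, j) \<in> shifted_diagram lam \<and> (n, False) \<in># S (i, j)} \<le> 1) \<and>
     \<comment> \<open>(5) each primed integer in at most one box per row\<close>
     (\<forall>n i. card {j. (i, j) \<in> shifted_diagram lam \<and> (n, True) \<in># S (i, j)} \<le> 1)"

definition sv_content :: "nat list \<Rightarrow> (nat \<times> nat \<Rightarrow> pletter multiset) \<Rightarrow> nat multiset" where
  "sv_content lam S = (\<Sum>b\<in>shifted_diagram lam. image_mset fst (S b))"

definition K_shifted :: "nat list \<Rightarrow> fps_inf" where
  "K_shifted lam = fsum {S. weak_sv_tableau lam S}
     (\<lambda>S M. if sv_content lam S = M then 1 else 0)"

end

theory Submission
  imports Defs "HOL-Library.Extended_Nat"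
begin

text \<open>A shifted tableau T is written as a symmetric array D with D i j = T (min i j, max i j) and
  infinity outside the shape. Shifted Hecke insertion then is a single row insertion with symmetric
  updates: once the bumping path has crossed the diagonal, inserting into a row of D to the left of
  the diagonal means inserting into a column of T. Every step is reversible, and so is the whole
  insertion if the corner of D where it ends is recorded; a corner below the diagonal is recorded by
  a primed letter. Row words of tableaux stay weakly K-Knuth equivalent to the inserted word, and
  comparing the bumping paths of two consecutive letters shows that a word descends exactly where
  its recorded letters cannot carry the same label. Hence, for each monomial, the compatible words
  equivalent to h correspond to the pairs of an increasing tableau with row word equivalent to h
  and a weak set-valued tableau of the same shape.\<close>

section \<open>K-Knuth equivalence of row words\<close>

text \<open>The obstacle is a letter that does not fit because an equal letter stands directly above
  its target. No relation inside one row expresses such a step, so two neighbouring rows have to be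
  rearranged together, and before the diagonal is crossed the upper one starts one box earlier. This
  is the source of the lemmas on \<open>rect_above\<close>. The exchange of the first two letters
  enters where a diagonal box takes part: letters are brought to the front of the word and exchanged
  there. It is kept out of \<open>keq\<close>, so that the other rearrangements can be made inside
  longer words and reversed for columns. For the recording, a label may occur several times, and the
  insertion to be undone has to be recognized from the tableaux alone. In the symmetric array each
  label lies in at most one box per column, and insertions with equal labels record corners that
  move weakly to the right; so the largest label in its last column belongs to the last insertion.
  An insertion that adds no box is recorded at an existing corner, and whether a box was added shows
  in whether the corner becomes empty when the letter is removed.\<close>

text \<open>The relations of kk_step without the one for the first two letters, hence a congruence on
  both sides.\<close>
inductive keq :: "nat list \<Rightarrow> nat list \<Rightarrow> bool" where
  keq_refl: "keq u u"
| keq_sym: "keq u v \<Longrightarrow> keq v u"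
| keq_trans [trans]: "keq u v \<Longrightarrow> keq v w \<Longrightarrow> keq u w"
| keq_idem: "keq (u @ [a, a] @ v) (u @ [a] @ v)"
| keq_braid: "a < b \<Longrightarrow> keq (u @ [a, b, a] @ v) (u @ [b, a, b] @ v)"
| keq_knuth1: "a < b \<Longrightarrow> b < c \<Longrightarrow> keq (u @ [b, a, c] @ v) (u @ [b, c, a] @ v)"
| keq_knuth2: "a < b \<Longrightarrow> b < c \<Longrightarrow> keq (u @ [a, c, b] @ v) (u @ [c, a, b] @ v)"

lemma keq_append: "keq u v \<Longrightarrow> keq (p @ u @ q) (p @ v @ q)"
proof (induction rule: keq.induct)
  case (keq_idem u a v) then show ?case using keq.keq_idem[of "p @ u" a "v @ q"] by simp
next
  case (keq_braid a b u v) then show ?case using keq.keq_braid[of a b "p @ u" "v @ q"] by simp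
next
  case (keq_knuth1 a b c u v) then show ?case using keq.keq_knuth1[of a b c "p @ u" "v @ q"] by simp
next
  case (keq_knuth2 a b c u v) then show ?case using keq.keq_knuth2[of a b c "p @ u" "v @ q"] by simp
qed (simp_all add: keq_refl keq_sym, blast intro: keq_trans)

lemma keq_ctx: "keq u v \<Longrightarrow> s = p @ u @ q \<Longrightarrow> t = p @ v @ q \<Longrightarrow> keq s t"
  using keq_append by simp

text \<open>Reversal exchanges the two Knuth relations. It transfers results on rows to columns,
  which are read from bottom to top, against their increasing order.\<close>

lemma keq_rev: "keq u v \<Longrightarrow> keq (rev u) (rev v)"
proof (induction rule: keq.induct)
  case (keq_idem u a v) then show ?case using keq.keq_idem[of "rev v" a "rev u"] by simp
next
  case (keq_braid a b u v) then show ?case using keq.keq_braid[of a b "rev v" "rev u"] by simp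
next
  case (keq_knuth1 a b c u v)
  then show ?case using keq_sym[OF keq.keq_knuth2[of a b c "rev v" "rev u"]] by simp
next
  case (keq_knuth2 a b c u v)
  then show ?case using keq_sym[OF keq.keq_knuth1[of a b c "rev v" "rev u"]] by simp
qed (simp_all add: keq_refl keq_sym, blast intro: keq_trans)

text \<open>Each swap of y with the letter a on its right is a Knuth move witnessed by the letter
  after a, which lies between a and y. Hence y stops before w, the last letter available as a
  witness.\<close>

lemma bubble_max:
  assumes "sorted_wrt (<) (A @ [w])" "\<forall>a\<in>set A. a < y" "w < y"
  shows "keq (y # A @ [w]) (A @ [y, w])"
  using assms
proof (induction A)
  case Nil then show ?case by (simp add: keq_refl)
next
  case (Cons a A)
  obtain a' t where t: "A @ [w] = a' # t" by (cases "A @ [w]") auto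
  have "a' \<in> set (A @ [w])" using t by simp
  then have "a < a'" "a' < y" using Cons.prems by auto
  then have "keq (y # a # A @ [w]) (a # y # A @ [w])"
    using keq_sym[OF keq_knuth2[of a a' y "[]" t]] t by simp
  also have "keq \<dots> (a # A @ [y, w])"
    using Cons by - (rule keq_ctx[of "y # A @ [w]" "A @ [y, w]" _ "[a]" "[]"], auto)
  finally show ?case by simp
qed

text \<open>Dual to \<open>bubble_max\<close>: z passes a letter c on its left because the letter
  before c lies between z and c, so the head b has to stay in front of z.\<close>

lemma bubble_min:
  assumes "sorted_wrt (<) (b # B)" "z < b"
  shows "keq (b # B @ [z]) (b # z # B)"
  using assms
proof (induction B rule: rev_induct)
  case Nil then show ?case by (simp add: keq_refl)
next
  case (snoc c B)
  obtain p t where t: "b # B = t @ [p]" by (metis append_butlast_last_id list.distinct(1))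
  have "p \<in> set (b # B)" using t by simp
  then have "z < p" "p < c" using snoc.prems by (auto simp: sorted_wrt_append)
  then have "keq (b # (B @ [c]) @ [z]) (b # B @ [z, c])"
    using keq_ctx[OF keq_sym[OF keq_knuth1[of z p c "[]" "[]"]], of _ t "[]"] t
    by (metis append.right_neutral append_Cons append_Nil append_assoc)
  also have "keq \<dots> (b # z # B @ [c])"
    using snoc by - (rule keq_ctx[of "b # B @ [z]" "b # z # B" _ "[]" "[c]"], auto simp: sorted_wrt_append)
  finally show ?case by simp
qed

text \<open>Two consecutive rows, the upper one listed first, aligned at their left ends.\<close>
definition above :: "nat list \<Rightarrow> nat list \<Rightarrow> bool" where
  "above A B \<longleftrightarrow> length B \<le> length A \<and> (\<forall>j<length B. A ! j < B ! j)"

lemma above_Nil [simp]: "above A []" by (simp add: above_def)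

lemma above_shift:
  assumes "above A B" "sorted_wrt (<) (Z @ A)"
  shows "above (Z @ A) B"
  unfolding above_def
proof (intro conjI allI impI)
  show "length B \<le> length (Z @ A)" using assms by (simp add: above_def)
  fix j assume j: "j < length B"
  then have jA: "j < length A" using assms by (simp add: above_def)
  have "(Z @ A) ! j \<le> (Z @ A) ! (length Z + j)"
    using sorted_wrt_nth_less[OF assms(2), of j "length Z + j"] jA by (cases "Z = []") auto
  also have "\<dots> = A ! j" by simp
  also have "\<dots> < B ! j" using assms j by (simp add: above_def)
  finally show "(Z @ A) ! j < B ! j" .
qed

text \<open>The last letter b of B is moved out of the way: it runs right through z and the part of
  A above the rest of B, and stops before the letter a above it, which is the smaller letter
  required by \<open>bubble_max\<close>. The induction hypothesis applies to B without b, and then b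
  runs back.\<close>

lemma row_past_min:
  assumes "above A B" "sorted_wrt (<) (z # A)" "sorted_wrt (<) B"
  shows "keq (B @ z # A) (z # B @ A)"
  using assms
proof (induction B arbitrary: A rule: rev_induct)
  case Nil then show ?case by (simp add: keq_refl)
next
  case (snoc b B)
  obtain A1 a R where A: "A = A1 @ a # R" and len: "length A1 = length B"
  proof
    have "length B < length A" using snoc.prems(1) by (simp add: above_def)
    then show "A = take (length B) A @ A ! length B # drop (Suc (length B)) A"
      and "length (take (length B) A) = length B" by (simp_all add: id_take_nth_drop)
  qed
  have ab: "a < b" using snoc.prems(1) len by (auto simp: above_def A nth_append dest: spec[of _ "length B"])
  have srt: "sorted_wrt (<) (z # A1 @ a # R)" using snoc.prems(2) A by metis
  have lt: "\<forall>x\<in>set (z # A1). x < b" using srt ab by (auto simp: sorted_wrt_append)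
  have ab': "above A1 B" unfolding above_def
  proof (intro conjI allI impI)
    fix j assume "j < length B"
    then show "A1 ! j < B ! j" using snoc.prems(1) len
      by (auto simp: above_def A nth_append dest!: spec[of _ j])
  qed (simp add: len)
  have s1: "sorted_wrt (<) ((z # A1) @ [a])" and s2: "sorted_wrt (<) (A1 @ [a])"
    and s3: "sorted_wrt (<) (z # A1)" and s4: "sorted_wrt (<) B"
    using srt snoc.prems(3) by (auto simp: sorted_wrt_append)
  have "keq ((B @ [b]) @ z # A) (B @ (z # A1) @ [b, a] @ R)"
    by (rule keq_ctx[OF bubble_max[OF s1 lt ab], of _ B R]) (simp_all add: A)
  also have "keq \<dots> ((z # B @ A1) @ [b, a] @ R)"
    by (rule keq_ctx[OF snoc.IH[OF ab' s3 s4], of _ "[]" "[b, a] @ R"]) simp_all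
  also have "keq \<dots> (z # B @ (b # A1 @ [a]) @ R)"
    using lt by - (rule keq_ctx[OF keq_sym[OF bubble_max[OF s2 _ ab]], of _ "z # B" R], auto)
  finally show ?case using A by simp
qed

lemma row_past_list:
  assumes "above A B" "sorted_wrt (<) (Z @ A)" "sorted_wrt (<) B"
  shows "keq (B @ Z @ A) (Z @ B @ A)"
  using assms
proof (induction Z)
  case Nil then show ?case by (simp add: keq_refl)
next
  case (Cons z Z)
  have "keq (B @ z # Z @ A) (z # B @ Z @ A)"
    using row_past_min[of "Z @ A" B z] above_shift[of A B Z] Cons.prems by simp
  also have "keq \<dots> (z # Z @ B @ A)"
    using Cons by - (rule keq_ctx[of "B @ Z @ A" "Z @ B @ A" _ "[z]" "[]"], auto)
  finally show ?case by simp
qed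

fun stacked :: "nat list list \<Rightarrow> bool" where
  "stacked [] = True"
| "stacked [A] = sorted_wrt (<) A"
| "stacked (A # B # Rs) = (sorted_wrt (<) A \<and> above A B \<and> stacked (B # Rs))"

lemma stacked_Cons_sorted: "stacked (A # Rs) \<Longrightarrow> sorted_wrt (<) A"
  by (cases Rs) auto

definition rword :: "nat list list \<Rightarrow> nat list" where
  "rword Rs = concat (rev Rs)"

lemma rword_simps [simp]: "rword [] = []" "rword (R # Rs) = rword Rs @ R"
  "rword (Rs @ Rs') = rword Rs' @ rword Rs"
  by (simp_all add: rword_def)

text \<open>Z passes one row B at a time, starting from the top. Afterwards \<open>Z @ B\<close> is
  again increasing, because the head of B exceeds the head of A. If B is empty, so are all rows
  below it.\<close>

lemma rows_past_list:
  assumes "stacked (A # Rs)" "sorted_wrt (<) (Z @ A)"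
  shows "keq (rword Rs @ Z @ A) (Z @ rword Rs @ A)"
  using assms
proof (induction Rs arbitrary: A)
  case Nil then show ?case by (simp add: keq_refl)
next
  case (Cons B Rs)
  have ab: "above A B" and sB: "sorted_wrt (<) B"
    using Cons.prems stacked_Cons_sorted by auto
  have "keq (rword (B # Rs) @ Z @ A) (rword Rs @ Z @ B @ A)"
    using row_past_list[OF ab _ sB] Cons.prems
    by - (rule keq_ctx[of "B @ Z @ A" "Z @ B @ A" _ "rword Rs" "[]"], auto)
  also have "keq \<dots> (Z @ rword (B # Rs) @ A)"
  proof (cases "B = []")
    case True
    have "\<And>C. C \<in> set Rs \<Longrightarrow> C = []"
    proof -
      have "stacked (B # Rs) \<Longrightarrow> B = [] \<Longrightarrow> \<forall>C\<in>set Rs. C = []" for B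
        by (induction Rs arbitrary: B) (auto simp: above_def)
      then show "\<And>C. C \<in> set Rs \<Longrightarrow> C = []" using True Cons.prems by auto
    qed
    then have "rword Rs = []" by (auto simp: rword_def)
    then show ?thesis using True by (simp add: keq_refl)
  next
    case False
    then obtain b B' where B: "B = b # B'" by (cases B) auto
    then obtain a A' where A: "A = a # A'" and "a < b" using ab by (cases A) (auto simp: above_def)
    then have "sorted_wrt (<) (Z @ B)" using Cons.prems sB B
      by (fastforce simp: sorted_wrt_append)
    then show ?thesis using Cons.IH[of B] Cons.prems
      by - (rule keq_ctx[of "rword Rs @ Z @ B" "Z @ rword Rs @ B" _ "[]" A], auto)
  qed
  finally show ?case .
qed

text \<open>Induction on columns. The head a of A is brought directly after b, the letter below it,
  so that the remaining rectangle is contiguous around z; it is returned after z has passed.\<close>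

lemma rect_past_max:
  assumes "length A = length B" "\<forall>j<length B. A ! j < B ! j"
    "sorted_wrt (<) A" "sorted_wrt (<) B" "\<forall>b\<in>set B. b < z"
  shows "keq (B @ z # A) (B @ A @ [z])"
  using assms
proof (induction A B rule: list_induct2)
  case Nil then show ?case by (simp add: keq_refl)
next
  case (Cons a A b B)
  have ab: "a < b" using Cons.prems(1) by auto
  have al: "\<forall>j<length B. A ! j < B ! j" using Cons.prems(1) by auto
  have s: "sorted_wrt (<) (b # B @ [z])" using Cons.prems by (auto simp: sorted_wrt_append)
  have "keq ((b # B) @ z # a # A) (b # a # (B @ [z]) @ A)"
    using bubble_min[of b "B @ [z]" a] s ab
    by - (rule keq_ctx[of "b # (B @ [z]) @ [a]" "b # a # B @ [z]" _ "[]" A], auto)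
  also have "keq \<dots> ([b, a] @ B @ A @ [z])"
    using Cons.IH[OF al] Cons.prems
    by - (rule keq_ctx[of "B @ z # A" "B @ A @ [z]" _ "[b, a]" "[]"], auto)
  also have "keq \<dots> ((b # B @ [a]) @ A @ [z])"
    using bubble_min[of b "B" a] s ab
    by - (rule keq_ctx[OF keq_sym[of "b # B @ [a]" "b # a # B"], of _ "[]" "A @ [z]"],
        auto simp: sorted_wrt_append)
  finally show ?case by simp
qed

text \<open>Ordinary Schensted insertion: the bumped letter y leaves to the left, where the lower
  rows stand in the row word.\<close>

lemma row_insert_replace:
  assumes "sorted_wrt (<) (B1 @ y # B2)" "\<forall>b\<in>set B1. b < x" "x < y"
  shows "keq (B1 @ y # B2 @ [x]) (y # B1 @ x # B2)"
proof -
  have "keq (B1 @ y # B2 @ [x]) (B1 @ y # x # B2)"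
    using assms bubble_min[of y B2 x]
    by - (rule keq_ctx[of "y # B2 @ [x]" "y # x # B2" _ B1 "[]"], auto simp: sorted_wrt_append)
  also have "keq \<dots> (y # B1 @ x # B2)"
    using assms keq_sym[OF bubble_max[of B1 x y]]
    by - (rule keq_ctx[of "B1 @ [y, x]" "y # B1 @ [x]" _ "[]" B2], auto simp: sorted_wrt_append)
  finally show ?thesis .
qed

text \<open>Since x already stands left of y, the row stays as it is. The braid relation turns x y x
  into y x y, which produces an outgoing y without losing the one in the row.\<close>

lemma row_insert_mem:
  assumes "sorted_wrt (<) (B1 @ x # y # B2)"
  shows "keq (B1 @ x # y # B2 @ [x]) (y # B1 @ x # y # B2)"
proof -
  have "keq (B1 @ x # y # B2 @ [x]) (B1 @ x # y # x # B2)"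
    using assms bubble_min[of y B2 x]
    by - (rule keq_ctx[of "y # B2 @ [x]" "y # x # B2" _ "B1 @ [x]" "[]"], auto simp: sorted_wrt_append)
  also have "keq \<dots> (B1 @ y # x # y # B2)"
    using assms keq_braid[of x y "B1" B2] by (auto simp: sorted_wrt_append)
  also have "keq \<dots> (y # B1 @ x # y # B2)"
    using assms keq_sym[OF bubble_max[of B1 x y]]
    by - (rule keq_ctx[of "B1 @ [y, x]" "y # B1 @ [x]" _ "[]" "y # B2"], auto simp: sorted_wrt_append)
  finally show ?thesis .
qed

section \<open>Letters blocked by an equal letter in the row above\<close>

definition rect_above :: "nat list \<Rightarrow> nat list \<Rightarrow> bool" where
  "rect_above A B \<longleftrightarrow> length A = length B \<and> (\<forall>j<length B. A ! j < B ! j)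
     \<and> sorted_wrt (<) A \<and> sorted_wrt (<) B"

lemma keq_rect: "rect_above A B \<Longrightarrow> \<forall>b\<in>set B. b < z \<Longrightarrow> keq (B @ z # A) (B @ A @ [z])"
  by (simp add: rect_past_max rect_above_def)

text \<open>The letter z stands immediately above y, so y may be inserted a second time for free.\<close>
lemma rect_duplicate:
  assumes "rect_above A B" "\<forall>b\<in>set B. b < z" "z < y"
  shows "keq (y # B @ A @ [z]) (y # B @ y # A @ [z])"
proof (cases B rule: rev_cases)
  case Nil
  then have "A = []" using assms by (simp add: rect_above_def)
  then show ?thesis using Nil keq_sym[OF keq_idem[of "[]" y "[z]"]] by simp
next
  case (snoc B' b)
  then obtain A0 a where A: "A = A0 @ [a]" using assms by (cases A rule: rev_cases) (auto simp: rect_above_def)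
  have len: "length A0 = length B'" using assms(1) A snoc by (simp add: rect_above_def)
  have ab: "a < b" using assms(1) A snoc len
    by (auto simp: rect_above_def nth_append dest: spec[of _ "length B'"])
  have bz: "b < z" using assms(2) snoc by simp
  have sB: "sorted_wrt (<) (B' @ [b])" and sA: "sorted_wrt (<) (A0 @ [a])"
    using assms(1) A snoc by (auto simp: rect_above_def)
  have r: "rect_above A0 B'" unfolding rect_above_def
  proof (intro conjI allI impI)
    fix j assume "j < length B'"
    then show "A0 ! j < B' ! j" using assms(1) len
      by (auto simp: rect_above_def A snoc nth_append dest!: spec[of _ j])
  qed (use len sB sA in \<open>auto simp: sorted_wrt_append\<close>)
  have lb: "\<forall>x\<in>set B'. x < b" and la: "\<forall>x\<in>set A0. x < a"
    using sB sA by (auto simp: sorted_wrt_append)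
  have sAb: "sorted_wrt (<) (A0 @ [b])" using sA ab by (auto simp: sorted_wrt_append)
  have m1: "keq (b # A0 @ [a, z]) (A0 @ [b, z, a])"
  proof -
    have "keq (b # A0 @ [a, z]) (A0 @ [b, a, z])"
      using bubble_max[OF sA _ ab] less_trans[OF _ ab] la
      by - (rule keq_ctx[of "b # A0 @ [a]" "A0 @ [b, a]" _ "[]" "[z]"], auto)
    also have "keq \<dots> (A0 @ [b, z, a])"
      using keq_knuth1[of a b z A0 "[]"] ab bz by simp
    finally show ?thesis .
  qed
  have m2: "keq (y # A0 @ [b, z, a]) (A0 @ [b, y, z, a])"
  proof -
    have "keq (y # A0 @ [b, z, a]) (A0 @ [y, b, z, a])"
      using bubble_max[OF sAb _ less_trans[OF bz assms(3)]] la ab bz assms(3) less_trans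
      by - (rule keq_ctx[of "y # A0 @ [b]" "A0 @ [y, b]" _ "[]" "[z, a]"], fastforce+)
    also have "keq \<dots> (A0 @ [b, y, z, a])"
      using keq_sym[OF keq_knuth2[of b z y A0 "[a]"]] bz assms(3) by simp
    finally show ?thesis .
  qed
  have m3: "keq (y # B' @ [b]) (B' @ [y, b])"
    using bubble_max[OF sB _ less_trans[OF bz assms(3)]] lb bz assms(3) by fastforce
  have "keq (y # B @ A @ [z]) (B' @ y # b # A0 @ [a, z])"
    by (rule keq_ctx[OF m3, of _ "[]" "A0 @ [a, z]"]) (simp_all add: snoc A)
  also have "keq \<dots> (B' @ y # A0 @ [b, z, a])"
    by (rule keq_ctx[OF m1, of _ "B' @ [y]" "[]"]) simp_all
  also have "keq \<dots> (B' @ A0 @ [b, y, z, a])"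
    by (rule keq_ctx[OF m2, of _ "B'" "[]"]) simp_all
  finally have L: "keq (y # B @ A @ [z]) (B' @ A0 @ [b, y, z, a])" .
  have "keq (y # B @ y # A @ [z]) (B' @ y # b # y # A0 @ [a, z])"
    by (rule keq_ctx[OF m3, of _ "[]" "y # A0 @ [a, z]"]) (simp_all add: snoc A)
  \<comment> \<open>The second y yields two copies of b through the braid relation. Both are driven
    to the same place and merged, which leaves the word already reached from the other side.\<close>
  also have "keq \<dots> (B' @ b # y # b # A0 @ [a, z])"
    using keq_sym[OF keq_braid[of b y B' "A0 @ [a, z]"]] bz assms(3) by simp
  also have "keq \<dots> (B' @ b # y # A0 @ [b, z, a])"
    by (rule keq_ctx[OF m1, of _ "B' @ [b, y]" "[]"]) simp_all
  also have "keq \<dots> (B' @ b # A0 @ [b, y, z, a])"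
    by (rule keq_ctx[OF m2, of _ "B' @ [b]" "[]"]) simp_all
  also have "keq \<dots> (B' @ A0 @ [b, b, y, z, a])"
    by (rule keq_ctx[OF keq_rect[OF r lb], of _ "[]" "[b, y, z, a]"]) simp_all
  also have "keq \<dots> (B' @ A0 @ [b, y, z, a])"
    using keq_idem[of "B' @ A0" b "[y, z, a]"] by simp
  finally show ?thesis using L keq_sym keq_trans by blast
qed

text \<open>After z has pushed y out, z is carried to the end of the rectangle formed by B1 and A1.
  There \<open>rect_duplicate\<close> restores the y of the row; then z meets its copy in the upper
  row and is absorbed.\<close>

lemma row_insert_above_rect:
  assumes "sorted_wrt (<) (B1 @ y # B2)" "sorted_wrt (<) (A1 @ z # A2)" "rect_above A1 B1"
    "\<forall>b\<in>set B1. b < z" "z < y" "above (z # A2) B2"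
  shows "keq (B1 @ y # B2 @ z # A1 @ z # A2) (y # B1 @ y # B2 @ A1 @ z # A2)"
proof -
  have s: "sorted_wrt (<) (y # B2)" "sorted_wrt (<) B2" "sorted_wrt (<) (B1 @ [z])"
    using assms by (auto simp: sorted_wrt_append)
  have zB: "\<forall>b\<in>set B1. b < y" using assms by auto
  note min = bubble_min[OF s(1) assms(5)]
  note past = row_past_list[OF assms(6) assms(2) s(2)]
  note dup = rect_duplicate[OF assms(3,4,5)]
  have "keq (B1 @ y # B2 @ z # A1 @ z # A2) (B1 @ y # z # B2 @ A1 @ z # A2)"
    by (rule keq_ctx[OF min, of _ B1 "A1 @ z # A2"]) simp_all
  also have "keq \<dots> (y # B1 @ z # B2 @ A1 @ z # A2)"
    by (rule keq_ctx[OF keq_sym[OF bubble_max[OF s(3) zB assms(5)]], of _ "[]" "B2 @ A1 @ z # A2"])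
      simp_all
  also have "keq \<dots> (y # B1 @ z # A1 @ B2 @ z # A2)"
    by (rule keq_ctx[OF past, of _ "y # B1 @ [z]" "[]"]) simp_all
  also have "keq \<dots> (y # B1 @ A1 @ z # B2 @ z # A2)"
    by (rule keq_ctx[OF keq_rect[OF assms(3,4)], of _ "[y]" "B2 @ z # A2"]) simp_all
  also have "keq \<dots> (y # B1 @ y # A1 @ z # B2 @ z # A2)"
    by (rule keq_ctx[OF dup, of _ "[]" "B2 @ z # A2"]) simp_all
  also have "keq \<dots> (y # B1 @ A1 @ y # z # B2 @ z # A2)"
    by (rule keq_ctx[OF keq_rect[OF assms(3) zB], of _ "[y]" "z # B2 @ z # A2"]) simp_all
  also have "keq \<dots> (y # B1 @ A1 @ y # B2 @ z # z # A2)"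
    by (rule keq_ctx[OF keq_sym[OF min], of _ "y # B1 @ A1" "z # A2"]) simp_all
  also have "keq \<dots> (y # B1 @ A1 @ y # B2 @ z # A2)"
    using keq_idem[of "y # B1 @ A1 @ y # B2" z A2] by simp
  also have "keq \<dots> (y # B1 @ y # A1 @ B2 @ z # A2)"
    by (rule keq_ctx[OF keq_sym[OF keq_rect[OF assms(3) zB]], of _ "[y]" "B2 @ z # A2"]) simp_all
  also have "keq \<dots> (y # B1 @ y # B2 @ A1 @ z # A2)"
    by (rule keq_ctx[OF keq_sym[OF past], of _ "y # B1 @ [y]" "[]"]) simp_all
  finally show ?thesis .
qed

text \<open>A letter z entering on the left comes out on the right as its predecessor a in the row.
  This is the device by which \<open>row_past_first_box\<close> gets z out of the way of p.\<close>

lemma letter_through_row: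
  assumes "sorted_wrt (<) (A0 @ a # z # A2)"
  shows "keq (z # A0 @ a # z # A2) (A0 @ a # z # A2 @ [a])"
proof -
  have s: "sorted_wrt (<) (A0 @ [a])" "sorted_wrt (<) (z # A2)" "a < z" "\<forall>x\<in>set A0. x < z"
    using assms by (auto simp: sorted_wrt_append)
  have "keq (z # A0 @ a # z # A2) (A0 @ z # a # z # A2)"
    by (rule keq_ctx[OF bubble_max[OF s(1,4,3)], of _ "[]" "z # A2"]) simp_all
  also have "keq \<dots> (A0 @ a # z # a # A2)"
    using keq_sym[OF keq_braid[of a z A0 A2]] s by simp
  also have "keq \<dots> (A0 @ a # z # A2 @ [a])"
    by (rule keq_ctx[OF keq_sym[OF bubble_min[OF s(2,3)]], of _ "A0 @ [a]" "[]"]) simp_all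
  finally show ?thesis .
qed

text \<open>In a shifted shape the upper row starts one box p earlier, and p separates z from the
  aligned part. Since z occurs in the upper row, it can leave that row on the right as the letter a;
  then p passes B, and a turns back into z.\<close>

lemma row_past_first_box:
  assumes "sorted_wrt (<) (p # A1 @ z # A2)" "A1 \<noteq> []" "above (A1 @ z # A2) B" "sorted_wrt (<) B"
  shows "keq (B @ z # p # A1 @ z # A2) (p # B @ z # A1 @ z # A2)"
proof -
  obtain A0 a where A: "A1 = A0 @ [a]" using assms(2) by (cases A1 rule: rev_cases) auto
  have s: "sorted_wrt (<) ((p # A0) @ a # z # A2)" "sorted_wrt (<) (A0 @ a # z # A2)"
    using assms(1) A by auto
  have "keq (B @ z # p # A1 @ z # A2) (B @ p # A1 @ z # A2 @ [a])"
    by (rule keq_ctx[OF letter_through_row[OF s(1)], of _ B "[]"]) (simp_all add: A)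
  also have "keq \<dots> (p # B @ A1 @ z # A2 @ [a])"
    by (rule keq_ctx[OF row_past_min[OF assms(3,1,4)], of _ "[]" "[a]"]) (simp_all add: A)
  also have "keq \<dots> (p # B @ z # A1 @ z # A2)"
    by (rule keq_ctx[OF keq_sym[OF letter_through_row[OF s(2)]], of _ "p # B" "[]"]) (simp_all add: A)
  finally show ?thesis .
qed

text \<open>The box p is taken to the front, the aligned case applies, and p returns past the
  outgoing y. The first letter of B1 lies between p and y and witnesses this exchange.\<close>

lemma row_insert_above:
  assumes "sorted_wrt (<) (B1 @ y # B2)" "sorted_wrt (<) (p # A1 @ z # A2)" "rect_above A1 B1"
    "\<forall>b\<in>set B1. b < z" "z < y" "above (A1 @ z # A2) (B1 @ y # B2)" "above (z # A2) B2" "B1 \<noteq> []"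
  shows "keq (B1 @ y # B2 @ z # p # A1 @ z # A2) (y # B1 @ y # B2 @ p # A1 @ z # A2)"
proof -
  have ne: "A1 \<noteq> []" using assms(3,8) by (auto simp: rect_above_def)
  obtain b B' where B: "B1 = b # B'" using assms(8) by (cases B1) auto
  obtain a A' where A: "A1 = a # A'" using ne by (cases A1) auto
  have pb: "p < b" "b < y" using assms(1,2,3) A B by (auto simp: rect_above_def)
  have s: "sorted_wrt (<) (A1 @ z # A2)" using assms(2) by simp
  have "keq (B1 @ y # B2 @ z # p # A1 @ z # A2) (p # B1 @ y # B2 @ z # A1 @ z # A2)"
    using row_past_first_box[OF assms(2) ne assms(6,1)] by simp
  also have "keq \<dots> (p # y # B1 @ y # B2 @ A1 @ z # A2)"
    by (rule keq_ctx[OF row_insert_above_rect[OF assms(1) s assms(3,4,5,7)], of _ "[p]" "[]"]) simp_all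
  also have "keq \<dots> (y # p # B1 @ y # B2 @ A1 @ z # A2)"
    using keq_knuth2[of p b y "[]" "B' @ y # B2 @ A1 @ z # A2"] pb by (simp add: B)
  also have "keq \<dots> (y # B1 @ y # B2 @ p # A1 @ z # A2)"
    by (rule keq_ctx[OF keq_sym[OF row_past_min[OF assms(6,2,1)]], of _ "[y]" "[]"]) simp_all
  finally show ?thesis .
qed

text \<open>The case in which nothing is bumped out: z reaches its copy in the upper row and merges
  with it.\<close>

lemma row_stop_above_rect:
  assumes "rect_above A1 B" "\<forall>b\<in>set B. b < z"
  shows "keq (B @ z # A1 @ z # A2) (B @ A1 @ z # A2)"
proof -
  have "keq (B @ z # A1 @ z # A2) (B @ A1 @ z # z # A2)"
    by (rule keq_ctx[OF keq_rect[OF assms], of _ "[]" "z # A2"]) simp_all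
  also have "keq \<dots> (B @ A1 @ z # A2)"
    using keq_idem[of "B @ A1" z A2] by simp
  finally show ?thesis .
qed

lemma row_stop_above:
  assumes "sorted_wrt (<) (p # A1 @ z # A2)" "rect_above A1 B"
    "\<forall>b\<in>set B. b < z" "above (A1 @ z # A2) B" "B \<noteq> []"
  shows "keq (B @ z # p # A1 @ z # A2) (B @ p # A1 @ z # A2)"
proof -
  have ne: "A1 \<noteq> []" and sB: "sorted_wrt (<) B" using assms(2,5) by (auto simp: rect_above_def)
  have "keq (B @ z # p # A1 @ z # A2) (p # B @ z # A1 @ z # A2)"
    by (rule row_past_first_box[OF assms(1) ne assms(4) sB])
  also have "keq \<dots> (p # B @ A1 @ z # A2)"
    by (rule keq_ctx[OF row_stop_above_rect[OF assms(2,3)], of _ "[p]" "[]"]) simp_all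
  also have "keq \<dots> (B @ p # A1 @ z # A2)"
    by (rule keq_sym[OF row_past_min[OF assms(4,1) sB]])
  finally show ?thesis .
qed

text \<open>Each initial piece Z passes the stack of all remainders below it by
  \<open>rows_past_list\<close>. With pieces of length at most one this strips off a column, which
  is how row words become column words.\<close>

lemma rword_peel:
  assumes "stacked (map snd ZR @ Rs)" "\<forall>(Z, R)\<in>set ZR. sorted_wrt (<) (Z @ R)"
  shows "keq (rword (map (\<lambda>(Z, R). Z @ R) ZR @ Rs)) (rword (map fst ZR) @ rword (map snd ZR @ Rs))"
  using assms
proof (induction ZR)
  case Nil then show ?case by (simp add: keq_refl)
next
  case (Cons x ZR)
  obtain Z R where x: "x = (Z, R)" by fastforce
  have st: "stacked (R # map snd ZR @ Rs)" using Cons.prems x by simp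
  then have st': "stacked (map snd ZR @ Rs)" by (cases "map snd ZR @ Rs") auto
  have sR: "sorted_wrt (<) (Z @ R)" using Cons.prems x by auto
  have IH: "keq (rword (map (\<lambda>(Z, R). Z @ R) ZR @ Rs)) (rword (map fst ZR) @ rword (map snd ZR @ Rs))"
    using Cons.IH[OF st'] Cons.prems by auto
  have "keq (rword (map (\<lambda>(Z, R). Z @ R) (x # ZR) @ Rs))
      (rword (map fst ZR) @ rword (map snd ZR @ Rs) @ Z @ R)"
    by (rule keq_ctx[OF IH, of _ "[]" "Z @ R"]) (simp_all add: x)
  also have "keq \<dots> (rword (map fst ZR) @ Z @ rword (map snd ZR @ Rs) @ R)"
    by (rule keq_ctx[OF rows_past_list[OF st sR], of _ "rword (map fst ZR)" "[]"]) simp_all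
  finally show ?case by (simp add: x)
qed

section \<open>Weak equivalence and stacks of shifted rows\<close>

abbreviation (input) weq :: "nat list \<Rightarrow> nat list \<Rightarrow> bool" where
  "weq \<equiv> weak_kk_equiv"

lemma weq_refl: "weq u u"
  by (simp add: weak_kk_equiv_def)

lemma weq_sym: "weq u v \<Longrightarrow> weq v u"
  by (metis weak_kk_equiv_def equivclp_sym)

lemma weq_trans [trans]: "weq u v \<Longrightarrow> weq v w \<Longrightarrow> weq u w"
  by (metis weak_kk_equiv_def equivclp_trans)

lemma kk_step_weq: "kk_step u v \<Longrightarrow> weq u v"
  by (auto simp: weak_kk_equiv_def)

lemma keq_weq: "keq u v \<Longrightarrow> weq u v"
proof (induction rule: keq.induct)
  case (keq_trans u v w) then show ?case using weq_trans by blast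
qed (blast intro: weq_refl weq_sym kk_step_weq kk_step.intros)+

lemma keq_weq_trans [trans]: "keq u v \<Longrightarrow> weq v w \<Longrightarrow> weq u w"
  using keq_weq weq_trans by blast

lemma weq_keq_trans [trans]: "weq u v \<Longrightarrow> keq v w \<Longrightarrow> weq u w"
  using keq_weq weq_trans by blast

lemma kk_step_append: "kk_step u v \<Longrightarrow> kk_step (u @ q) (v @ q)"
proof (induction rule: kk_step.induct)
  case (idem u a v) then show ?case using kk_step.idem[of u a "v @ q"] by simp
next
  case (braid a b u v) then show ?case using kk_step.braid[of a b u "v @ q"] by simp
next
  case (knuth1 a b c u v) then show ?case using kk_step.knuth1[of a b c u "v @ q"] by simp
next
  case (knuth2 a b c u v) then show ?case using kk_step.knuth2[of a b c u "v @ q"] by simp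
next
  case (first a b u) then show ?case using kk_step.first[of a b "u @ q"] by simp
qed

text \<open>Words are adjoined on the right only, because the exchange of the first two letters is
  tied to the front.\<close>

lemma weq_append: "weq u v \<Longrightarrow> weq (u @ q) (v @ q)"
  unfolding weak_kk_equiv_def
proof (induction rule: equivclp_induct)
  case (step y z)
  have "equivclp kk_step (y @ q) (z @ q)"
    using step(2) kk_step_append by (metis converse_r_into_equivclp r_into_equivclp)
  then show ?case using step(3) equivclp_trans by metis
qed simp

lemma weq_ctx: "weq u v \<Longrightarrow> s = u @ q \<Longrightarrow> t = v @ q \<Longrightarrow> weq s t"
  using weq_append by simp

lemma weq_first: "weq (a # b # u) (b # a # u)"
proof -
  have "weq (a # b # u) (b # a # u)" if "a < b" for a b
    using kk_step_weq[OF kk_step.first[OF that, of u]] by simp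
  then show ?thesis using weq_sym weq_refl by (metis linorder_neqE_nat)
qed

text \<open>Here \<open>tl A\<close> drops the diagonal box, so that the rest of the row is aligned
  with the row beneath it.\<close>

fun shifted_stack :: "nat list list \<Rightarrow> bool" where
  "shifted_stack [] = True"
| "shifted_stack [A] = sorted_wrt (<) A"
| "shifted_stack (A # B # Rs) = (sorted_wrt (<) A \<and> above (tl A) B \<and> shifted_stack (B # Rs))"

lemma shifted_stack_sorted: "shifted_stack (A # Rs) \<Longrightarrow> sorted_wrt (<) A"
  by (cases Rs) auto

lemma shifted_stack_tl: "shifted_stack (A # Rs) \<Longrightarrow> shifted_stack Rs"
  by (cases Rs) auto

lemma above_tl: "above (tl A) B \<Longrightarrow> sorted_wrt (<) A \<Longrightarrow> above A B"
  using above_shift[of "tl A" B "[hd A]"] by (cases A) auto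

lemma shifted_stack_stacked: "shifted_stack Rs \<Longrightarrow> stacked Rs"
  by (induction Rs rule: shifted_stack.induct) (auto intro: above_tl)

lemma shifted_stack_stacked_tl: "shifted_stack (A # Rs) \<Longrightarrow> stacked (tl A # Rs)"
  using shifted_stack_stacked by (cases Rs; cases A) auto

lemma shifted_stack_Nil: "shifted_stack ([] # Rs) \<Longrightarrow> rword Rs = []"
proof (induction Rs)
  case (Cons B Rs)
  then have "B = []" by (simp add: above_def)
  then show ?case using Cons by simp
qed simp

lemma shifted_stack_hd_less:
  "shifted_stack ((y # R) # Rs) \<Longrightarrow> a \<in> set (rword Rs) \<Longrightarrow> y < a"
proof (induction Rs arbitrary: y R)
  case (Cons B Rs)
  note st = Cons.prems(1) and IH = Cons.IH and a = Cons.prems(2)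
  show ?case
  proof (cases B)
    case Nil
    then show ?thesis using st a shifted_stack_Nil[of Rs] by auto
  next
    case (Cons b B')
    have "y < b" using st Cons by (cases R) (auto simp: above_def)
    moreover have "a \<in> set B \<or> b < a" using IH[of b B'] st a Cons by auto
    moreover have "sorted_wrt (<) B" using st shifted_stack_sorted[of B Rs] by simp
    ultimately show ?thesis using Cons by auto
  qed
qed simp

text \<open>The exchange of the first two letters of a word is used here.\<close>
lemma shifted_past_min:
  assumes "shifted_stack Rs" "\<forall>a\<in>set (rword Rs). x < a"
  shows "weq (rword Rs @ [x]) (x # rword Rs)"
  using assms
proof (induction Rs arbitrary: x)
  case Nil then show ?case by (simp add: weq_refl)
next
  case (Cons R Rs)
  note st = shifted_stack_tl[OF Cons.prems(1)]
  show ?case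
  proof (cases R)
    case Nil
    then show ?thesis using Cons.IH[OF st] Cons.prems by simp
  next
    case R: (Cons y R')
    have st': "stacked (R' # Rs)" using shifted_stack_stacked_tl[OF Cons.prems(1)] R by simp
    have yR: "sorted_wrt (<) ([y] @ R')" using shifted_stack_sorted[OF Cons.prems(1)] R by simp
    have xy: "x < y" using Cons.prems(2) R by simp
    have xR: "sorted_wrt (<) ([x] @ R')" using Cons.prems(2) R yR by simp
    have ylt: "\<forall>a\<in>set (rword Rs). y < a" using Cons.prems(1) R shifted_stack_hd_less by blast
    have "keq (rword (R # Rs) @ [x]) (rword Rs @ y # x # R')"
      using keq_ctx[OF bubble_min[of y R' x], of _ "rword Rs" "[]"] yR xy R by simp
    \<comment> \<open>The diagonal letter y is smaller than everything below it, so the induction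
      hypothesis carries it to the front. Then x follows past the lower rows, and the two are
      exchanged there.\<close>
    also have "weq \<dots> (y # rword Rs @ x # R')"
      by (rule weq_ctx[OF Cons.IH[OF st ylt], of _ "x # R'"]) simp_all
    also have "keq \<dots> (y # x # rword Rs @ R')"
      by (rule keq_ctx[OF rows_past_list[OF st' xR], of _ "[y]" "[]"]) simp_all
    also have "weq \<dots> (x # y # rword Rs @ R')" by (rule weq_first)
    also have "keq \<dots> (x # rword (R # Rs))"
      by (rule keq_ctx[OF keq_sym[OF rows_past_list[OF st' yR]], of _ "[x]" "[]"]) (simp_all add: R)
    finally show ?thesis .
  qed
qed

text \<open>The letter y is counted as the last box of the row W. Thus the diagonal letter a stands
  after a genuine shifted stack of larger letters and can go to the front; with a gone, y passes the
  rectangle of W and Z, and a returns.\<close>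

lemma max_past_upper_row:
  assumes "shifted_stack ((W @ [y]) # Us)" "sorted_wrt (<) (a # Z)" "rect_above Z W"
    "\<forall>u\<in>set (rword ((W @ [y]) # Us)). a < u"
  shows "weq (rword (W # Us) @ y # a # Z) (rword (W # Us) @ a # Z @ [y])"
proof -
  have Wy: "\<forall>w\<in>set W. w < y"
    using shifted_stack_sorted[OF assms(1)] by (simp add: sorted_wrt_append)
  have abW: "above Z W" using assms(3) by (simp add: above_def rect_above_def)
  have stW: "stacked (W # Us)"
  proof (cases Us)
    case Nil then show ?thesis using assms(3) by (simp add: rect_above_def)
  next
    case (Cons C Us')
    have ab: "above (tl (W @ [y])) C" using assms(1) Cons by simp
    have "length C \<le> length W" using ab by (simp add: above_def)
    moreover have "above (W @ [y]) C" using above_tl[OF ab] assms(1) Cons by simp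
    ultimately have "above W C" by (simp add: above_def nth_append)
    moreover have "stacked (C # Us')" using assms(1) Cons shifted_stack_stacked by simp
    ultimately show ?thesis using Cons assms(3) by (simp add: rect_above_def)
  qed
  then have stZ: "stacked (Z # W # Us)" using abW assms(2) by simp
  have s: "sorted_wrt (<) ([a] @ Z)" using assms(2) by simp
  have "weq (rword (W # Us) @ y # a # Z) (a # rword (W # Us) @ y # Z)"
    by (rule weq_ctx[OF shifted_past_min[OF assms(1,4)], of _ Z]) simp_all
  also have "keq \<dots> (a # rword (W # Us) @ Z @ [y])"
    by (rule keq_ctx[OF keq_rect[OF assms(3) Wy], of _ "a # rword Us" "[]"]) simp_all
  also have "keq \<dots> (rword (W # Us) @ a # Z @ [y])"
    by (rule keq_ctx[OF keq_sym[OF rows_past_list[OF stZ s]], of _ "[]" "[y]"]) simp_all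
  finally show ?thesis .
qed

section \<open>Shifted Hecke insertion\<close>

declare not_infinity_eq [iff del]

type_synonym array = "nat \<Rightarrow> nat \<Rightarrow> enat"

lemma enat_less_fin: "(a::enat) < b \<Longrightarrow> a \<noteq> \<infinity>"
  by (cases a) auto

text \<open>Row 0 and column 0 form a border of zeros.\<close>
definition symarr :: "array \<Rightarrow> bool" where
  "symarr D \<longleftrightarrow> (\<forall>i. D i 0 = 0) \<and> (\<forall>i j. D i j = D j i)
     \<and> (\<forall>i j. 1 \<le> i \<longrightarrow> D i j < D i (Suc j) \<or> D i (Suc j) = \<infinity>) \<and> (\<exists>N. D 1 N = \<infinity>)"

lemma symarr_zero [simp]: "symarr D \<Longrightarrow> D i 0 = 0" "symarr D \<Longrightarrow> D 0 i = 0"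
  unfolding symarr_def by metis+

lemma symarr_sym: "symarr D \<Longrightarrow> D i j = D j i"
  unfolding symarr_def by blast

lemma symarr_Suc: "symarr D \<Longrightarrow> 1 \<le> i \<Longrightarrow> D i j < D i (Suc j) \<or> D i (Suc j) = \<infinity>"
  unfolding symarr_def by metis

lemma enat_le_fin: "(a::enat) \<le> b \<Longrightarrow> b \<noteq> \<infinity> \<Longrightarrow> a \<noteq> \<infinity>"
  by (cases a; cases b) auto

lemma symarr_mono_row:
  assumes "symarr D" "j \<le> j'"
  shows "D i j \<le> D i j'"
proof (cases "i = 0")
  case False
  then have "D i j \<le> D i (Suc j)" for j using symarr_Suc[OF assms(1), of i j] by auto
  then show ?thesis using assms(2) lift_Suc_mono_le by blast
qed (use assms in simp)

lemma symarr_mono: "symarr D \<Longrightarrow> i \<le> i' \<Longrightarrow> j \<le> j' \<Longrightarrow> D i j \<le> D i' j'"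
  by (metis order_trans symarr_mono_row symarr_sym)

lemma symarr_strict: "symarr D \<Longrightarrow> 1 \<le> i \<Longrightarrow> j < j' \<Longrightarrow> D i j \<noteq> \<infinity> \<Longrightarrow> D i j < D i j'"
  by (metis Suc_leI enat_ord_simps(4) order_less_le_trans symarr_Suc symarr_mono_row)

lemma symarr_strict_col: "symarr D \<Longrightarrow> 1 \<le> j \<Longrightarrow> i < i' \<Longrightarrow> D i j \<noteq> \<infinity> \<Longrightarrow> D i j < D i' j"
  by (metis symarr_strict symarr_sym)

lemma symarr_less_index: "symarr D \<Longrightarrow> D i j < D i j' \<Longrightarrow> j < j'"
  by (meson leD leI symarr_mono_row)

lemma symarr_bound: "symarr D \<Longrightarrow> \<exists>N. \<forall>i j. 1 \<le> i \<and> 1 \<le> j \<and> (N \<le> i \<or> N \<le> j) \<longrightarrow> D i j = \<infinity>"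
proof -
  assume D: "symarr D"
  then obtain N where N: "D 1 N = \<infinity>" unfolding symarr_def by blast
  have "D i j = \<infinity>" if "1 \<le> i" "N \<le> j" for i j
    using symarr_mono[OF D that] N by simp
  then show ?thesis using symarr_sym[OF D] by metis
qed

definition upd :: "array \<Rightarrow> nat \<Rightarrow> nat \<Rightarrow> enat \<Rightarrow> nat \<Rightarrow> nat \<Rightarrow> enat" where
  "upd D i c x = (\<lambda>a b. if (a, b) = (i, c) \<or> (a, b) = (c, i) then x else D a b)"

lemma symarr_upd:
  assumes D: "symarr D" and ic: "1 \<le> i" "1 \<le> c"
    and l: "D i (c - 1) < y \<or> y = \<infinity>" and u: "D (i - 1) c < y \<or> y = \<infinity>"
    and r: "y < D i (Suc c) \<or> D i (Suc c) = \<infinity>" and d: "y < D (Suc i) c \<or> D (Suc i) c = \<infinity>"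
  shows "symarr (upd D i c y)"
proof -
  note s = symarr_sym[OF D]
  have u': "D c (i - 1) < y \<or> y = \<infinity>" using u s by metis
  have d': "y < D c (Suc i) \<or> D c (Suc i) = \<infinity>" using d s by metis
  obtain N where N: "\<And>j. N \<le> j \<Longrightarrow> 1 \<le> j \<Longrightarrow> D 1 j = \<infinity>" using symarr_bound[OF D] by (metis order_refl)
  have "upd D i c y a b < upd D i c y a (Suc b) \<or> upd D i c y a (Suc b) = \<infinity>" if "1 \<le> a" for a b
  proof -
    have "D a b < D a (Suc b) \<or> D a (Suc b) = \<infinity>" using symarr_Suc[OF D that] .
    then show ?thesis using l u' r d' ic by (auto simp: upd_def)
  qed
  moreover have "upd D i c y a b = upd D i c y b a" for a b
    using s[of a b] by (auto simp: upd_def)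
  moreover have "upd D i c y 1 (N + i + c + 1) = \<infinity>" using N by (auto simp: upd_def)
  moreover have "upd D i c y a 0 = 0" for a using D ic by (auto simp: upd_def)
  ultimately show ?thesis unfolding symarr_def by blast
qed

text \<open>The letter x inserted into row i aims at column pos D i x; it replaces the entry out D i x
  there only if the array stays increasing, and out D i x is inserted into row i + 1 in any case.\<close>
definition pos :: "array \<Rightarrow> nat \<Rightarrow> enat \<Rightarrow> nat" where
  "pos D i x = (LEAST c. x < D i c)"

definition fits :: "array \<Rightarrow> nat \<Rightarrow> enat \<Rightarrow> bool" where
  "fits D i x \<longleftrightarrow> D i (pos D i x - 1) < x \<and> D (i - 1) (pos D i x) < x"

definition bump :: "array \<Rightarrow> nat \<Rightarrow> enat \<Rightarrow> nat \<Rightarrow> nat \<Rightarrow> enat" where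
  "bump D i x = (if fits D i x then upd D i (pos D i x) x else D)"

definition out :: "array \<Rightarrow> nat \<Rightarrow> enat \<Rightarrow> enat" where
  "out D i x = D i (pos D i x)"

text \<open>The last two conditions hold for a letter that has just been bumped out of row i - 1.\<close>
definition insertable :: "array \<Rightarrow> nat \<Rightarrow> enat \<Rightarrow> bool" where
  "insertable D i x \<longleftrightarrow> symarr D \<and> 1 \<le> i \<and> x \<noteq> \<infinity> \<and> D (i - 1) 1 < x
     \<and> (\<exists>d. D (i - 1) d \<le> x \<and> x < D i d)"

lemma insertable_first:
  assumes "symarr D" "0 < x" "x \<noteq> \<infinity>"
  shows "insertable D 1 x"
proof -
  obtain N where "D 1 N = \<infinity>" using assms(1) unfolding symarr_def by blast
  then have "D (1 - 1) N \<le> x \<and> x < D 1 N" using assms by simp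
  then show ?thesis using assms unfolding insertable_def by auto
qed

text \<open>The path moves weakly left: the target lies at or before the column d of
  \<open>insertable\<close>, and this bounds the entry above it.\<close>

lemma insertable_pos:
  assumes "insertable D i x"
  shows "x < D i (pos D i x)" "1 \<le> pos D i x" "D i (pos D i x - 1) \<le> x"
    "D (i - 1) (pos D i x) \<le> x"
proof -
  from assms obtain d where D: "symarr D" and d: "D (i - 1) d \<le> x" "x < D i d"
    unfolding insertable_def by blast
  show 1: "x < D i (pos D i x)" unfolding pos_def using d(2) by (rule LeastI)
  show 2: "1 \<le> pos D i x" using 1 D by (cases "pos D i x") auto
  then have "pos D i x - 1 < pos D i x" by simp
  then show "D i (pos D i x - 1) \<le> x" unfolding pos_def using not_less_Least not_le by blast
  have "pos D i x \<le> d" unfolding pos_def using d(2) by (rule Least_le)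
  then show "D (i - 1) (pos D i x) \<le> x" using d(1) symarr_mono_row[OF D] order_trans by blast
qed

lemma pos_eqI: "symarr D \<Longrightarrow> D i (c - 1) \<le> x \<Longrightarrow> x < D i c \<Longrightarrow> pos D i x = c"
  unfolding pos_def
proof (rule Least_equality)
  fix c' assume "symarr D" "D i (c - 1) \<le> x" "x < D i c'"
  then have "c - 1 < c'" using symarr_less_index[of D i "c - 1" c'] order_le_less_trans by blast
  then show "c \<le> c'" by simp
qed

text \<open>A letter that does not fit therefore aims at column 2 or later, so that the column c - 1
  in which it is recorded exists.\<close>

lemma fits_first_column: "insertable D i x \<Longrightarrow> pos D i x = 1 \<Longrightarrow> fits D i x"
  using insertable_pos[of D i x] by (auto simp: fits_def insertable_def)

lemma bump_le: "insertable D i x \<Longrightarrow> bump D i x a b \<le> D a b"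
  using insertable_pos(1)[of D i x] symarr_sym[of D]
  by (auto simp: bump_def upd_def insertable_def)

lemma bump_pos: "insertable D i x \<Longrightarrow> bump D i x i (pos D i x) = (if fits D i x then x else out D i x)"
  by (simp add: bump_def upd_def out_def)

lemma bump_symarr:
  assumes "insertable D i x"
  shows "symarr (bump D i x)"
proof (cases "fits D i x")
  case True
  let ?p = "pos D i x"
  from assms have D: "symarr D" and i: "1 \<le> i" unfolding insertable_def by auto
  note p = insertable_pos[OF assms]
  have "x < D i (Suc ?p)" "x < D (Suc i) ?p"
    using p(1) symarr_mono[OF D, of i i ?p "Suc ?p"] symarr_mono[OF D, of i "Suc i" ?p ?p] by auto
  then show ?thesis using True symarr_upd[OF D i p(2)] by (simp add: bump_def fits_def)
qed (use assms in \<open>simp add: bump_def insertable_def\<close>)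

text \<open>The column \<open>pos D i x\<close> itself is the witness d for the next row: its new
  entry in row i is at most the bumped letter, while the entry below is larger.\<close>

lemma bump_insertable:
  assumes "insertable D i x" "out D i x \<noteq> \<infinity>"
  shows "insertable (bump D i x) (Suc i) (out D i x)"
proof -
  let ?p = "pos D i x" and ?E = "bump D i x" and ?y = "out D i x"
  from assms have D: "symarr D" and i: "1 \<le> i" unfolding insertable_def by auto
  note p = insertable_pos[OF assms(1)]
  have le: "?E a b \<le> D a b" for a b using bump_le[OF assms(1)] .
  have "?E i 1 < ?y"
  proof (cases "?p = 1")
    case True
    then show ?thesis using fits_first_column[OF assms(1) True] p(1) bump_pos[OF assms(1)]
      by (simp add: out_def)
  next
    case False
    then have "1 \<le> ?p - 1" using p(2) by simp
    then have "D i 1 \<le> x" using p(3) symarr_mono_row[OF D] order_trans by blast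
    then show ?thesis using le[of i 1] p(1) by (simp add: out_def)
  qed
  moreover have "?E i ?p \<le> ?y" using le by (simp add: out_def)
  moreover have "?E (Suc i) ?p = D (Suc i) ?p" by (auto simp: bump_def upd_def)
  then have "?y < ?E (Suc i) ?p"
    using symarr_strict_col[OF D p(2), of i "Suc i"] assms(2) by (simp add: out_def)
  ultimately show ?thesis using bump_symarr[OF assms(1)] assms(2) unfolding insertable_def by auto
qed

section \<open>Reversing a single bumping step\<close>

lemma bump_inverse:
  assumes "insertable D i x" "bump D i x = E"
  shows "D = (if fits D i x then upd E i (pos D i x) (out D i x) else E)"
    "x = (if fits D i x then E i (pos D i x) else max (E i (pos D i x - 1)) (E (i - 1) (pos D i x)))"
proof -
  let ?p = "pos D i x"
  from assms have D: "symarr D" unfolding insertable_def by auto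
  note p = insertable_pos[OF assms(1)]
  show "D = (if fits D i x then upd E i ?p (out D i x) else E)"
    using symarr_sym[OF D, of i ?p] unfolding assms(2)[symmetric]
    by (auto simp: bump_def upd_def out_def fun_eq_iff)
  \<comment> \<open>A letter that did not fit is at least both its left and its upper neighbour and
    equals one of them.\<close>
  show "x = (if fits D i x then E i ?p else max (E i (?p - 1)) (E (i - 1) ?p))"
    using assms(2) p(3,4) by (auto simp: bump_def upd_def fits_def max_def)
qed

text \<open>For a finite bumped letter these inequalities recover the target from the new array: it
  is the last column of row i whose entry is at most the bumped letter, and equality there means
  that nothing was replaced.\<close>

lemma bump_pos_bounds:
  assumes "insertable D i x"
  shows "bump D i x i (pos D i x) \<le> out D i x" "bump D i x i (pos D i x) = out D i x \<longleftrightarrow> \<not> fits D i x"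
    "out D i x \<noteq> \<infinity> \<Longrightarrow> out D i x < bump D i x i (Suc (pos D i x))"
proof -
  let ?p = "pos D i x"
  from assms have D: "symarr D" and i: "1 \<le> i" unfolding insertable_def by auto
  note p = insertable_pos[OF assms]
  show "bump D i x i ?p \<le> out D i x" using bump_le[OF assms] by (simp add: out_def)
  show "bump D i x i ?p = out D i x \<longleftrightarrow> \<not> fits D i x"
    using bump_pos[OF assms] p(1) by (auto simp: out_def)
  have "bump D i x i (Suc ?p) = D i (Suc ?p)" by (auto simp: bump_def upd_def)
  then show "out D i x \<noteq> \<infinity> \<Longrightarrow> out D i x < bump D i x i (Suc ?p)"
    using symarr_strict[OF D i, of ?p "Suc ?p"] by (simp add: out_def)
qed

lemma bump_inj:
  assumes "insertable D i x" "insertable D' i x'" "bump D i x = bump D' i x'"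
    "out D i x = out D' i x'" "out D i x \<noteq> \<infinity>"
  shows "D = D' \<and> x = x'"
proof -
  let ?E = "bump D i x"
  have E: "symarr ?E" using bump_symarr assms(1) .
  note b = bump_pos_bounds[OF assms(1)] and b' = bump_pos_bounds[OF assms(2), folded assms(3,4)]
  have "?E i (pos D i x) < ?E i (Suc (pos D' i x'))" "?E i (pos D' i x') < ?E i (Suc (pos D i x))"
    using b b' assms(5) by (meson order_le_less_trans)+
  then have "pos D i x = pos D' i x'" using symarr_less_index[OF E] by (metis less_antisym not_less_eq)
  moreover from this have "fits D i x = fits D' i x'" using b(2) b'(2) by auto
  ultimately show ?thesis
    using bump_inverse[OF assms(1) refl] bump_inverse[OF assms(2) assms(3)[symmetric]] assms(4) by metis
qed

text \<open>The choice of x is forced: a letter aiming at column p without fitting is at least both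
  neighbours and does not exceed both of them.\<close>

lemma unbump_nofit:
  assumes E: "symarr E" "1 \<le> i" "2 \<le> p" and f: "E i (p - 1) \<noteq> \<infinity>" "E (i - 1) p \<noteq> \<infinity>"
    and x: "x = max (E i (p - 1)) (E (i - 1) p)"
  shows "insertable E i x" "pos E i x = p" "\<not> fits E i x"
proof -
  have p1: "1 \<le> p" using E(3) by simp
  have xy: "x < E i p"
    using f symarr_strict[OF E(1,2), of "p - 1" p] symarr_strict_col[OF E(1) p1, of "i - 1" i] E by (simp add: x)
  have "E (i - 1) 1 < x"
  proof (cases "i = 1")
    case True
    have "E i 0 < E i (p - 1)" using symarr_strict[OF E(1,2), of 0 "p - 1"] E by simp
    then show ?thesis using True E by (simp add: less_max_iff_disj x)
  next
    case False
    have "E (i - 1) 1 \<noteq> \<infinity>" using enat_le_fin[OF symarr_mono_row[OF E(1) p1] f(2)] .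
    then have "E (i - 1) 1 < E (i - 1) p" using symarr_strict[OF E(1), of "i - 1" 1 p] False E by simp
    then show ?thesis by (simp add: less_max_iff_disj x)
  qed
  moreover have "E (i - 1) p \<le> x \<and> x < E i p" using xy by (simp add: x)
  moreover have "x \<noteq> \<infinity>" using xy enat_less_fin by simp
  ultimately show "insertable E i x" unfolding insertable_def using E by blast
  show pos: "pos E i x = p" using pos_eqI[OF E(1), of i p x] xy by (simp add: x)
  show "\<not> fits E i x" by (simp add: fits_def pos not_less) (auto simp: x max_def)
qed

lemma unbump_fit:
  assumes E: "symarr E" "1 \<le> i" "1 \<le> p" and lt: "E i p < y"
    and r: "y < E i (Suc p) \<or> E i (Suc p) = \<infinity>" and d: "y < E (Suc i) p \<or> E (Suc i) p = \<infinity>"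
    and D: "D = upd E i p y" and x: "x = E i p"
  shows "insertable D i x" "pos D i x = p" "fits D i x" "bump D i x = E" "out D i x = y"
proof -
  have fx: "x \<noteq> \<infinity>" using lt x enat_less_fin by simp
  have l: "E i (p - 1) < x"
    using symarr_strict[OF E(1,2), of "p - 1" p] E(3) x
      enat_le_fin[OF symarr_mono_row[OF E(1), of "p - 1" p i] fx[unfolded x]] by simp
  have u: "E (i - 1) p < x"
    using symarr_strict_col[OF E(1,3), of "i - 1" i] E(2) x
      enat_le_fin[OF symarr_mono[OF E(1), of "i - 1" i p p] fx[unfolded x]] by simp
  have sD: "symarr D" unfolding D
    using symarr_upd[OF E _ _ r d] less_trans[OF l lt[folded x]] less_trans[OF u lt[folded x]] by blast
  have Dl: "D i (p - 1) = E i (p - 1)" "D (i - 1) p = E (i - 1) p" "D i p = y"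
    using E by (auto simp: upd_def D)
  show pos: "pos D i x = p" using pos_eqI[OF sD, of i p x] Dl l lt x by simp
  have "D (i - 1) 1 = E (i - 1) 1" using E by (auto simp: upd_def D)
  moreover have "E (i - 1) 1 < x" using symarr_mono_row[OF E(1,3), of "i - 1"] u by simp
  moreover have "D (i - 1) p \<le> x \<and> x < D i p" using Dl u lt x by simp
  ultimately show "insertable D i x" unfolding insertable_def using sD E(2) fx by metis
  show f: "fits D i x" using Dl l u by (simp add: fits_def pos)
  have "bump D i x = upd D i p x" using f by (simp add: bump_def pos)
  then show "bump D i x = E" using symarr_sym[OF E(1), of i p] x
    by (auto simp: upd_def fun_eq_iff D)
  show "out D i x = y" using Dl pos by (simp add: out_def)
qed

text \<open>The target has to be the last column of row i with an entry at most y. If that entry is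
  y, the step replaced nothing; otherwise y is put back, and the entry removed was the inserted
  letter.\<close>

lemma bump_surj:
  assumes "insertable E (Suc i) y" "1 \<le> i"
  obtains D x where "insertable D i x" "bump D i x = E" "out D i x = y"
proof -
  from assms have E: "symarr E" and y: "y \<noteq> \<infinity>" "E i 1 < y" unfolding insertable_def by auto
  obtain d where d: "E i d \<le> y" "y < E (Suc i) d" using assms unfolding insertable_def by auto
  obtain N where "E i N = \<infinity>" using symarr_bound[OF E] assms(2) by (metis le_add2 le_add1)
  then have ex: "y < E i N" using y by simp
  define p where "p = (LEAST q. y < E i q) - 1"
  have q: "y < E i (LEAST q. y < E i q)" using ex by (rule LeastI)
  then have "(LEAST q. y < E i q) \<noteq> 0" using E by (metis not_less_zero symarr_zero(1))
  then have p: "y < E i (Suc p)" using q by (simp add: p_def)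
  have "p < (LEAST q. y < E i q)" using \<open>(LEAST q. y < E i q) \<noteq> 0\<close> by (simp add: p_def)
  then have pl: "E i p \<le> y" using not_less_Least not_le by blast
  have "1 < Suc p" using symarr_less_index[OF E order.strict_trans[OF y(2) p]] .
  then have p1: "1 \<le> p" by simp
  \<comment> \<open>The column d provided by \<open>insertable\<close> is at most p, so y is smaller
    than the entry below the target and may be put back.\<close>
  have "d < Suc p" using symarr_less_index[OF E order_le_less_trans[OF d(1) p]] .
  then have yd: "y < E (Suc i) p" using d(2) symarr_mono_row[OF E, of d p "Suc i"] by auto
  show ?thesis
  proof (cases "E i p = y")
    case True
    have p2: "2 \<le> p" using True y p1 by (cases "p = 1") auto
    have f: "E i (p - 1) \<noteq> \<infinity>" "E (i - 1) p \<noteq> \<infinity>"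
      using True y(1) enat_le_fin[OF symarr_mono_row[OF E, of "p - 1" p i]]
        enat_le_fin[OF symarr_mono[OF E, of "i - 1" i p p]] by (metis diff_le_self order_refl)+
    show ?thesis
      using that unbump_nofit[OF E assms(2) p2 f refl] True by (simp add: bump_def out_def)
  next
    case False
    then have "E i p < y" using pl by simp
    then show ?thesis using that unbump_fit[OF E assms(2) p1 _ _ _ refl refl] p yd by blast
  qed
qed

text \<open>The last three arguments are the row and the column at which the path meets an infinite
  entry, and whether the last letter is placed there.\<close>

inductive ins :: "array \<Rightarrow> nat \<Rightarrow> enat \<Rightarrow> array \<Rightarrow> nat \<Rightarrow> nat \<Rightarrow> bool \<Rightarrow> bool" where
  ins_stop: "out D i x = \<infinity> \<Longrightarrow> ins D i x (bump D i x) i (pos D i x) (fits D i x)"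
| ins_cont: "out D i x \<noteq> \<infinity> \<Longrightarrow> ins (bump D i x) (Suc i) (out D i x) E r c b \<Longrightarrow> ins D i x E r c b"

lemma ins_row_le: "ins D i x E r c b \<Longrightarrow> i \<le> r"
  by (induction rule: ins.induct) auto

text \<open>From row N on all entries are infinite, so a path that continues is still above row N
  and the distance to N decreases. The bound N persists because a continuing step changes only
  finite entries.\<close>

lemma ins_total:
  assumes "insertable D i x"
  shows "\<exists>E r c b. ins D i x E r c b"
proof -
  obtain N where N: "\<forall>i j. 1 \<le> i \<and> 1 \<le> j \<and> (N \<le> i \<or> N \<le> j) \<longrightarrow> D i j = \<infinity>"
    using symarr_bound assms unfolding insertable_def by blast
  have "insertable D i x \<Longrightarrow> \<forall>i\<ge>N. 1 \<le> i \<longrightarrow> D i 1 = \<infinity> \<Longrightarrow> \<exists>E r c b. ins D i x E r c b"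
  proof (induction "N - i" arbitrary: D i x rule: less_induct)
    case less
    show ?case
    proof (cases "out D i x = \<infinity>")
      case True then show ?thesis using ins_stop by blast
    next
      case False
      have D: "symarr D" and i1: "1 \<le> i" using less.prems unfolding insertable_def by auto
      note p = insertable_pos[OF less.prems(1)]
      have "D i 1 \<le> D i (pos D i x)" using symarr_mono_row[OF D p(2)] .
      then have "i < N" using less.prems(2) i1 False by (force simp: out_def not_le)
      moreover have "bump D i x j 1 = \<infinity>" if "N \<le> j" "1 \<le> j" for j
        using less.prems(2) that False \<open>i < N\<close> symarr_sym[OF D, of i "pos D i x"]
        by (auto simp: bump_def upd_def out_def)
      ultimately show ?thesis
        using less.hyps[of "Suc i"] bump_insertable[OF less.prems(1) False] ins_cont[OF False]
        by (metis diff_less_mono2 lessI)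
    qed
  qed
  then show ?thesis using assms N by simp
qed

lemma ins_symarr: "ins D i x E r c b \<Longrightarrow> insertable D i x \<Longrightarrow> symarr E"
  by (induction rule: ins.induct) (auto intro: bump_symarr dest: bump_insertable)

lemma ins_det: "ins D i x E r c b \<Longrightarrow> ins D i x E' r' c' b' \<Longrightarrow> E = E' \<and> r = r' \<and> c = c' \<and> b = b'"
proof (induction rule: ins.induct)
  case (ins_stop D i x) then show ?case by (auto elim: ins.cases)
next
  case (ins_cont D i x E r c b)
  from ins_cont.prems show ?case using ins_cont.hyps(1) ins_cont.IH by cases auto
qed

text \<open>The path is read backwards: its last step, with infinite output, is undone by
  \<open>bump_inverse\<close> from the recorded target, and the steps before it by
  \<open>bump_inj\<close>.\<close>

lemma ins_inj:
  "ins D i x E r c b \<Longrightarrow> insertable D i x \<Longrightarrow> ins D' i x' E r c b \<Longrightarrow> insertable D' i x' \<Longrightarrow> D = D' \<and> x = x'"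
proof (induction arbitrary: D' x' rule: ins.induct)
  case (ins_stop D i x)
  from ins_stop.prems(2) show ?case
  proof cases
    case ins_stop': ins_stop
    then show ?thesis
      using bump_inverse[OF ins_stop.prems(1) refl] bump_inverse[OF ins_stop.prems(3) refl] ins_stop.hyps
      by metis
  next
    case ins_cont then show ?thesis using ins_row_le by fastforce
  qed
next
  case (ins_cont D i x E r c b)
  from ins_cont.prems(2) show ?case
  proof cases
    case ins_stop then show ?thesis using ins_row_le[OF ins_cont.hyps(2)] by simp
  next
    case cont': ins_cont
    then show ?thesis
      using ins_cont.IH[OF bump_insertable[OF ins_cont.prems(1) ins_cont.hyps(1)] cont'(2)
          bump_insertable[OF ins_cont.prems(3) cont'(1)]]
        bump_inj[OF ins_cont.prems(1,3)] ins_cont.hyps(1) by blast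
  qed
qed

lemma ins_backwards:
  "ins D (Suc i) x E r c b \<Longrightarrow> insertable D (Suc i) x \<Longrightarrow> \<exists>D0 x0. ins D0 1 x0 E r c b \<and> insertable D0 1 x0"
proof (induction i arbitrary: D x)
  case (Suc i)
  obtain D' x' where "insertable D' (Suc i) x'" "bump D' (Suc i) x' = D" "out D' (Suc i) x' = x"
    using bump_surj[OF Suc.prems(2)] by auto
  then show ?case using Suc.IH[of D' x'] Suc.prems ins_cont[of D' "Suc i" x' E r c b]
    by (auto simp: insertable_def)
qed auto

section \<open>Row lengths and the paths of two consecutive letters\<close>

definition len :: "array \<Rightarrow> nat \<Rightarrow> nat" where
  "len D i = (LEAST c. D i (Suc c) = \<infinity>)"

lemma len_less_iff:
  assumes "symarr D" "1 \<le> i"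
  shows "D i c = \<infinity> \<longleftrightarrow> len D i < c"
proof
  obtain N where "D i (Suc N) = \<infinity>" using symarr_bound[OF assms(1)] assms(2)
    by (metis le_SucI le_add1 order_refl plus_1_eq_Suc)
  then have inf: "D i (Suc (len D i)) = \<infinity>" unfolding len_def by (rule LeastI)
  show "D i c = \<infinity>" if "len D i < c"
    using symarr_mono_row[OF assms(1), of "Suc (len D i)" c i] that inf by simp
  show "len D i < c" if "D i c = \<infinity>"
  proof (cases c)
    case 0 then show ?thesis using that assms by simp
  next
    case (Suc c') then show ?thesis using that unfolding len_def by (metis Least_le le_imp_less_Suc)
  qed
qed

lemma len_le_iff: "symarr D \<Longrightarrow> 1 \<le> i \<Longrightarrow> D i c \<noteq> \<infinity> \<longleftrightarrow> c \<le> len D i"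
  using len_less_iff not_le by blast

lemma len_eqI: "symarr D \<Longrightarrow> 1 \<le> i \<Longrightarrow> D i c \<noteq> \<infinity> \<Longrightarrow> D i (Suc c) = \<infinity> \<Longrightarrow> len D i = c"
  using len_le_iff len_less_iff by (metis le_antisym less_Suc_eq_le)

text \<open>The letters carried along the path increase, and each of them replaces a larger entry;
  all three bounds come from this.\<close>

lemma ins_changes:
  assumes "ins D i x E r c b" "insertable D i x"
  shows "E p q \<le> D p q \<and> (D p q \<le> x \<longrightarrow> E p q = D p q) \<and> (E p q = D p q \<or> x \<le> E p q)"
  using assms
proof (induction rule: ins.induct)
  case (ins_stop D i x)
  have "x < D i (pos D i x)" "D (pos D i x) i = D i (pos D i x)"
    using insertable_pos(1) ins_stop.prems symarr_sym by (auto simp: insertable_def)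
  then show ?case using bump_le[OF ins_stop.prems] by (auto simp: bump_def upd_def)
next
  case (ins_cont D i x E r c b)
  have p: "x < D i (pos D i x)" "D (pos D i x) i = D i (pos D i x)"
    using insertable_pos(1) ins_cont.prems symarr_sym by (auto simp: insertable_def)
  then have "x < out D i x" by (simp add: out_def)
  moreover have "bump D i x p q \<le> D p q" using bump_le[OF ins_cont.prems] .
  moreover have "bump D i x p q = D p q \<or> bump D i x p q = x" "D p q \<le> x \<Longrightarrow> bump D i x p q = D p q"
    using p by (auto simp: bump_def upd_def)
  ultimately show ?case using ins_cont.IH[OF bump_insertable[OF ins_cont.prems ins_cont.hyps(1)]]
    by (metis less_imp_le order_trans)
qed

text \<open>F is the tableau E during a second insertion, which has reached the letter y.\<close>
definition tracks :: "array \<Rightarrow> array \<Rightarrow> enat \<Rightarrow> bool" where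
  "tracks E F y \<longleftrightarrow> (\<forall>p q. F p q \<le> E p q \<and> (y < E p q \<longrightarrow> F p q = E p q))"

lemma tracks_bump:
  assumes "tracks E F y" "insertable F i y"
  shows "tracks E (bump F i y) (out F i y)"
  unfolding tracks_def
proof (intro allI)
  fix p q
  note y = insertable_pos(1)[OF assms(2)]
  have s: "F (pos F i y) i = F i (pos F i y)" using assms(2) symarr_sym by (auto simp: insertable_def)
  have "bump F i y p q \<le> E p q" using bump_le[OF assms(2)] assms(1) order_trans
    unfolding tracks_def by blast
  moreover have "bump F i y p q = E p q" if "out F i y < E p q"
  proof -
    have "F p q = E p q" using that y assms(1) unfolding tracks_def out_def by (meson order.strict_trans)
    then show ?thesis using that s by (auto simp: bump_def upd_def out_def)
  qed
  ultimately show "bump F i y p q \<le> E p q \<and> (out F i y < E p q \<longrightarrow> bump F i y p q = E p q)" by blast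
qed

lemma out_le: "insertable D i x \<Longrightarrow> x < D i c \<Longrightarrow> out D i x \<le> D i c"
proof -
  assume "insertable D i x" and x: "x < D i c"
  then have D: "symarr D" unfolding insertable_def by blast
  have "pos D i x \<le> c" unfolding pos_def using x by (rule Least_le)
  then show ?thesis using symarr_mono_row[OF D] by (simp add: out_def)
qed

text \<open>The row of E after its own insertion step x has no entry strictly between x and the letter bumped out.\<close>
lemma out_mono:
  assumes x: "insertable D i x" and y: "insertable F i y" and t: "tracks E F y" and le: "x \<le> y"
    and E: "\<And>q. E i q = bump D i x i q \<or> out D i x \<le> E i q"
  shows "out D i x \<le> out F i y"
proof -
  note py = insertable_pos(1)[OF y]
  let ?q = "pos F i y"
  have Eq: "F i ?q = E i ?q \<or> E i ?q \<le> y" "F i ?q \<le> E i ?q" using t unfolding tracks_def by (auto simp: not_less)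
  then have "F i ?q = E i ?q" using py by auto
  moreover have "out D i x \<le> E i ?q"
  proof (cases "E i ?q = bump D i x i ?q")
    case True
    then have "x < bump D i x i ?q" using py \<open>F i ?q = E i ?q\<close> le by simp
    then have "bump D i x i ?q = D i ?q" by (auto simp: bump_def upd_def split: if_splits)
    then show ?thesis using out_le[OF x] \<open>x < bump D i x i ?q\<close> True by simp
  qed (use E in blast)
  ultimately show ?thesis by (simp add: out_def)
qed

text \<open>If x stands in row i after its step, the smaller y bumps out at most x. Otherwise x was
  blocked by an equal entry above its target, and the path of y stays strictly left of that target,
  among entries smaller than x.\<close>

lemma out_anti:
  assumes x: "insertable D i x" and y: "insertable F i y" and t: "tracks E F y" and lt: "y < x"
    and E: "\<And>p q. bump D i x p q \<le> x \<Longrightarrow> E p q = bump D i x p q"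
    "\<And>p q. E p q \<le> bump D i x p q"
  shows "out F i y < out D i x"
proof -
  let ?c = "pos D i x"
  note px = insertable_pos[OF x]
  have D: "symarr D" and F: "symarr F" using x y unfolding insertable_def by auto
  have Feq: "F p q = bump D i x p q" if "bump D i x p q = x" for p q
    using E(1)[of p q] that t lt unfolding tracks_def by auto
  have xo: "x < out D i x" using px by (simp add: out_def)
  show ?thesis
  proof (cases "\<exists>q. bump D i x i q = x")
    case True
    then obtain q where "F i q = x" using Feq by metis
    then show ?thesis using out_le[OF y, of q] lt xo by auto
  next
    case False
    then have nf: "\<not> fits D i x" using bump_pos[OF x] by metis
    then have b: "bump D i x = D" by (simp add: bump_def)
    then have l: "D i (?c - 1) < x" using False px(3) by (metis order_le_less)
    then have up: "D (i - 1) ?c = x" using nf px(4) by (auto simp: fits_def)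
    then have Fup: "F (i - 1) ?c = x" using Feq b by simp
    obtain d where d: "F (i - 1) d \<le> y" "y < F i d" using y unfolding insertable_def by blast
    have "d < ?c" using symarr_less_index[OF F, of "i - 1" d ?c] d(1) lt Fup by (metis order_le_less_trans)
    then have "F i d \<le> F i (?c - 1)" using symarr_mono_row[OF F] by simp
    also have "\<dots> \<le> E i (?c - 1)" using t unfolding tracks_def by blast
    also have "\<dots> \<le> D i (?c - 1)" using E(2) b by metis
    finally have "out F i y \<le> D i (?c - 1)" using out_le[OF y d(2)] by simp
    then show ?thesis using l xo by simp
  qed
qed

text \<open>In every row the two carried letters are in the same order, by \<open>out_mono\<close>
  and \<open>out_anti\<close>, and a path ends as soon as its bumped letter is infinite.\<close>

lemma ins_compare:
  assumes "ins D i x E r c b" "insertable D i x" "ins F i y G r' c' b'" "insertable F i y" "tracks E F y"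
  shows "r' \<le> r \<longleftrightarrow> x \<le> y"
  using assms
proof (induction arbitrary: F y rule: ins.induct)
  case (ins_stop D i x)
  let ?E = "bump D i x"
  show ?case
  proof (cases "x \<le> y")
    case True
    then have o: "out F i y = \<infinity>" using out_mono[OF ins_stop.prems(1,3,4) True] ins_stop.hyps by simp
    from ins_stop.prems(2) show ?thesis using o True by cases auto
  next
    case False
    then have o: "out F i y \<noteq> \<infinity>"
      using out_anti[OF ins_stop.prems(1,3,4)] enat_less_fin by (auto simp: not_le)
    from ins_stop.prems(2) show ?thesis using o False ins_row_le by cases fastforce+
  qed
next
  case (ins_cont D i x E r c b)
  note i1 = bump_insertable[OF ins_cont.prems(1) ins_cont.hyps(1)]
  note ch = ins_changes[OF ins_cont.hyps(2) i1]
  have xo: "x < out D i x" using insertable_pos(1)[OF ins_cont.prems(1)] by (simp add: out_def)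
  have E1: "E i q = bump D i x i q \<or> out D i x \<le> E i q" for q using ch by blast
  have E2: "bump D i x p q \<le> x \<Longrightarrow> E p q = bump D i x p q" for p q using ch xo by (meson less_imp_le order_trans)
  have E3: "E p q \<le> bump D i x p q" for p q using ch by blast
  have cmp: "out D i x \<le> out F i y \<longleftrightarrow> x \<le> y"
    using out_mono[OF ins_cont.prems(1,3,4) _ E1] out_anti[OF ins_cont.prems(1,3,4) _ E2 E3]
    by (meson not_le)
  from ins_cont.prems(2) show ?case
  proof cases
    case ins_stop
    then show ?thesis using cmp ins_row_le[OF ins_cont.hyps(2)] by auto
  next
    case c2: ins_cont
    show ?thesis
      using ins_cont.IH[OF i1 c2(2) bump_insertable[OF ins_cont.prems(3) c2(1)]
          tracks_bump[OF ins_cont.prems(4,3)]] cmp by simp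
  qed
qed

text \<open>A letter that does not fit at (r, c) is recorded in the bottom box of column c - 1.\<close>
definition rcol :: "nat \<Rightarrow> bool \<Rightarrow> nat" where
  "rcol c b = (if b then c else c - 1)"

text \<open>The shapes involved in an insertion ending at (r, c); b tells whether this box is new.\<close>
definition stops :: "array \<Rightarrow> array \<Rightarrow> nat \<Rightarrow> nat \<Rightarrow> bool \<Rightarrow> bool" where
  "stops D E r c b \<longleftrightarrow> symarr D \<and> symarr E \<and> 1 \<le> r \<and> 1 \<le> c \<and> D r c = \<infinity> \<and> D (r - 1) c \<noteq> \<infinity> \<and> D r (c - 1) \<noteq> \<infinity>
     \<and> (\<forall>p q. E p q = \<infinity> \<longleftrightarrow> D p q = \<infinity> \<and> \<not> (b \<and> ((p, q) = (r, c) \<or> (p, q) = (c, r))))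
     \<and> (\<not> b \<longrightarrow> 2 \<le> c)"

lemma ins_stops: "ins D i x E r c b \<Longrightarrow> insertable D i x \<Longrightarrow> stops D E r c b"
proof (induction rule: ins.induct)
  case (ins_stop D i x)
  let ?c = "pos D i x"
  note p = insertable_pos[OF ins_stop.prems]
  have D: "symarr D" "1 \<le> i" and x: "x \<noteq> \<infinity>" using ins_stop.prems unfolding insertable_def by auto
  have "\<not> fits D i x \<Longrightarrow> ?c \<noteq> 1" using fits_first_column[OF ins_stop.prems] by blast
  moreover have "D i (?c - 1) \<noteq> \<infinity>" "D (i - 1) ?c \<noteq> \<infinity>" using p(3,4) x enat_le_fin by blast+
  moreover have "D i ?c = \<infinity>" "D ?c i = \<infinity>" using ins_stop.hyps symarr_sym[OF D(1), of i ?c] by (auto simp: out_def)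
  moreover have "bump D i x p q = (if fits D i x \<and> ((p, q) = (i, ?c) \<or> (p, q) = (?c, i)) then x else D p q)" for p q
    by (simp add: bump_def upd_def)
  ultimately show ?case
    unfolding stops_def using D p(2) x bump_symarr[OF ins_stop.prems] by (auto split: if_splits)
next
  case (ins_cont D i x E r c b)
  have D: "symarr D" using ins_cont.prems unfolding insertable_def by auto
  have "bump D i x p q = \<infinity> \<longleftrightarrow> D p q = \<infinity>" for p q
    using ins_cont.hyps(1) symarr_sym[OF D, of i "pos D i x"] ins_cont.prems
    by (auto simp: bump_def upd_def out_def insertable_def)
  then show ?case using ins_cont.IH[OF bump_insertable[OF ins_cont.prems ins_cont.hyps(1)]] D
    by (simp add: stops_def)
qed

text \<open>These facts make the bottom of the recorded column a corner of the new shape; if a box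
  was added, the corner is that box.\<close>

lemma stops_rcol:
  assumes "stops D E r c b"
  shows "1 \<le> rcol c b" "E 1 (rcol c b) \<noteq> \<infinity>" "E (len E (rcol c b)) (Suc (rcol c b)) = \<infinity>"
    "b \<Longrightarrow> len E (rcol c b) = r"
proof -
  have E: "symarr E" and D: "symarr D" and rc: "1 \<le> r" "1 \<le> c" "D r c = \<infinity>" "D r (c - 1) \<noteq> \<infinity>" "\<not> b \<Longrightarrow> 2 \<le> c"
    and sh: "\<And>p q. E p q = \<infinity> \<longleftrightarrow> D p q = \<infinity> \<and> \<not> (b \<and> ((p, q) = (r, c) \<or> (p, q) = (c, r)))"
    using assms unfolding stops_def by auto
  let ?e = "rcol c b"
  show e: "1 \<le> ?e" using rc by (cases b) (auto simp: rcol_def)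
  have re: "E r ?e \<noteq> \<infinity>" using sh rc by (auto simp: rcol_def)
  then show "E 1 ?e \<noteq> \<infinity>" using symarr_mono[OF E rc(1), of ?e ?e] enat_le_fin by blast
  have up: "D r (Suc c) = \<infinity>" using symarr_mono_row[OF D, of c "Suc c" r] rc(3) by simp
  have down: "D c (Suc r) = \<infinity>" using symarr_mono[OF D, of r "Suc r" c c] rc(3) symarr_sym[OF D] by simp
  show l: "len E ?e = r" if b
    using len_eqI[OF E, of c r] that rc sh down symarr_sym[OF E] re by (auto simp: rcol_def)
  show "E (len E ?e) (Suc ?e) = \<infinity>"
  proof (cases b)
    case True
    then show ?thesis using l sh up by (auto simp: rcol_def)
  next
    case False
    have "r \<le> len E ?e" using len_le_iff[OF E e] re symarr_sym[OF E] by metis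
    moreover have "Suc ?e = c" "E r c = \<infinity>" using False rc sh by (auto simp: rcol_def)
    ultimately show ?thesis using symarr_mono[OF E, of r "len E ?e" c c] by simp
  qed
qed

text \<open>A second path that ends no lower ends to the right of the first corner, or is recorded
  at that very corner. A path that ends lower is recorded weakly to the left; if it stays in the
  same column, it adds a box there, and the column length changes.\<close>

lemma stops_compare:
  assumes "stops D E r c b" "stops E G r' c' b'"
  shows "r' \<le> r \<longleftrightarrow> rcol c b < rcol c' b' \<or> rcol c b = rcol c' b' \<and> len E (rcol c b) = len G (rcol c' b')"
proof -
  have E: "symarr E" and D: "symarr D" and rc: "1 \<le> r" "1 \<le> c" "D r c = \<infinity>" "D r (c - 1) \<noteq> \<infinity>" "\<not> b \<Longrightarrow> 2 \<le> c"
    and sh: "\<And>p q. E p q = \<infinity> \<longleftrightarrow> D p q = \<infinity> \<and> \<not> (b \<and> ((p, q) = (r, c) \<or> (p, q) = (c, r)))"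
    using assms(1) unfolding stops_def by auto
  have G: "symarr G" and rc': "1 \<le> r'" "1 \<le> c'" "E r' c' = \<infinity>" "E (r' - 1) c' \<noteq> \<infinity>" "\<not> b' \<Longrightarrow> 2 \<le> c'"
    and sh': "\<And>p q. G p q = \<infinity> \<longleftrightarrow> E p q = \<infinity> \<and> \<not> (b' \<and> ((p, q) = (r', c') \<or> (p, q) = (c', r')))"
    using assms(2) unfolding stops_def by auto
  let ?e = "rcol c b" and ?e' = "rcol c' b'"
  note sr = stops_rcol[OF assms(1)] and sr' = stops_rcol[OF assms(2)]
  have re: "E r ?e \<noteq> \<infinity>" using sh rc by (auto simp: rcol_def)
  have up: "D r (Suc c) = \<infinity>" using symarr_mono_row[OF D, of c "Suc c" r] rc(3) by simp
  have rSe: "E r (Suc ?e) = \<infinity>" using sh rc up by (auto simp: rcol_def)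
  have same: "len G i = len E i" if "\<not> b'" for i using sh' that by (simp add: len_def)
  show ?thesis
  proof (cases "r' \<le> r")
    case True
    then have "E r' ?e \<noteq> \<infinity>" using re symarr_mono[OF E True, of ?e ?e] enat_le_fin by blast
    then have "?e < c'" using rc'(3) symarr_mono_row[OF E, of c' ?e r'] by (cases "?e < c'") auto
    then have "?e < ?e' \<or> ?e = ?e' \<and> \<not> b'" by (auto simp: rcol_def)
    then show ?thesis using True same[of ?e] by auto
  next
    case False
    then have "E r c' \<noteq> \<infinity>" using rc'(4) symarr_mono[OF E, of r "r' - 1" c' c']
      by (cases "r \<le> r' - 1") (auto dest: enat_le_fin)
    then have ce: "c' \<le> ?e" using rSe symarr_mono_row[OF E, of "Suc ?e" c' r] by (cases "c' \<le> ?e") auto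
    show ?thesis
    proof (cases b')
      case True
      have "len E c' < r'" using len_less_iff[OF E rc'(2)] rc'(3) symarr_sym[OF E] by metis
      then show ?thesis using True False ce sr'(4) by (auto simp: rcol_def)
    qed (use ce False rc'(5) in \<open>auto simp: rcol_def\<close>)
  qed
qed

text \<open>If a box was added, it is the bottom of the recorded column. Otherwise c is the next
  column and r is its first empty row.\<close>

lemma stops_unique:
  assumes "stops D E r c b" "stops D' E r' c' b" "rcol c b = rcol c' b"
  shows "r = r' \<and> c = c'"
proof (cases b)
  case True
  then show ?thesis using stops_rcol(4)[OF assms(1)] stops_rcol(4)[OF assms(2)] assms(3)
    by (simp add: rcol_def)
next
  case False
  have cc: "c = c'" using assms False by (auto simp: rcol_def stops_def)
  have *: "E r c = \<infinity>" "E (r - 1) c \<noteq> \<infinity>" "E r' c = \<infinity>" "E (r' - 1) c \<noteq> \<infinity>" and E: "symarr E"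
    using assms(1,2) False cc unfolding stops_def by auto
  have "\<not> r < r'" using * symarr_mono[OF E, of r "r' - 1" c c] by (cases "r \<le> r' - 1") auto
  moreover have "\<not> r' < r" using * symarr_mono[OF E, of r' "r - 1" c c] by (cases "r' \<le> r - 1") auto
  ultimately show ?thesis using cc by simp
qed

text \<open>Only the recorded column and b are kept: with the final array they determine the end of
  the path, by \<open>stops_unique\<close>.\<close>

definition inserts :: "array \<Rightarrow> enat \<Rightarrow> array \<Rightarrow> nat \<Rightarrow> bool \<Rightarrow> bool" where
  "inserts D x E e b \<longleftrightarrow> insertable D 1 x \<and> (\<exists>r c. ins D 1 x E r c b \<and> e = rcol c b)"

lemma insertable_one_iff: "insertable D 1 x \<longleftrightarrow> symarr D \<and> 0 < x \<and> x \<noteq> \<infinity>"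
  using insertable_first[of D x] by (auto simp: insertable_def)

lemma inserts_total: "symarr D \<Longrightarrow> 0 < x \<Longrightarrow> x \<noteq> \<infinity> \<Longrightarrow> \<exists>E e b. inserts D x E e b"
  unfolding inserts_def using insertable_first ins_total by metis

lemma inserts_det: "inserts D x E e b \<Longrightarrow> inserts D x E' e' b' \<Longrightarrow> E = E' \<and> e = e' \<and> b = b'"
  unfolding inserts_def by (blast dest: ins_det)

lemma inserts_inj:
  assumes "inserts D x E e b" "inserts D' x' E e b"
  shows "D = D' \<and> x = x'"
proof -
  obtain r c r' c' where i: "insertable D 1 x" "ins D 1 x E r c b" "insertable D' 1 x'" "ins D' 1 x' E r' c' b"
    and e: "rcol c b = rcol c' b" using assms unfolding inserts_def by metis
  have "r = r' \<and> c = c'" using stops_unique ins_stops i e by metis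
  then show ?thesis using ins_inj i by metis
qed

text \<open>Every corner can have been recorded, with either value of b. Emptying its box, or
  keeping the array, gives the last step; \<open>ins_backwards\<close> supplies the steps in the
  rows above.\<close>

lemma inserts_surj:
  assumes E: "symarr E" and e: "1 \<le> e" "E 1 e \<noteq> \<infinity>" "E (len E e) (Suc e) = \<infinity>"
  shows "\<exists>D x. inserts D x E e b"
proof -
  let ?r = "len E e"
  have r1: "1 \<le> ?r" using len_le_iff[OF E e(1)] e(2) symarr_sym[OF E] by metis
  have re: "E ?r e \<noteq> \<infinity>" using len_le_iff[OF E e(1)] symarr_sym[OF E] by (metis order_refl)
  have "\<exists>D i x. 1 \<le> i \<and> insertable D i x \<and> out D i x = \<infinity> \<and> bump D i x = E \<and> rcol (pos D i x) b = e \<and> fits D i x = b"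
  proof (cases b)
    case True
    have "E (Suc ?r) e = \<infinity>" using len_less_iff[OF E e(1)] symarr_sym[OF E] by (metis lessI)
    then show ?thesis
      using unbump_fit[OF E r1 e(1) _ _ _ refl refl, where y = \<infinity>] re e(3) r1 True by (auto simp: rcol_def)
  next
    case False
    \<comment> \<open>Without a new box the path ends in the column to the right of the corner, at
      the first empty row of that column.\<close>
    define i where "i = Suc (len E (Suc e))"
    have inf: "E i (Suc e) = \<infinity>" and fin: "E (i - 1) (Suc e) \<noteq> \<infinity>"
      using len_less_iff[OF E, of "Suc e"] by (auto simp: i_def symarr_sym[OF E, of _ "Suc e"])
    have "\<not> ?r < i" using e(3) fin symarr_mono[OF E, of ?r "i - 1" "Suc e" "Suc e"]
      by (cases "?r \<le> i - 1") auto
    then have "E i e \<noteq> \<infinity>" using re symarr_mono[OF E, of i ?r e e] enat_le_fin by (meson not_le order_refl)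
    then show ?thesis using unbump_nofit[OF E _ _ _ fin refl] inf False e(1)
      by (intro exI[of _ E] exI[of _ i]) (auto simp: rcol_def bump_def out_def i_def)
  qed
  then obtain D i x where i: "1 \<le> i" "insertable D i x" "out D i x = \<infinity>" "bump D i x = E"
    "rcol (pos D i x) b = e" "fits D i x = b" by blast
  then have "ins D (Suc (i - 1)) x E i (pos D i x) b" using ins_stop[of D i x] by simp
  then show ?thesis using ins_backwards[of D "i - 1" x] i unfolding inserts_def by fastforce
qed

text \<open>This translates a non-descent of the word into the relative position of two consecutive
  recorded corners.\<close>

lemma inserts_compare:
  assumes "inserts D x E e b" "inserts E y G e' b'"
  shows "x \<le> y \<longleftrightarrow> e < e' \<or> e = e' \<and> len E e = len G e'"
proof -
  obtain r c r' c' where i: "insertable D 1 x" "ins D 1 x E r c b" "e = rcol c b"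
    "insertable E 1 y" "ins E 1 y G r' c' b'" "e' = rcol c' b'" using assms unfolding inserts_def by metis
  have "r' \<le> r \<longleftrightarrow> x \<le> y" using ins_compare[OF i(2,1,5,4)] by (simp add: tracks_def)
  then show ?thesis using stops_compare[OF ins_stops[OF i(2,1)] ins_stops[OF i(5,4)]] i by simp
qed

lemma inserts_symarr: "inserts D x E e b \<Longrightarrow> symarr D \<and> symarr E"
  using ins_symarr unfolding inserts_def insertable_def by blast

lemma inserts_corner:
  assumes "inserts D x E e b"
  shows "1 \<le> e" "E 1 e \<noteq> \<infinity>" "E (len E e) (Suc e) = \<infinity>"
    "D p q = \<infinity> \<longleftrightarrow> E p q = \<infinity> \<or> b \<and> ((p, q) = (len E e, e) \<or> (p, q) = (e, len E e))"
proof -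
  obtain r c where st: "stops D E r c b" and e: "e = rcol c b"
    using assms ins_stops unfolding inserts_def by blast
  show "1 \<le> e" "E 1 e \<noteq> \<infinity>" "E (len E e) (Suc e) = \<infinity>" using stops_rcol[OF st] e by auto
  have "D r c = \<infinity>" "D c r = \<infinity>" using st symarr_sym unfolding stops_def by metis+
  moreover have "b \<Longrightarrow> e = c \<and> len E e = r" using stops_rcol(4)[OF st] e by (simp add: rcol_def)
  moreover have "E p q = \<infinity> \<longleftrightarrow> D p q = \<infinity> \<and> \<not> (b \<and> ((p, q) = (r, c) \<or> (p, q) = (c, r)))"
    using st unfolding stops_def by blast
  ultimately show "D p q = \<infinity> \<longleftrightarrow> E p q = \<infinity> \<or> b \<and> ((p, q) = (len E e, e) \<or> (p, q) = (e, len E e))"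
    by auto
qed

section \<open>Row words under insertion\<close>

text \<open>The half-open range of columns may run past the end of the row: infinite entries are
  dropped, so one bound N serves all rows.\<close>

definition fseg :: "array \<Rightarrow> nat \<Rightarrow> nat \<Rightarrow> nat \<Rightarrow> nat list" where
  "fseg D i a b = map (\<lambda>j. the_enat (D i j)) (filter (\<lambda>j. D i j \<noteq> \<infinity>) [a..<b])"

lemma fseg_append: "a \<le> b \<Longrightarrow> b \<le> c \<Longrightarrow> fseg D i a c = fseg D i a b @ fseg D i b c"
  unfolding fseg_def by (metis filter_append le_iff_add map_append upt_add_eq_append)

lemma fseg_empty [simp]: "b \<le> a \<Longrightarrow> fseg D i a b = []"
  by (simp add: fseg_def)

lemma fseg_single: "fseg D i a (Suc a) = (if D i a = \<infinity> then [] else [the_enat (D i a)])"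
  by (simp add: fseg_def)

lemma fseg_cong: "(\<And>j. a \<le> j \<Longrightarrow> j < b \<Longrightarrow> D i j = D' i' j) \<Longrightarrow> fseg D i a b = fseg D' i' a b"
  unfolding fseg_def by (intro arg_cong2[of _ _ _ _ map] map_cong filter_cong) auto

lemma fseg_split:
  assumes "D i c \<noteq> \<infinity>" "a \<le> c" "c < b"
  shows "fseg D i a b = fseg D i a c @ the_enat (D i c) # fseg D i (Suc c) b"
proof -
  have "fseg D i a b = fseg D i a c @ fseg D i c (Suc c) @ fseg D i (Suc c) b"
    using assms fseg_append[of a c b D i] fseg_append[of c "Suc c" b D i] by simp
  then show ?thesis using assms(1) by (simp add: fseg_single)
qed

lemma fseg_inf: "symarr D \<Longrightarrow> D i a = \<infinity> \<Longrightarrow> fseg D i a b = []"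
proof -
  assume "symarr D" "D i a = \<infinity>"
  then have "D i j = \<infinity>" if "a \<le> j" for j using symarr_mono_row[of D a j i] that by simp
  then show ?thesis by (simp add: fseg_def)
qed

lemma fseg_upt:
  assumes "symarr D" "1 \<le> i"
  shows "fseg D i a b = map (\<lambda>j. the_enat (D i j)) [a..<min b (Suc (len D i))]"
proof -
  have "filter (\<lambda>j. D i j \<noteq> \<infinity>) [a..<b] = [a..<min b (Suc (len D i))]"
    unfolding len_le_iff[OF assms]
    by (induction b) (auto simp: min_def le_Suc_eq)
  then show ?thesis by (simp add: fseg_def)
qed

lemma the_enat_less: "a < b \<Longrightarrow> b \<noteq> \<infinity> \<Longrightarrow> the_enat a < the_enat b"
  by (cases a; cases b) auto

lemma symarr_strict_the: "symarr D \<Longrightarrow> 1 \<le> i \<Longrightarrow> j < j' \<Longrightarrow> D i j' \<noteq> \<infinity> \<Longrightarrow> the_enat (D i j) < the_enat (D i j')"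
  using enat_le_fin[OF symarr_mono_row[of D j j' i]] symarr_strict the_enat_less by simp

lemma fseg_sorted:
  assumes "symarr D" "1 \<le> i"
  shows "sorted_wrt (<) (fseg D i a b)"
proof -
  have "sorted_wrt (\<lambda>x y. the_enat (D i x) < the_enat (D i y)) [a..<min b (Suc (len D i))]"
    using symarr_strict_the[OF assms] len_le_iff[OF assms]
    by (intro sorted_wrt_mono_rel[OF _ sorted_wrt_upt]) auto
  then show ?thesis by (simp add: fseg_upt[OF assms] sorted_wrt_map)
qed

lemma fseg_mem: "v \<in> set (fseg D i a b) \<longleftrightarrow> (\<exists>j. a \<le> j \<and> j < b \<and> D i j \<noteq> \<infinity> \<and> v = the_enat (D i j))"
  by (auto simp: fseg_def)

lemma fseg_less:
  assumes "symarr D" "D i (c - 1) < x" "x \<noteq> \<infinity>" "v \<in> set (fseg D i a c)"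
  shows "v < the_enat x"
proof -
  obtain j where j: "j < c" "v = the_enat (D i j)" using assms(4) unfolding fseg_mem by blast
  then have "D i j \<le> D i (c - 1)" using symarr_mono_row[OF assms(1)] by simp
  then show ?thesis using assms j the_enat_less by (meson order_le_less_trans)
qed

lemma len_antimono: "symarr D \<Longrightarrow> 1 \<le> i \<Longrightarrow> len D (Suc i) \<le> len D i"
  using len_le_iff[of D i "len D (Suc i)"] len_le_iff[of D "Suc i" "len D (Suc i)"]
    symarr_mono[of D i "Suc i" "len D (Suc i)" "len D (Suc i)"] enat_le_fin by auto

text \<open>The segments may start in different columns: moving right in row i from a to a' and then
  down to the next row only increases the entry.\<close>

lemma fseg_above:
  assumes D: "symarr D" "1 \<le> i" and a: "1 \<le> a" "a \<le> a'" and l: "b' - a' \<le> b - a"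
  shows "above (fseg D i a b) (fseg D (Suc i) a' b')"
proof -
  have i': "1 \<le> Suc i" by simp
  note la = len_antimono[OF D]
  show ?thesis unfolding above_def fseg_upt[OF D] fseg_upt[OF D(1) i']
  proof (intro conjI allI impI)
    show "length (map (\<lambda>j. the_enat (D (Suc i) j)) [a'..<min b' (Suc (len D (Suc i)))])
      \<le> length (map (\<lambda>j. the_enat (D i j)) [a..<min b (Suc (len D i))])"
      using la a l by auto
    fix j assume "j < length (map (\<lambda>j. the_enat (D (Suc i) j)) [a'..<min b' (Suc (len D (Suc i)))])"
    then have j: "a' + j < b'" "a' + j < Suc (len D (Suc i))" by auto
    have fin: "D (Suc i) (a' + j) \<noteq> \<infinity>" using len_le_iff[OF D(1) i'] j by auto
    have f': "D i (a' + j) \<noteq> \<infinity>" using enat_le_fin[OF symarr_mono[OF D(1)] fin] by simp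
    have "D i (a + j) \<le> D i (a' + j)" using symarr_mono_row[OF D(1)] a by simp
    also have "\<dots> < D (Suc i) (a' + j)" using symarr_strict_col[OF D(1)] f' a by simp
    finally have "the_enat (D i (a + j)) < the_enat (D (Suc i) (a' + j))" using fin the_enat_less by blast
    moreover have "a + j < b" "a + j < Suc (len D i)" using j l a la by auto
    ultimately show "map (\<lambda>j. the_enat (D i j)) [a..<min b (Suc (len D i))] ! j
      < map (\<lambda>j. the_enat (D (Suc i) j)) [a'..<min b' (Suc (len D (Suc i)))] ! j"
      using j by (subst (1 2) nth_map) simp_all
  qed
qed

lemma fseg_rect:
  assumes D: "symarr D" "1 \<le> i" and a: "1 \<le> a" and fin: "a < b \<Longrightarrow> D (Suc i) (b - 1) \<noteq> \<infinity>"
  shows "rect_above (fseg D i a b) (fseg D (Suc i) a b)"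
proof -
  have "length (fseg D i' a b) = b - a" if "i' = i \<or> i' = Suc i" for i'
  proof (cases "a < b")
    case True
    have "D i' (b - 1) \<noteq> \<infinity>"
      using that fin[OF True] enat_le_fin[OF symarr_mono[OF D(1), of i "Suc i" "b - 1" "b - 1"]] by auto
    then have "b \<le> Suc (len D i')" using len_le_iff[OF D(1), of i' "b - 1"] that D(2) by auto
    then show ?thesis using fseg_upt[OF D(1), of i'] that D(2) by auto
  qed simp
  then show ?thesis using fseg_above[OF D a order_refl, of b b] fseg_sorted[OF D(1)] D(2)
    by (auto simp: rect_above_def above_def)
qed

lemma fseg_stacked:
  assumes D: "symarr D" and f: "\<And>j. 1 \<le> f j" "\<And>j. f j \<le> f (Suc j)" and m: "1 \<le> m"
  shows "stacked (map (\<lambda>j. fseg D j (f j) b) [m..<n])"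
  using m
proof (induction "n - m" arbitrary: m)
  case (Suc d)
  then have mn: "m < n" by simp
  show ?case
  proof (cases "Suc m < n")
    case True
    have "stacked (map (\<lambda>j. fseg D j (f j) b) [Suc m..<n])" using Suc by simp
    moreover have "above (fseg D m (f m) b) (fseg D (Suc m) (f (Suc m)) b)"
      using fseg_above[OF D] Suc.prems f by (simp add: diff_le_mono2)
    ultimately show ?thesis using True fseg_sorted[OF D Suc.prems]
      by (simp add: upt_conv_Cons)
  next
    case False
    then have "n = Suc m" using mn by simp
    then show ?thesis using fseg_sorted[OF D Suc.prems] by simp
  qed
qed simp

lemma fseg_tl_above:
  assumes D: "symarr D" "1 \<le> i"
  shows "above (tl (fseg D i i b)) (fseg D (Suc i) (Suc i) b)"
proof (cases "i < b \<and> D i i \<noteq> \<infinity>")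
  case True
  then have "tl (fseg D i i b) = fseg D i (Suc i) b" by (simp add: fseg_split[of D i i i b])
  then show ?thesis using fseg_above[OF D, of "Suc i" "Suc i" b b] by simp
next
  case False
  then have "fseg D (Suc i) (Suc i) b = []"
    using fseg_inf[OF D(1)] symarr_mono[OF D(1), of i "Suc i" i "Suc i"] by (cases "i < b") auto
  then show ?thesis by simp
qed

lemma fseg_shifted_stack:
  assumes D: "symarr D" and m: "1 \<le> m"
  shows "shifted_stack (map (\<lambda>j. fseg D j j b) [m..<n])"
  using m
proof (induction "n - m" arbitrary: m)
  case (Suc d)
  then have mn: "m < n" by simp
  show ?case
  proof (cases "Suc m < n")
    case True
    have "shifted_stack (map (\<lambda>j. fseg D j j b) [Suc m..<n])" using Suc by simp
    then show ?thesis using True fseg_sorted[OF D Suc.prems] fseg_tl_above[OF D Suc.prems]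
      by (simp add: upt_conv_Cons)
  next
    case False
    then have "n = Suc m" using mn by simp
    then show ?thesis using fseg_sorted[OF D Suc.prems] by simp
  qed
qed simp

text \<open>The row word of the part of the tableau in columns k, ..., t - 1.\<close>
definition blk :: "array \<Rightarrow> nat \<Rightarrow> nat \<Rightarrow> nat \<Rightarrow> nat list" where
  "blk D k t n = rword (map (\<lambda>j. fseg D j (max j k) t) [1..<n])"

text \<open>By symmetry, row k of D up to the diagonal is column k of the tableau; it is read here
  from bottom to top.\<close>

definition colw :: "array \<Rightarrow> nat \<Rightarrow> nat list" where
  "colw D k = rev (fseg D k 1 (Suc k))"

text \<open>\<open>rword_peel\<close> strips one box from each row that meets column k; rows below
  the diagonal box (k, k) contribute empty pieces.\<close>

lemma blk_peel:
  assumes D: "symarr D" and k: "1 \<le> k" "k < t" "k < n"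
  shows "keq (blk D k t n) (colw D k @ blk D (Suc k) t n)"
proof -
  let ?Z = "\<lambda>j. if j \<le> k then fseg D j k (Suc k) else []"
  let ?R = "\<lambda>j. fseg D j (max j (Suc k)) t"
  let ?ZR = "map (\<lambda>j. (?Z j, ?R j)) [1..<n]"
  have ZR: "?Z j @ ?R j = fseg D j (max j k) t" for j
    using fseg_append[of k "Suc k" t D j] k by (cases "j \<le> k") (auto simp: max_absorb1 max_absorb2)
  have st: "stacked (map snd ?ZR @ [])"
    using fseg_stacked[OF D, of "\<lambda>j. max j (Suc k)" 1 t n] by (simp add: comp_def)
  have so: "\<forall>(Z, R)\<in>set ?ZR. sorted_wrt (<) (Z @ R)"
    using ZR fseg_sorted[OF D] by (auto split: if_splits)
  have revc: "concat (rev zs) = rev (concat zs)" if "\<forall>z\<in>set zs. rev z = z" for zs :: "nat list list"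
    using that by (induction zs) auto
  have "concat (rev (map ?Z [1..<n])) = rev (concat (map ?Z [1..<n]))"
    by (rule revc) (auto simp: fseg_single)
  also have "concat (map ?Z [1..<n]) = concat (map ?Z [1..<Suc k])"
  proof -
    have "[1..<n] = [1..<Suc k] @ [Suc k..<n]" using k upt_add_eq_append[of 1 "Suc k" "n - Suc k"] by simp
    moreover have "concat (map ?Z [Suc k..<n]) = []" by simp
    ultimately show ?thesis by (simp only: map_append concat_append append_Nil2)
  qed
  also have "\<dots> = concat (map (\<lambda>j. fseg D j k (Suc k)) [1..<Suc k])"
    by (intro arg_cong[of _ _ concat] map_cong) auto
  also have "\<dots> = fseg D k 1 (Suc k)"
  proof -
    have "concat (map (\<lambda>j. fseg D j k (Suc k)) [1..<m]) = fseg D k 1 m" for m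
      by (induction m) (use symarr_sym[OF D] in \<open>auto simp: fseg_def\<close>)
    then show ?thesis .
  qed
  finally have "rword (map fst ?ZR) = colw D k" by (simp add: rword_def colw_def comp_def)
  then show ?thesis using rword_peel[OF st so] ZR by (simp add: blk_def comp_def)
qed

lemma blk_cols:
  assumes D: "symarr D" and k: "1 \<le> k" "k \<le> t" "t \<le> n"
  shows "keq (blk D k t n) (concat (map (colw D) [k..<t]))"
  using k
proof (induction "t - k" arbitrary: k)
  case 0
  have "blk D t t n = []" by (simp add: blk_def rword_def)
  then show ?case using 0 by (simp add: keq_refl)
next
  case (Suc d)
  then have kt: "k < t" by simp
  have "keq (blk D k t n) (colw D k @ blk D (Suc k) t n)" using blk_peel[OF D] Suc by simp
  also have "keq \<dots> (colw D k @ concat (map (colw D) [Suc k..<t]))"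
    using Suc kt by - (rule keq_ctx[of "blk D (Suc k) t n" "concat (map (colw D) [Suc k..<t])" _ "colw D k" "[]"], auto)
  finally show ?case using kt by (simp add: upt_conv_Cons)
qed

definition bounded_by :: "array \<Rightarrow> nat \<Rightarrow> bool" where
  "bounded_by D N \<longleftrightarrow> (\<forall>p q. 1 \<le> p \<longrightarrow> N \<le> q \<longrightarrow> D p q = \<infinity>)"

definition rows :: "array \<Rightarrow> nat \<Rightarrow> nat \<Rightarrow> nat \<Rightarrow> nat list" where
  "rows D N m n = rword (map (\<lambda>j. fseg D j j N) [m..<n])"

definition cols :: "array \<Rightarrow> nat \<Rightarrow> nat \<Rightarrow> nat list" where
  "cols D m n = concat (map (colw D) [m..<n])"

lemma rows_split: "m \<le> i \<Longrightarrow> i \<le> n \<Longrightarrow> rows D N m n = rows D N i n @ rows D N m i"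
  unfolding rows_def using upt_add_eq_append[of m i "n - i"] by simp

lemma rows_single [simp]: "rows D N i (Suc i) = fseg D i i N"
  by (simp add: rows_def)

lemma cols_split: "m \<le> i \<Longrightarrow> i \<le> n \<Longrightarrow> cols D m n = cols D m i @ cols D i n"
  unfolding cols_def using upt_add_eq_append[of m i "n - i"] by simp

lemma cols_single [simp]: "cols D i (Suc i) = colw D i"
  by (simp add: cols_def)

lemma rows_cong: "(\<And>j q. m \<le> j \<Longrightarrow> j < n \<Longrightarrow> j \<le> q \<Longrightarrow> D j q = D' j q) \<Longrightarrow> rows D N m n = rows D' N m n"
  unfolding rows_def by (intro arg_cong[of _ _ rword] map_cong refl fseg_cong) auto

lemma cols_cong: "(\<And>j q. m \<le> j \<Longrightarrow> j < n \<Longrightarrow> q \<le> j \<Longrightarrow> D j q = D' j q) \<Longrightarrow> cols D m n = cols D' m n"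
  unfolding cols_def colw_def by (intro arg_cong[of _ _ concat] map_cong refl arg_cong[of _ _ rev] fseg_cong) auto

lemma bump_other: "(a, b) \<noteq> (i, pos D i x) \<Longrightarrow> (a, b) \<noteq> (pos D i x, i) \<Longrightarrow> bump D i x a b = D a b"
  by (auto simp: bump_def upd_def)

lemma rows_eq_cols:
  assumes "symarr D" "1 \<le> N"
  shows "keq (rows D N 1 N) (cols D 1 N)"
proof -
  have "rows D N 1 N = blk D 1 N N"
    unfolding rows_def blk_def by (intro arg_cong[of _ _ rword] map_cong) (auto simp: max_def)
  then show ?thesis using blk_cols[OF assms(1), of 1 N N] assms(2) by (simp add: cols_def)
qed

text \<open>Blocking from above does not occur in row 1, where the border entry above is 0 and x is
  positive.\<close>

lemma not_fits_cases:
  assumes "insertable D i x" "\<not> fits D i x"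
  obtains (left) "D i (pos D i x - 1) = x" | (up) "D i (pos D i x - 1) < x" "D (i - 1) (pos D i x) = x" "2 \<le> i"
proof (cases "D i (pos D i x - 1) = x")
  case False
  then have l: "D i (pos D i x - 1) < x" using insertable_pos(3)[OF assms(1)] by simp
  then have u: "D (i - 1) (pos D i x) = x" using insertable_pos(4)[OF assms(1)] assms(2)
    by (auto simp: fits_def)
  have "i \<noteq> 1" using u assms(1) by (auto simp: insertable_def)
  then have "2 \<le> i" using assms(1) by (auto simp: insertable_def)
  then show ?thesis using l u up by blast
qed (use left in blast)

section \<open>One bumping step on the reading word\<close>

lemma segment_step:
  assumes x: "insertable D i x" and o: "out D i x \<noteq> \<infinity>" and p: "a \<le> pos D i x" "pos D i x < b"
    and e: "fits D i x \<or> D i (pos D i x - 1) = x \<and> a \<le> pos D i x - 1"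
  shows "keq (fseg D i a b @ [the_enat x]) (the_enat (out D i x) # fseg (bump D i x) i a b)"
proof -
  let ?p = "pos D i x" and ?y = "the_enat (out D i x)" and ?x = "the_enat x"
  let ?B1 = "fseg D i a ?p" and ?B2 = "fseg D i (Suc ?p) b"
  from x have D: "symarr D" and i: "1 \<le> i" and xf: "x \<noteq> \<infinity>" unfolding insertable_def by auto
  have B: "fseg D i a b = ?B1 @ ?y # ?B2"
    using fseg_split[of D i ?p a b] o p by (simp add: out_def)
  have s: "sorted_wrt (<) (?B1 @ ?y # ?B2)" using fseg_sorted[OF D i] B by metis
  have xy: "?x < ?y" using insertable_pos(1)[OF x] o the_enat_less by (simp add: out_def)
  show ?thesis
  proof (cases "fits D i x")
    case True
    have lt: "\<forall>b\<in>set ?B1. b < ?x" using fseg_less[OF D _ xf] True by (auto simp: fits_def)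
    have "bump D i x i ?p \<noteq> \<infinity>" using bump_pos[OF x] True xf by simp
    then have "fseg (bump D i x) i a b = fseg (bump D i x) i a ?p @ ?x # fseg (bump D i x) i (Suc ?p) b"
      using fseg_split[of "bump D i x" i ?p a b] p True bump_pos[OF x] by simp
    also have "fseg (bump D i x) i a ?p = ?B1"
      by (rule fseg_cong, rule bump_other) auto
    also have "fseg (bump D i x) i (Suc ?p) b = ?B2"
      by (rule fseg_cong, rule bump_other) auto
    finally show ?thesis using row_insert_replace[OF s lt xy] B by simp
  next
    case False
    then have l: "D i (?p - 1) = x" "a \<le> ?p - 1" using e by auto
    have "?B1 = fseg D i a (?p - 1) @ [?x]"
      using fseg_split[of D i "?p - 1" a ?p] l xf insertable_pos(2)[OF x] by simp
    then show ?thesis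
      using row_insert_mem[of "fseg D i a (?p - 1)" ?x ?y ?B2] s B False by (simp add: bump_def)
  qed
qed

text \<open>Row i - 1 takes part if x is blocked by an equal letter above its target. That row has
  its diagonal box as an extra first box, so the shifted form \<open>row_insert_above\<close>
  applies.\<close>

lemma row_step:
  assumes x: "insertable D i x" and o: "out D i x \<noteq> \<infinity>" and p: "i < pos D i x" and N: "bounded_by D N"
  shows "keq (fseg D i i N @ [the_enat x] @ rows D N 1 i)
    (the_enat (out D i x) # fseg (bump D i x) i i N @ rows D N 1 i)"
proof -
  let ?p = "pos D i x" and ?y = "the_enat (out D i x)" and ?x = "the_enat x"
  let ?B1 = "fseg D i i ?p" and ?B2 = "fseg D i (Suc ?p) N"
  from x have D: "symarr D" and i: "1 \<le> i" and xf: "x \<noteq> \<infinity>" unfolding insertable_def by auto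
  have pN: "?p < N" using N o i unfolding bounded_by_def out_def by (meson not_le)
  have yf: "D i ?p \<noteq> \<infinity>" using o by (simp add: out_def)
  have B: "fseg D i i N = ?B1 @ ?y # ?B2"
    using fseg_split[of D i ?p i N] yf p pN by (simp add: out_def)
  have s: "sorted_wrt (<) (?B1 @ ?y # ?B2)" using fseg_sorted[OF D i] B by metis
  have xy: "?x < ?y" using insertable_pos(1)[OF x] o the_enat_less by (simp add: out_def)
  show ?thesis
  proof (cases "fits D i x \<or> D i (?p - 1) = x")
    case True
    then have "fits D i x \<or> D i (?p - 1) = x \<and> i \<le> ?p - 1" using p by auto
    from segment_step[OF x o less_imp_le[OF p] pN this] show ?thesis
      by - (rule keq_ctx[of _ _ _ "[]" "rows D N 1 i"], auto)
  next
    case False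
    then have b: "bump D i x = D" by (simp add: bump_def)
    have "\<not> fits D i x" using False by blast
    with x show ?thesis
    proof (cases rule: not_fits_cases)
      case up
      let ?A1 = "fseg D (i - 1) i ?p" and ?A2 = "fseg D (i - 1) (Suc ?p) N"
      let ?q = "the_enat (D (i - 1) (i - 1))"
      have i1: "1 \<le> i - 1" and Si: "Suc (i - 1) = i" using up by auto
      have qf: "D (i - 1) (i - 1) \<noteq> \<infinity>" "D i (?p - 1) \<noteq> \<infinity>"
        using enat_le_fin[OF symarr_mono[OF D, of "i - 1" i "i - 1" ?p] yf] p up(1) enat_less_fin by auto
      have A': "fseg D (i - 1) i N = ?A1 @ ?x # ?A2"
        using fseg_split[of D "i - 1" ?p i N] p pN up xf by simp
      have A: "fseg D (i - 1) (i - 1) N = ?q # ?A1 @ ?x # ?A2"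
        using fseg_split[of D "i - 1" "i - 1" "i - 1" N] qf(1) p pN up A' Si by simp
      have sA: "sorted_wrt (<) (?q # ?A1 @ ?x # ?A2)" using fseg_sorted[OF D i1] A by metis
      have r: "rect_above ?A1 ?B1" using fseg_rect[OF D i1 i, of ?p] qf Si by simp
      have lt: "\<forall>b\<in>set ?B1. b < ?x" using fseg_less[OF D up(1) xf] by auto
      have ab: "above (?A1 @ ?x # ?A2) (?B1 @ ?y # ?B2)"
        using fseg_above[OF D i1 i order_refl, of N N] A' B Si by simp
      have "?x # ?A2 = fseg D (i - 1) ?p N"
        using fseg_split[of D "i - 1" ?p ?p N] up xf pN by simp
      then have ab2: "above (?x # ?A2) ?B2"
        using fseg_above[OF D i1, of ?p "Suc ?p" N N] Si p by simp
      have ne: "?B1 \<noteq> []"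
        using fseg_split[of D i "?p - 1" i ?p] qf p by simp
      have R: "rows D N 1 i = ?q # ?A1 @ ?x # ?A2 @ rows D N 1 (i - 1)"
        using rows_split[of 1 "i - 1" i D N] i1 A rows_single[of D N "i - 1"] Si by simp
      show ?thesis
        by (rule keq_ctx[OF row_insert_above[OF s sA r lt xy ab ab2 ne], of _ "[]" "rows D N 1 (i - 1)"])
          (simp_all add: B b R del: One_nat_def)
    qed (use False in blast)
  qed
qed

text \<open>Reversed column words are segments of rows i and i - 1 of D that both start in column 1.
  Hence the aligned form \<open>row_insert_above_rect\<close> applies, without an extra first
  box.\<close>

lemma col_step:
  assumes x: "insertable D i x" and o: "out D i x \<noteq> \<infinity>" and p: "pos D i x < i"
  shows "keq (colw D (i - 1) @ [the_enat x] @ colw D i)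
    (colw D (i - 1) @ colw (bump D i x) i @ [the_enat (out D i x)])"
proof -
  let ?p = "pos D i x" and ?y = "the_enat (out D i x)" and ?x = "the_enat x" and ?N = "Suc i"
  let ?B1 = "fseg D i 1 ?p" and ?B2 = "fseg D i (Suc ?p) ?N"
  let ?C = "fseg D (i - 1) 1 i"
  from x have D: "symarr D" and i: "1 \<le> i" and xf: "x \<noteq> \<infinity>" unfolding insertable_def by auto
  note p1 = insertable_pos(2)[OF x]
  have yf: "D i ?p \<noteq> \<infinity>" using o by (simp add: out_def)
  have B: "fseg D i 1 ?N = ?B1 @ ?y # ?B2"
    using fseg_split[of D i ?p 1 ?N] yf p p1 by (simp add: out_def)
  have s: "sorted_wrt (<) (?B1 @ ?y # ?B2)" using fseg_sorted[OF D i] B by metis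
  have xy: "?x < ?y" using insertable_pos(1)[OF x] o the_enat_less by (simp add: out_def)
  have "keq (fseg D i 1 ?N @ [?x] @ ?C) (?y # fseg (bump D i x) i 1 ?N @ ?C)"
  proof (cases "fits D i x \<or> D i (?p - 1) = x")
    case True
    have "1 \<le> ?p - 1" if "D i (?p - 1) = x"
      using that x by (cases "?p - 1 = 0") (auto simp: insertable_def)
    then have e: "fits D i x \<or> D i (?p - 1) = x \<and> 1 \<le> ?p - 1" using True by blast
    have "?p < ?N" using p by simp
    from segment_step[OF x o p1 this e] show ?thesis
      by - (rule keq_ctx[of _ _ _ "[]" ?C], auto)
  next
    case False
    then have b: "bump D i x = D" by (simp add: bump_def)
    have "\<not> fits D i x" using False by blast
    with x show ?thesis
    proof (cases rule: not_fits_cases)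
      case up
      let ?A1 = "fseg D (i - 1) 1 ?p" and ?A2 = "fseg D (i - 1) (Suc ?p) i"
      have i1: "1 \<le> i - 1" and Si: "Suc (i - 1) = i" using up by auto
      have qf: "D i (?p - 1) \<noteq> \<infinity>" using up(1) enat_less_fin by auto
      have A: "?C = ?A1 @ ?x # ?A2"
        using fseg_split[of D "i - 1" ?p 1 i] p p1 up xf by simp
      have sA: "sorted_wrt (<) (?A1 @ ?x # ?A2)" using fseg_sorted[OF D i1] A by metis
      have r: "rect_above ?A1 ?B1" using fseg_rect[OF D i1 order_refl, of ?p] qf Si by simp
      have lt: "\<forall>b\<in>set ?B1. b < ?x" using fseg_less[OF D up(1) xf] by auto
      have "?x # ?A2 = fseg D (i - 1) ?p i"
        using fseg_split[of D "i - 1" ?p ?p i] up xf p by simp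
      then have ab2: "above (?x # ?A2) ?B2"
        using fseg_above[OF D i1 p1, of "Suc ?p" ?N i] Si by simp
      show ?thesis
        by (rule keq_ctx[OF row_insert_above_rect[OF s sA r lt xy ab2], of _ "[]" "[]"])
          (simp_all add: B b A del: One_nat_def)
    qed (use False in blast)
  qed
  then have "keq (rev (fseg D i 1 ?N @ [?x] @ ?C)) (rev (?y # fseg (bump D i x) i 1 ?N @ ?C))"
    by (rule keq_rev)
  then show ?thesis using i by (simp add: colw_def)
qed

lemma above_append: "above A C \<Longrightarrow> above (A @ B) C"
  by (auto simp: above_def nth_append)

lemma shifted_stack_snoc:
  assumes "shifted_stack (W # Us)" "W \<noteq> []" "\<forall>w\<in>set W. w < y"
  shows "shifted_stack ((W @ [y]) # Us)"
  using assms above_append[of "tl W" _ "[y]"]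
  by (cases Us) (auto simp: sorted_wrt_append)

text \<open>Within columns up to i, the letter y exceeds all of row m + 1. It can be regarded as a
  new last box of that row, which is the situation of \<open>max_past_upper_row\<close>, and so it
  climbs over row m.\<close>

lemma triangle_step:
  assumes D: "symarr D" and m: "1 \<le> m" "m < i" and f: "D (Suc m) i < y" "y \<noteq> \<infinity>"
  shows "weq (rword (map (\<lambda>k. fseg D k k (Suc i)) [Suc m..<Suc i]) @ the_enat y # fseg D m m (Suc i))
    (rword (map (\<lambda>k. fseg D k k (Suc i)) [m..<Suc i]) @ [the_enat y])"
proof -
  let ?Z = "\<lambda>k. fseg D k k (Suc i)"
  let ?W = "?Z (Suc m)" and ?Us = "map ?Z [Suc (Suc m)..<Suc i]"
  let ?a = "the_enat (D m m)" and ?Y = "fseg D m (Suc m) (Suc i)"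
  have fin: "D (Suc m) i \<noteq> \<infinity>" using f enat_less_fin by blast
  have fm: "D m m \<noteq> \<infinity>" "D (Suc m) (Suc m) \<noteq> \<infinity>"
    using enat_le_fin[OF symarr_mono[OF D] fin] m by auto
  have Zm: "?Z m = ?a # ?Y" using fseg_split[of D m m m "Suc i"] fm m by simp
  have WU: "map ?Z [Suc m..<Suc i] = ?W # ?Us" using m by (subst upt_conv_Cons) simp_all
  have mWU: "map ?Z [m..<Suc i] = (?a # ?Y) # ?W # ?Us"
    using m Zm WU by (subst upt_conv_Cons) simp_all
  have ne: "?W \<noteq> []" using fseg_split[of D "Suc m" "Suc m" "Suc m" "Suc i"] fm m by simp
  have Wy: "\<forall>w\<in>set ?W. w < the_enat y" using fseg_less[OF D, of "Suc m" "Suc i" y] f by auto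
  have ss: "shifted_stack (?W # ?Us)" "shifted_stack ((?a # ?Y) # ?W # ?Us)"
    using fseg_shifted_stack[OF D, of "Suc m" "Suc i" "Suc i"] fseg_shifted_stack[OF D m(1), of "Suc i" "Suc i"]
    by (simp_all only: WU mWU)
  have rec: "rect_above ?Y ?W" using fseg_rect[OF D m(1), of "Suc m" "Suc i"] fin by simp
  have "?a < u" if "u \<in> set (rword (?W # ?Us))" for u using shifted_stack_hd_less[OF ss(2) that] .
  moreover have "?a < the_enat y" using calculation[of "hd ?W"] ne Wy by (auto intro: less_trans)
  ultimately have lt: "\<forall>u\<in>set (rword ((?W @ [the_enat y]) # ?Us)). ?a < u" by auto
  have "sorted_wrt (<) (?a # ?Y)" using shifted_stack_sorted[OF ss(2)] .
  then have "weq (rword (?W # ?Us) @ the_enat y # ?a # ?Y) (rword (?W # ?Us) @ ?a # ?Y @ [the_enat y])"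
    using max_past_upper_row[OF shifted_stack_snoc[OF ss(1) ne Wy] _ rec lt] by blast
  then show ?thesis unfolding WU mWU Zm by simp
qed

text \<open>The rows above m' are added one at a time. The base row is left open since the crossing
  of the diagonal starts from i if the letter fits there and from i - 1 if it is blocked.\<close>

lemma triangle_all:
  assumes D: "symarr D" and m: "1 \<le> m" "m \<le> m'" "m' \<le> i" and f: "D m' i < y" "y \<noteq> \<infinity>"
    and base: "weq (V @ rword (map (\<lambda>k. fseg D k k (Suc i)) [m'..<i]))
      (rword (map (\<lambda>k. fseg D k k (Suc i)) [m'..<Suc i]) @ [the_enat y])"
  shows "weq (V @ rword (map (\<lambda>k. fseg D k k (Suc i)) [m..<i]))
      (rword (map (\<lambda>k. fseg D k k (Suc i)) [m..<Suc i]) @ [the_enat y])"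
  using m
proof (induction "m' - m" arbitrary: m)
  case 0
  then show ?case using base by simp
next
  case (Suc d)
  let ?Z = "\<lambda>k. fseg D k k (Suc i)"
  have mi: "m < i" "Suc m \<le> m'" using Suc by auto
  then have IH: "weq (V @ rword (map ?Z [Suc m..<i])) (rword (map ?Z [Suc m..<Suc i]) @ [the_enat y])"
    using Suc by simp
  have lt: "D (Suc m) i < y" using order_le_less_trans[OF symarr_mono[OF D mi(2) order_refl] f(1)] .
  have "weq (V @ rword (map ?Z [m..<i])) (rword (map ?Z [Suc m..<Suc i]) @ the_enat y # ?Z m)"
    by (rule weq_ctx[OF IH, of _ "?Z m"]) (use mi in \<open>simp_all add: upt_conv_Cons[of m i]\<close>)
  also have "weq \<dots> (rword (map ?Z [m..<Suc i]) @ [the_enat y])"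
    using triangle_step[OF D Suc.prems(1) mi(1) lt f(2)] .
  finally show ?case .
qed

text \<open>Row reading changes to column reading here. The inserted x and the diagonal letter y are
  brought to the front and exchanged. The part to the right of column i is split off and read by
  columns, and y is carried over the remaining triangle.\<close>

lemma diag_step:
  assumes x: "insertable D i x" and o: "out D i x \<noteq> \<infinity>" and p: "pos D i x = i" and N: "bounded_by D N"
  shows "weq (rows D N i N @ [the_enat x] @ rows D N 1 i)
    (cols (bump D i x) 1 (Suc i) @ [the_enat (out D i x)] @ cols (bump D i x) (Suc i) N)"
proof -
  let ?D = "bump D i x" and ?y = "the_enat (out D i x)" and ?x = "the_enat x"
  let ?R = "fseg D i (Suc i) N" and ?U = "rows D N (Suc i) N"
  let ?Z = "\<lambda>k. fseg ?D k k (Suc i)"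
  from x have D: "symarr D" and i: "1 \<le> i" and xf: "x \<noteq> \<infinity>" unfolding insertable_def by auto
  note D' = bump_symarr[OF x]
  have yf: "D i i \<noteq> \<infinity>" and y: "out D i x = D i i" using o p by (simp_all add: out_def)
  have iN: "i < N" using N yf i unfolding bounded_by_def by (meson not_le)
  have xy: "?x < ?y" using insertable_pos(1)[OF x] o p the_enat_less by (simp add: out_def)
  have B: "fseg D i i N = ?y # ?R" using fseg_split[of D i i i N] yf iN y by simp
  have L: "map (\<lambda>j. fseg D j j N) [i..<N] = (?y # ?R) # map (\<lambda>j. fseg D j j N) [Suc i..<N]"
    using iN B by (simp add: upt_conv_Cons)
  have ss: "shifted_stack ((?y # ?R) # map (\<lambda>j. fseg D j j N) [Suc i..<N])"
    using fseg_shifted_stack[OF D i, of N N] by (simp only: L)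
  have sR: "sorted_wrt (<) (?y # ?R)" using shifted_stack_sorted[OF ss] .
  then have sxR: "sorted_wrt (<) ([?x] @ ?R)" using xy by auto
  have Uy: "weq (?U @ [?y]) (?y # ?U)"
    unfolding rows_def using shifted_past_min[OF shifted_stack_tl[OF ss]] shifted_stack_hd_less[OF ss] by blast
  have st: "stacked (?R # map (\<lambda>j. fseg D j j N) [Suc i..<N])"
    using shifted_stack_stacked_tl[OF ss] by simp
  have Ux: "keq (?U @ [?x] @ ?R) ([?x] @ ?U @ ?R)"
    unfolding rows_def by (rule rows_past_list[OF st sxR])
  let ?rest = "rows D N 1 i"
  have "keq (rows D N i N @ [?x] @ ?rest) (?U @ ?y # ?x # ?R @ ?rest)"
    by (rule keq_ctx[OF bubble_min[OF sR xy], of _ ?U ?rest])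
      (use iN B rows_split[of i "Suc i" N D N] in simp_all)
  also have "weq \<dots> (?y # ?U @ ?x # ?R @ ?rest)"
    by (rule weq_ctx[OF Uy, of _ "?x # ?R @ ?rest"]) simp_all
  also have "keq \<dots> (?y # ?x # ?U @ ?R @ ?rest)"
    by (rule keq_ctx[OF Ux, of _ "[?y]" ?rest]) simp_all
  also have "weq \<dots> (?x # ?y # ?U @ ?R @ ?rest)" by (rule weq_first)
  \<comment> \<open>Rows 1 to i - 1 are cut after column i. The right-hand pieces, with the rest of
    row i and the rows below, form a block that is read by columns.\<close>
  also have "keq (?U @ ?R @ ?rest) (rword (map ?Z [1..<i]) @ cols ?D (Suc i) N)"
  proof -
    let ?ZR = "map (\<lambda>k. (fseg D k k (Suc i), fseg D k (Suc i) N)) [1..<i]"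
    let ?Rs = "?R # map (\<lambda>j. fseg D j j N) [Suc i..<N]"
    have a: "map snd ?ZR @ ?Rs = map (\<lambda>j. fseg D j (max j (Suc i)) N) [1..<N]"
    proof -
      have "[1..<N] = [1..<i] @ i # [Suc i..<N]"
        using iN i upt_add_eq_append[of 1 i "N - i"] by (simp add: upt_conv_Cons)
      then show ?thesis by (auto simp: max_def)
    qed
    have fa: "fseg D k k (Suc i) @ fseg D k (Suc i) N = fseg D k k N" if "k < i" for k
      using fseg_append[of k "Suc i" N D k] that iN by simp
    have b: "map (\<lambda>(Z, R). Z @ R) ?ZR = map (\<lambda>j. fseg D j j N) [1..<i]"
      using fa by auto
    have "stacked (map snd ?ZR @ ?Rs)" unfolding a using fseg_stacked[OF D] by simp
    moreover have "\<forall>(Z, R)\<in>set ?ZR. sorted_wrt (<) (Z @ R)"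
      using fa fseg_sorted[OF D] by auto
    ultimately have "keq (rword (map (\<lambda>(Z, R). Z @ R) ?ZR @ ?Rs)) (rword (map fst ?ZR) @ rword (map snd ?ZR @ ?Rs))"
      by (rule rword_peel)
    then have "keq (?U @ ?R @ ?rest) (rword (map fst ?ZR) @ blk D (Suc i) N N)"
      unfolding a b by (simp add: rows_def blk_def)
    also have "keq \<dots> (rword (map fst ?ZR) @ cols D (Suc i) N)"
      using blk_cols[OF D, of "Suc i" N N] iN by - (rule keq_ctx[of _ _ _ "rword (map fst ?ZR)" "[]"], auto simp: cols_def)
    also have "cols D (Suc i) N = cols ?D (Suc i) N"
      by (rule cols_cong, rule bump_other[symmetric]) (use p in auto)
    also have "map fst ?ZR = map ?Z [1..<i]"
      by (auto intro!: fseg_cong bump_other[symmetric] simp: p)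
    finally show ?thesis .
  qed
  then have "keq (?x # ?y # ?U @ ?R @ ?rest) (([?x, ?y] @ rword (map ?Z [1..<i])) @ cols ?D (Suc i) N)"
    by - (rule keq_ctx[of _ _ _ "[?x, ?y]" "[]"], auto)
  also have "weq \<dots> ((rword (map ?Z [1..<Suc i]) @ [?y]) @ cols ?D (Suc i) N)"
  proof (rule weq_append, cases "fits D i x")
    case True
    have xd: "?D i i = x" using bump_pos[OF x] True p by simp
    have "weq ([?x, ?y] @ rword (map ?Z [i..<i])) (rword (map ?Z [i..<Suc i]) @ [?y])"
      using xd xf by (simp add: fseg_single weq_refl)
    moreover have "?D i i < out D i x" using xd insertable_pos(1)[OF x] p y by simp
    ultimately show "weq ([?x, ?y] @ rword (map ?Z [1..<i])) (rword (map ?Z [1..<Suc i]) @ [?y])"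
      using triangle_all[OF D' order_refl i order_refl _ o] by blast
  next
    case False
    then have b: "?D = D" by (simp add: bump_def)
    \<comment> \<open>On the diagonal the left and the upper neighbour are equal by symmetry, so a
      blocked x occurs at both.\<close>
    have l: "D (i - 1) i = x"
      using not_fits_cases[OF x False, unfolded p] symarr_sym[OF D, of "i - 1" i] by metis
    have "i \<noteq> 1" using fits_first_column[OF x] False p by blast
    then have i2: "2 \<le> i" using i by simp
    let ?q = "the_enat (D (i - 1) (i - 1))"
    have i1: "1 \<le> i - 1" "Suc (i - 1) = i" using i2 by auto
    have qf: "D (i - 1) (i - 1) \<noteq> \<infinity>" using enat_le_fin[OF symarr_mono_row[OF D, of "i - 1" i "i - 1"]] l xf by simp
    have qx: "?q < ?x" using symarr_strict_the[OF D i1(1), of "i - 1" i] l xf i1 by simp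
    have "fseg D (i - 1) i (Suc i) = [?x]" using l xf by (simp add: fseg_single)
    then have Zq: "fseg D (i - 1) (i - 1) (Suc i) = [?q, ?x]"
      using fseg_split[of D "i - 1" "i - 1" "i - 1" "Suc i"] qf i1 by simp
    have "[i - 1..<i] = [i - 1]" using i1 upt_conv_Cons[of "i - 1" i] by simp
    then have u: "[i - 1..<i] = [i - 1]" "[i - 1..<Suc i] = [i - 1, i]" by simp_all
    have Zi: "fseg D i i (Suc i) = [?y]" using yf y by (simp add: fseg_single)
    \<comment> \<open>The base case consists of the diagonal boxes q and y and the box x above y:
      two exchanges at the front surround a braid relation.\<close>
    have "keq [?x, ?y, ?q, ?x] [?x, ?q, ?y, ?x]"
      using keq_sym[OF keq_knuth1[OF qx xy, of "[]" "[?x]"]] by simp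
    also have "weq \<dots> [?q, ?x, ?y, ?x]" by (rule weq_first)
    also have "keq \<dots> [?q, ?y, ?x, ?y]" using keq_braid[OF xy, of "[?q]" "[]"] by simp
    also have "weq \<dots> [?y, ?q, ?x, ?y]" by (rule weq_first)
    finally have "weq ([?x, ?y] @ rword (map ?Z [i - 1..<i])) (rword (map ?Z [i - 1..<Suc i]) @ [?y])"
      unfolding u b using Zq Zi by simp
    moreover have "?D (i - 1) i < out D i x" using l b insertable_pos(1)[OF x] p y by simp
    ultimately show "weq ([?x, ?y] @ rword (map ?Z [1..<i])) (rword (map ?Z [1..<Suc i]) @ [?y])"
      using triangle_all[OF D' order_refl i1(1) _ _ o, of i] diff_le_self by blast
  qed
  also have "keq \<dots> (cols ?D 1 (Suc i) @ [?y] @ cols ?D (Suc i) N)"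
  proof -
    have "rword (map ?Z [1..<Suc i]) = blk ?D 1 (Suc i) (Suc i)"
      unfolding blk_def by (intro arg_cong[of _ _ rword] map_cong) (auto simp: max_def)
    then have "keq (rword (map ?Z [1..<Suc i])) (cols ?D 1 (Suc i))"
      using blk_cols[OF D', of 1 "Suc i" "Suc i"] by (simp add: cols_def)
    then show ?thesis by - (rule keq_ctx[of _ _ _ "[]" "[?y] @ cols ?D (Suc i) N"], auto)
  qed
  finally show ?thesis .
qed

section \<open>The end of the bumping path on the reading word\<close>

lemma bump_row_bound:
  assumes x: "insertable D i x" and N: "bounded_by (bump D i x) N"
  shows "i < N"
proof (rule ccontr)
  let ?p = "pos D i x"
  have D: "symarr D" and xf: "x \<noteq> \<infinity>" using x unfolding insertable_def by auto
  assume "\<not> i < N"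
  then have big: "bump D i x a i = \<infinity>" if "1 \<le> a" for a using N that by (simp add: bounded_by_def)
  show False
  proof (cases "fits D i x")
    case True
    then have "bump D i x ?p i = x" by (auto simp: bump_def upd_def)
    then show False using big[OF insertable_pos(2)[OF x]] xf by simp
  next
    case False
    then have "?p \<noteq> 1" using fits_first_column[OF x] by blast
    then have "1 \<le> ?p - 1" using insertable_pos(2)[OF x] by simp
    then have "D i (?p - 1) = \<infinity>" using big False symarr_sym[OF D] by (metis bump_def)
    then show False using insertable_pos(3)[OF x] xf by simp
  qed
qed

text \<open>A letter that fits is appended to row i. Otherwise it is absorbed by an equal letter,
  found to the left, above, or, for a target on the diagonal, by way of the exchange of the first
  two letters.\<close>

lemma row_stop:
  assumes x: "insertable D i x" and o: "out D i x = \<infinity>" and p: "i \<le> pos D i x"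
    and N: "bounded_by (bump D i x) N"
  shows "weq (rows D N i N @ [the_enat x] @ rows D N 1 i) (rows (bump D i x) N 1 N)"
proof -
  let ?E = "bump D i x" and ?p = "pos D i x" and ?x = "the_enat x"
  from x have D: "symarr D" and i: "1 \<le> i" and xf: "x \<noteq> \<infinity>" unfolding insertable_def by auto
  have inf: "D i ?p = \<infinity>" using o by (simp add: out_def)
  note iN = bump_row_bound[OF x N]
  have R: "rows D' N 1 N = rows D' N (Suc i) N @ fseg D' i i N @ rows D' N 1 i" for D'
    using rows_split[of 1 i N D' N] rows_split[of i "Suc i" N D' N] iN i by simp
  have Ri: "rows D N i N = rows D N (Suc i) N @ fseg D i i N"
    using rows_split[of i "Suc i" N D N] iN by simp
  have B: "fseg D i i N = fseg D i i (min N ?p)"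
    using fseg_append[of i "min N ?p" N D i] fseg_inf[OF D inf, of N] p iN by (auto simp: min_def)
  show ?thesis
  proof (cases "fits D i x")
    case True
    have ip: "?E i ?p = x" using True by (auto simp: bump_def upd_def)
    have pN: "?p < N" using N ip xf i unfolding bounded_by_def by (metis not_le)
    have "fseg ?E i i N = fseg ?E i i ?p @ ?x # fseg ?E i (Suc ?p) N"
      using fseg_split[of ?E i ?p i N] ip p pN xf by simp
    also have "fseg ?E i i ?p = fseg D i i ?p"
      by (rule fseg_cong, rule bump_other) auto
    also have "fseg ?E i (Suc ?p) N = fseg D i (Suc ?p) N"
      by (rule fseg_cong, rule bump_other) (use p in auto)
    also have "\<dots> = []" using fseg_inf[OF D] symarr_mono_row[OF D, of ?p "Suc ?p" i] inf by simp
    finally have "fseg ?E i i N = fseg D i i N @ [?x]" using B pN by (simp add: min_def)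
    moreover have "rows ?E N (Suc i) N = rows D N (Suc i) N"
      by (rule rows_cong, rule bump_other) (use p in auto)
    moreover have "rows ?E N 1 i = rows D N 1 i"
      by (rule rows_cong, rule bump_other) (use p in auto)
    ultimately show ?thesis using R[of ?E] Ri by (simp add: weq_refl)
  next
    case False
    then have E: "?E = D" by (simp add: bump_def)
    have pf: "D i (?p - 1) \<noteq> \<infinity>" using insertable_pos(3)[OF x] xf enat_le_fin by blast
    then have pN: "?p \<le> N" using N E i unfolding bounded_by_def by (metis Suc_pred' diff_Suc_1 insertable_pos(2)[OF x] less_le_trans less_numeral_extra(1) not_less_eq_eq)
    then have B: "fseg D i i N = fseg D i i ?p" using B by simp
    show ?thesis
    proof (cases "?p = i")
      case True
      have l: "D (i - 1) i = x"
        using not_fits_cases[OF x False, unfolded True] symarr_sym[OF D, of "i - 1" i] by metis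
      have "i \<noteq> 1" using fits_first_column[OF x] False True by blast
      then have i1: "1 \<le> i - 1" "Suc (i - 1) = i" using i by auto
      let ?q = "the_enat (D (i - 1) (i - 1))"
      have qf: "D (i - 1) (i - 1) \<noteq> \<infinity>" using enat_le_fin[OF symarr_mono_row[OF D, of "i - 1" i "i - 1"]] l xf by simp
      have "D j j = \<infinity>" if "i \<le> j" for j using symarr_mono[OF D that that] inf True by simp
      then have "rows D N i N = []" unfolding rows_def by (auto simp: rword_def fseg_inf[OF D])
      moreover have "fseg D (i - 1) (i - 1) N = ?q # ?x # fseg D (i - 1) (Suc i) N"
        using fseg_split[of D "i - 1" "i - 1" "i - 1" N] fseg_split[of D "i - 1" i i N] qf l xf i1 iN by simp
      then have "rows D N 1 i = ?q # ?x # fseg D (i - 1) (Suc i) N @ rows D N 1 (i - 1)"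
        using rows_split[of 1 "i - 1" i D N] rows_single[of D N "i - 1"] i1 by simp
      \<comment> \<open>Row i and all lower rows are empty here, so x stands at the very front of
        the word.\<close>
      moreover have "weq (?x # ?q # ?x # T) (?q # ?x # T)" for T
      proof -
        have "weq (?q # ?x # ?x # T) (?q # ?x # T)" using keq_weq[OF keq_idem[of "[?q]" ?x T]] by simp
        then show ?thesis using weq_trans[OF weq_first] by blast
      qed
      ultimately show ?thesis using rows_split[of 1 i N D N] E iN i by simp
    next
      case ip: False
      then have ip: "i < ?p" using p by simp
      have "keq (fseg D i i N @ [?x] @ rows D N 1 i) (fseg D i i N @ rows D N 1 i)"
        using x False
      proof (cases rule: not_fits_cases)
        case left
        have "fseg D i i N = fseg D i i (?p - 1) @ [?x]"
          using fseg_split[of D i "?p - 1" i ?p] left xf ip B by simp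
        then show ?thesis using keq_idem[of "fseg D i i (?p - 1)" ?x "rows D N 1 i"] by simp
      next
        case up
        let ?A1 = "fseg D (i - 1) i ?p" and ?A2 = "fseg D (i - 1) (Suc ?p) N"
        let ?q = "the_enat (D (i - 1) (i - 1))"
        have i1: "1 \<le> i - 1" and Si: "Suc (i - 1) = i" using up by auto
        have qf: "D (i - 1) (i - 1) \<noteq> \<infinity>"
          using enat_le_fin[OF symarr_mono[OF D, of "i - 1" i "i - 1" "?p - 1"] pf] ip by auto
        have pN': "?p < N" using N up xf i1 unfolding bounded_by_def E by (metis not_le)
        have A': "fseg D (i - 1) i N = ?A1 @ ?x # ?A2"
          using fseg_split[of D "i - 1" ?p i N] ip pN' up xf by simp
        have A: "fseg D (i - 1) (i - 1) N = ?q # ?A1 @ ?x # ?A2"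
          using fseg_split[of D "i - 1" "i - 1" "i - 1" N] qf ip pN' A' Si by simp
        have sA: "sorted_wrt (<) (?q # ?A1 @ ?x # ?A2)" using fseg_sorted[OF D i1] A by metis
        have r: "rect_above ?A1 (fseg D i i ?p)" using fseg_rect[OF D i1 i, of ?p] pf Si by simp
        have lt: "\<forall>b\<in>set (fseg D i i ?p). b < ?x" using fseg_less[OF D up(1) xf] by auto
        have ab: "above (?A1 @ ?x # ?A2) (fseg D i i ?p)"
          using fseg_above[OF D i1 i order_refl, of N N] A' B Si by simp
        have ne: "fseg D i i ?p \<noteq> []"
          using fseg_split[of D i "?p - 1" i ?p] pf ip by simp
        have R: "rows D N 1 i = ?q # ?A1 @ ?x # ?A2 @ rows D N 1 (i - 1)"
          using rows_split[of 1 "i - 1" i D N] i1 A rows_single[of D N "i - 1"] Si by simp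
        show ?thesis
          by (rule keq_ctx[OF row_stop_above[OF sA r lt ab ne], of _ "[]" "rows D N 1 (i - 1)"])
            (simp_all add: B R del: One_nat_def)
      qed
      then have "keq (rows D N i N @ [?x] @ rows D N 1 i) (rows D N 1 N)"
        by - (rule keq_ctx[of _ _ _ "rows D N (Suc i) N" "[]"], auto simp: Ri R simp del: One_nat_def)
      then show ?thesis using E keq_weq by simp
    qed
  qed
qed

text \<open>The absorption argument is applied to reversed columns, and the column word is finally
  converted into the row word.\<close>

lemma col_stop:
  assumes x: "insertable D i x" and o: "out D i x = \<infinity>" and p: "pos D i x < i"
    and N: "bounded_by (bump D i x) N"
  shows "keq (cols D 1 i @ [the_enat x] @ cols D i N) (rows (bump D i x) N 1 N)"
proof -
  let ?E = "bump D i x" and ?p = "pos D i x" and ?x = "the_enat x"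
  from x have D: "symarr D" and i: "1 \<le> i" and xf: "x \<noteq> \<infinity>" unfolding insertable_def by auto
  note p1 = insertable_pos(2)[OF x]
  have inf: "D i ?p = \<infinity>" using o by (simp add: out_def)
  note iN = bump_row_bound[OF x N]
  have C: "fseg D i 1 (Suc i) = fseg D i 1 ?p"
    using fseg_append[of 1 ?p "Suc i" D i] fseg_inf[OF D inf] p p1 by simp
  have split: "cols D' 1 N = cols D' 1 (i - 1) @ cols D' (i - 1) i @ colw D' i @ cols D' (Suc i) N" if "1 \<le> i - 1" for D'
    using cols_split[of 1 "i - 1" N D'] cols_split[of "i - 1" i N D'] cols_split[of i "Suc i" N D'] iN that by simp
  have spl: "cols D' 1 N = cols D' 1 i @ colw D' i @ cols D' (Suc i) N" for D'
    using cols_split[of 1 i N D'] cols_split[of i "Suc i" N D'] iN i by simp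
  have "keq (cols D 1 i @ [?x] @ cols D i N) (cols ?E 1 N)"
  proof (cases "fits D i x")
    case True
    have ip: "?E i ?p = x" using True by (auto simp: bump_def upd_def)
    have "fseg ?E i 1 (Suc i) = fseg ?E i 1 ?p @ ?x # fseg ?E i (Suc ?p) (Suc i)"
      using fseg_split[of ?E i ?p 1 "Suc i"] ip p p1 xf by simp
    also have "fseg ?E i 1 ?p = fseg D i 1 ?p"
      by (rule fseg_cong, rule bump_other) (use p in auto)
    also have "fseg ?E i (Suc ?p) (Suc i) = fseg D i (Suc ?p) (Suc i)"
      by (rule fseg_cong, rule bump_other) (use p in auto)
    also have "\<dots> = []" using fseg_inf[OF D] symarr_mono_row[OF D, of ?p "Suc ?p" i] inf by simp
    finally have "colw ?E i = ?x # colw D i" using C by (simp add: colw_def)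
    moreover have "cols ?E 1 i = cols D 1 i"
      by (rule cols_cong, rule bump_other) (use p in auto)
    moreover have "cols ?E (Suc i) N = cols D (Suc i) N"
      by (rule cols_cong, rule bump_other) (use p in auto)
    ultimately show ?thesis using spl[of ?E] cols_split[of i "Suc i" N D] iN by (simp add: keq_refl)
  next
    case False
    then have E: "?E = D" by (simp add: bump_def)
    have "?p \<noteq> 1" using False fits_first_column[OF x] by blast
    then have p2: "1 \<le> ?p - 1" using p1 by simp
    then have i1: "1 \<le> i - 1" and Si: "Suc (i - 1) = i" using p by auto
    have pf: "D i (?p - 1) \<noteq> \<infinity>" using insertable_pos(3)[OF x] xf enat_le_fin by blast
    let ?C = "fseg D (i - 1) 1 i"
    have "keq (fseg D i 1 ?p @ [?x] @ ?C) (fseg D i 1 ?p @ ?C)"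
      using x False
    proof (cases rule: not_fits_cases)
      case left
      have "fseg D i 1 ?p = fseg D i 1 (?p - 1) @ [?x]"
        using fseg_split[of D i "?p - 1" 1 ?p] left xf p2 by simp
      then show ?thesis using keq_idem[of "fseg D i 1 (?p - 1)" ?x ?C] by simp
    next
      case up
      let ?A1 = "fseg D (i - 1) 1 ?p" and ?A2 = "fseg D (i - 1) (Suc ?p) i"
      have A: "?C = ?A1 @ ?x # ?A2"
        using fseg_split[of D "i - 1" ?p 1 i] p p1 up xf by simp
      have r: "rect_above ?A1 (fseg D i 1 ?p)" using fseg_rect[OF D i1 order_refl, of ?p] pf Si by simp
      have lt: "\<forall>b\<in>set (fseg D i 1 ?p). b < ?x" using fseg_less[OF D up(1) xf] by auto
      show ?thesis using row_stop_above_rect[OF r lt, of ?A2] A by simp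
    qed
    then have "keq (rev (fseg D i 1 ?p @ [?x] @ ?C)) (rev (fseg D i 1 ?p @ ?C))" by (rule keq_rev)
    then have k: "keq (colw D (i - 1) @ [?x] @ colw D i) (colw D (i - 1) @ colw D i)"
      using C Si by (simp add: colw_def)
    have c1: "cols D (i - 1) i = colw D (i - 1)" using cols_single[of D "i - 1"] Si by simp
    show ?thesis unfolding E
      by (rule keq_ctx[OF k, of _ "cols D 1 (i - 1)" "cols D (Suc i) N"])
        (use split[OF i1] c1 cols_split[of 1 "i - 1" i D] cols_split[of i "Suc i" N D] iN i1 in simp_all)
  qed
  moreover have "keq (cols ?E 1 N) (rows ?E N 1 N)"
    using rows_eq_cols[OF bump_symarr[OF x], of N] iN keq_sym by simp
  ultimately show ?thesis by (rule keq_trans)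
qed

lemma bounded_by_mono: "bounded_by E N \<Longrightarrow> (\<And>p q. E p q \<le> D p q) \<Longrightarrow> bounded_by D N"
  unfolding bounded_by_def by (metis enat_ord_simps(5))

text \<open>On its way, a letter sits between rows i and i - 1 of the row word before the bumping path
  has crossed the diagonal, and between columns i - 1 and i of the column word afterwards.\<close>
lemma ins_weq:
  assumes "ins D i x E r c b" "insertable D i x" "bounded_by E N"
  shows "(D (i - 1) i \<le> x \<longrightarrow> weq (rows D N i N @ [the_enat x] @ rows D N 1 i) (rows E N 1 N))
    \<and> (x < D (i - 1) i \<longrightarrow> weq (cols D 1 i @ [the_enat x] @ cols D i N) (rows E N 1 N))"
  using assms
proof (induction rule: ins.induct)
  case (ins_stop D i x)
  note x = ins_stop.prems(1) and o = ins_stop.hyps and N = ins_stop.prems(2)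
  from x have D: "symarr D" unfolding insertable_def by blast
  have s: "D (i - 1) i = D i (i - 1)" using symarr_sym[OF D] .
  note px = insertable_pos(1,3)[OF x]
  \<comment> \<open>By symmetry \<open>D (i - 1) i\<close> is the entry of row i just left of the
    diagonal, so comparing it with x decides on which side the target lies.\<close>
  have "i \<le> pos D i x" if "D (i - 1) i \<le> x"
    using symarr_less_index[OF D, of i "i - 1" "pos D i x"] that px s by (simp add: order_le_less_trans)
  moreover have "pos D i x < i" if "x < D (i - 1) i"
  proof -
    have "pos D i x - 1 < i - 1" using symarr_less_index[OF D, of i] that px(2) s by (metis order_le_less_trans)
    then show ?thesis by simp
  qed
  ultimately show ?case using row_stop[OF x o _ N] col_stop[OF x o _ N] keq_weq by blast
next
  case (ins_cont D i x E r c b)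
  note x = ins_cont.prems(1) and o = ins_cont.hyps(1) and N = ins_cont.prems(2)
  let ?E = "bump D i x" and ?p = "pos D i x" and ?x = "the_enat x" and ?y = "the_enat (out D i x)"
  from x have D: "symarr D" and i: "1 \<le> i" unfolding insertable_def by auto
  note E = bump_symarr[OF x]
  have s: "D (i - 1) i = D i (i - 1)" using symarr_sym[OF D] .
  note px = insertable_pos[OF x]
  have ND: "bounded_by D N" using bounded_by_mono[OF N] ins_changes[OF ins.ins_cont[OF o ins_cont.hyps(2)] x] by blast
  have iN: "i < N" using ND o i px(2) symarr_sym[OF D, of i ?p] unfolding bounded_by_def out_def by (metis not_le)
  note IH = ins_cont.IH[OF bump_insertable[OF x o] N]
  note bb = bump_pos_bounds[OF x]
  show ?case
  proof (intro conjI impI)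
    assume "D (i - 1) i \<le> x"
    then have "i \<le> ?p"
      using symarr_less_index[OF D, of i "i - 1" ?p] px(1) s by (simp add: order_le_less_trans)
    then consider "i < ?p" | "?p = i" by linarith
    then show "weq (rows D N i N @ [?x] @ rows D N 1 i) (rows E N 1 N)"
    proof cases
      case 1
      have "?E i (Suc i) \<le> ?E i ?p" using symarr_mono_row[OF E] 1 by simp
      then have "?E i (Suc i) \<le> out D i x" using bb(1) order_trans by blast
      then have w: "weq (rows ?E N (Suc i) N @ [?y] @ rows ?E N 1 (Suc i)) (rows E N 1 N)" using IH by simp
      have r: "rows ?E N (Suc i) N = rows D N (Suc i) N" "rows ?E N 1 i = rows D N 1 i"
        by (rule rows_cong, rule bump_other, use 1 in auto)+
      have "keq (rows D N i N @ [?x] @ rows D N 1 i) (rows ?E N (Suc i) N @ [?y] @ rows ?E N 1 (Suc i))"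
        by (rule keq_ctx[OF row_step[OF x o 1 ND], of _ "rows D N (Suc i) N" "[]"])
          (use rows_split[of i "Suc i" N D N] rows_split[of 1 i "Suc i" ?E N] iN i r in simp_all)
      then show ?thesis using w keq_weq_trans by blast
    next
      case 2
      have "out D i x < ?E i (Suc i)" using bb(3)[OF o] 2 by simp
      then have "weq (cols ?E 1 (Suc i) @ [?y] @ cols ?E (Suc i) N) (rows E N 1 N)" using IH by simp
      then show ?thesis using diag_step[OF x o 2 ND] weq_trans by blast
    qed
  next
    assume lt: "x < D (i - 1) i"
    have "?p - 1 < i - 1" using symarr_less_index[OF D, of i] lt px(3) s by (metis order_le_less_trans)
    then have p: "?p < i" by simp
    have i1: "1 \<le> i - 1" and Si: "Suc (i - 1) = i" using p px(2) by auto
    have "?E i (Suc ?p) \<le> ?E i (Suc i)" using symarr_mono_row[OF E] p by simp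
    then have "out D i x < ?E i (Suc i)" using bb(3)[OF o] by simp
    then have w: "weq (cols ?E 1 (Suc i) @ [?y] @ cols ?E (Suc i) N) (rows E N 1 N)" using IH by simp
    have c: "cols ?E 1 (i - 1) = cols D 1 (i - 1)" "colw ?E (i - 1) = colw D (i - 1)"
      "cols ?E (Suc i) N = cols D (Suc i) N"
    proof -
      have "cols ?E m n = cols D m n" if "n \<le> i \<or> i < m" for m n
        by (rule cols_cong, rule bump_other) (use p that in auto)
      then show "cols ?E 1 (i - 1) = cols D 1 (i - 1)" "colw ?E (i - 1) = colw D (i - 1)"
        "cols ?E (Suc i) N = cols D (Suc i) N"
        using cols_single[of ?E "i - 1"] cols_single[of D "i - 1"] Si by (metis diff_le_self lessI order_refl)+
    qed
    have sp: "cols D' 1 i = cols D' 1 (i - 1) @ colw D' (i - 1)" for D'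
      using cols_split[of 1 "i - 1" i D'] cols_single[of D' "i - 1"] i1 Si by simp
    have "keq (cols D 1 i @ [?x] @ cols D i N) (cols ?E 1 (Suc i) @ [?y] @ cols ?E (Suc i) N)"
      by (rule keq_ctx[OF col_step[OF x o p], of _ "cols D 1 (i - 1)" "cols D (Suc i) N"])
        (use cols_split[of i "Suc i" N D] cols_split[of 1 i "Suc i" ?E] sp c iN i in simp_all)
    then show "weq (cols D 1 i @ [?x] @ cols D i N) (rows E N 1 N)" using w keq_weq_trans by blast
  qed
qed

lemma inserts_weq:
  assumes "inserts D x E e b" "bounded_by E N"
  shows "weq (rows D N 1 N @ [the_enat x]) (rows E N 1 N)"
proof -
  obtain r c where "ins D 1 x E r c b" and x: "insertable D 1 x" using assms unfolding inserts_def by blast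
  from ins_weq[OF this assms(2)] x show ?thesis by (simp add: insertable_def rows_def)
qed

section \<open>Weak set-valued tableaux\<close>

text \<open>A directed box (r, e) stands for the box (min r e, max r e) of the shifted diagram
  together with a mark: primed below the diagonal, unprimed on or above it.\<close>
definition tbox :: "nat \<Rightarrow> nat \<Rightarrow> nat \<times> nat" where
  "tbox r e = (min r e, max r e)"

definition occ :: "(nat \<times> nat \<Rightarrow> pletter multiset) \<Rightarrow> nat \<Rightarrow> nat \<Rightarrow> nat \<Rightarrow> bool" where
  "occ S n r e \<longleftrightarrow> 1 \<le> r \<and> 1 \<le> e \<and> (n, e < r) \<in># S (tbox r e)"

definition shifted_shape :: "(nat \<times> nat) set \<Rightarrow> bool" where
  "shifted_shape A \<longleftrightarrow> finite A \<and> (\<forall>(i, j)\<in>A. 1 \<le> i \<and> i \<le> j)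
     \<and> (\<forall>i j i' j'. (i', j') \<in> A \<longrightarrow> 1 \<le> i \<longrightarrow> i \<le> j \<longrightarrow> i \<le> i' \<longrightarrow> j \<le> j' \<longrightarrow> (i, j) \<in> A)"

lemma shifted_shape_closed:
  "shifted_shape A \<Longrightarrow> (i', j') \<in> A \<Longrightarrow> 1 \<le> i \<Longrightarrow> i \<le> j \<Longrightarrow> i \<le> i' \<Longrightarrow> j \<le> j' \<Longrightarrow> (i, j) \<in> A"
  unfolding shifted_shape_def by blast

lemma shifted_shape_bounds: "shifted_shape A \<Longrightarrow> (i, j) \<in> A \<Longrightarrow> 1 \<le> i \<and> i \<le> j"
  unfolding shifted_shape_def by blast

text \<open>The order conditions are stated for all comparable pairs of boxes instead of neighbours,
  and the cardinality bounds as uniqueness.\<close>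

definition svt :: "(nat \<times> nat) set \<Rightarrow> (nat \<times> nat \<Rightarrow> pletter multiset) \<Rightarrow> bool" where
  "svt A S \<longleftrightarrow> shifted_shape A \<and> (\<forall>b. b \<in> A \<longleftrightarrow> S b \<noteq> {#}) \<and> (\<forall>b. \<forall>x\<in>#S b. 1 \<le> fst x)
     \<and> (\<forall>i j i' j' x y. i \<le> i' \<longrightarrow> j \<le> j' \<longrightarrow> (i, j) \<noteq> (i', j') \<longrightarrow> x \<in># S (i, j) \<longrightarrow> y \<in># S (i', j') \<longrightarrow> pval x \<le> pval y)
     \<and> (\<forall>i. \<forall>x\<in>#S (i, i). \<not> snd x)
     \<and> (\<forall>n i i' j. (n, False) \<in># S (i, j) \<longrightarrow> (n, False) \<in># S (i', j) \<longrightarrow> i = i')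
     \<and> (\<forall>n i j j'. (n, True) \<in># S (i, j) \<longrightarrow> (n, True) \<in># S (i, j') \<longrightarrow> j = j')"

lemma svtD:
  assumes "svt A S"
  shows "shifted_shape A" "b \<in> A \<longleftrightarrow> S b \<noteq> {#}" "x \<in># S b \<Longrightarrow> 1 \<le> fst x"
    "i \<le> i' \<Longrightarrow> j \<le> j' \<Longrightarrow> (i, j) \<noteq> (i', j') \<Longrightarrow> x \<in># S (i, j) \<Longrightarrow> y \<in># S (i', j') \<Longrightarrow> pval x \<le> pval y"
    "x \<in># S (i, i) \<Longrightarrow> \<not> snd x"
    "(n, False) \<in># S (i, j) \<Longrightarrow> (n, False) \<in># S (i', j) \<Longrightarrow> i = i'"
    "(n, True) \<in># S (i, j) \<Longrightarrow> (n, True) \<in># S (i, j') \<Longrightarrow> j = j'"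
  by (rule assms[unfolded svt_def, THEN conjunct1]
        assms[unfolded svt_def, THEN conjunct2, THEN conjunct1, rule_format]
        assms[unfolded svt_def, THEN conjunct2, THEN conjunct2, THEN conjunct1, rule_format]
        assms[unfolded svt_def, THEN conjunct2, THEN conjunct2, THEN conjunct2, THEN conjunct1, rule_format]
        assms[unfolded svt_def, THEN conjunct2, THEN conjunct2, THEN conjunct2, THEN conjunct2, THEN conjunct1, rule_format]
        assms[unfolded svt_def, THEN conjunct2, THEN conjunct2, THEN conjunct2, THEN conjunct2, THEN conjunct2, THEN conjunct1, rule_format]
        assms[unfolded svt_def, THEN conjunct2, THEN conjunct2, THEN conjunct2, THEN conjunct2, THEN conjunct2, THEN conjunct2, rule_format];
      assumption)+

lemma svtI:
  assumes "shifted_shape A" "\<And>b. b \<in> A \<longleftrightarrow> S b \<noteq> {#}" "\<And>x b. x \<in># S b \<Longrightarrow> 1 \<le> fst x"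
    "\<And>i j i' j' x y. i \<le> i' \<Longrightarrow> j \<le> j' \<Longrightarrow> (i, j) \<noteq> (i', j') \<Longrightarrow> x \<in># S (i, j) \<Longrightarrow> y \<in># S (i', j') \<Longrightarrow> pval x \<le> pval y"
    "\<And>x i. x \<in># S (i, i) \<Longrightarrow> \<not> snd x"
    "\<And>n i i' j. (n, False) \<in># S (i, j) \<Longrightarrow> (n, False) \<in># S (i', j) \<Longrightarrow> i = i'"
    "\<And>n i j j'. (n, True) \<in># S (i, j) \<Longrightarrow> (n, True) \<in># S (i, j') \<Longrightarrow> j = j'"
  shows "svt A S"
  unfolding svt_def by (intro conjI allI impI ballI) (rule assms; assumption)+

lemma svt_box: "svt A S \<Longrightarrow> x \<in># S (i, j) \<Longrightarrow> 1 \<le> i \<and> i \<le> j \<and> (i, j) \<in> A"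
  using svtD(1,2) shifted_shape_bounds by (metis empty_not_add_mset multi_member_split)

lemma card_le_one: "finite B \<Longrightarrow> card B \<le> 1 \<longleftrightarrow> (\<forall>x\<in>B. \<forall>y\<in>B. x = y)"
  by (simp add: card_le_Suc0_iff_eq)

text \<open>The conditions on neighbours propagate along a path of boxes inside the shape: each box
  on it is nonempty and supplies a letter to compare with.\<close>

lemma weak_sv_tableau_svt:
  assumes sh: "shifted_shape (shifted_diagram lam)"
  shows "weak_sv_tableau lam S \<longleftrightarrow> svt (shifted_diagram lam) S"
proof
  let ?A = "shifted_diagram lam"
  have fin: "finite {i. (i, j) \<in> ?A \<and> P i}" "finite {j. (i, j) \<in> ?A \<and> P j}" for i j P
  proof -
    have f: "finite ?A" using sh unfolding shifted_shape_def by blast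
    have "{i. (i, j) \<in> ?A \<and> P i} \<subseteq> fst ` ?A" "{j. (i, j) \<in> ?A \<and> P j} \<subseteq> snd ` ?A" by force+
    then show "finite {i. (i, j) \<in> ?A \<and> P i}" "finite {j. (i, j) \<in> ?A \<and> P j}"
      using f finite_subset by blast+
  qed
  show "svt ?A S" if w: "weak_sv_tableau lam S"
  proof -
    have off: "S b = {#}" if "b \<notin> ?A" for b using w that unfolding weak_sv_tableau_def by blast
    have on: "S b \<noteq> {#}" "\<forall>x\<in>#S b. 1 \<le> fst x" if "b \<in> ?A" for b
      using w that unfolding weak_sv_tableau_def by blast+
    have right: "pval x \<le> pval y" if "(i, j) \<in> ?A" "(i, Suc j) \<in> ?A" "x \<in># S (i, j)" "y \<in># S (i, Suc j)" for i j x y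
    proof -
      have "Max (pval ` set_mset (S (i, j))) \<le> Min (pval ` set_mset (S (i, Suc j)))"
        using w that unfolding weak_sv_tableau_def by blast
      then show ?thesis using that(3,4)
        by (meson Max_ge Min_le finite_imageI finite_set_mset image_eqI order_trans)
    qed
    have down: "pval x \<le> pval y" if "(i, j) \<in> ?A" "(Suc i, j) \<in> ?A" "x \<in># S (i, j)" "y \<in># S (Suc i, j)" for i j x y
    proof -
      have "Max (pval ` set_mset (S (i, j))) \<le> Min (pval ` set_mset (S (Suc i, j)))"
        using w that unfolding weak_sv_tableau_def by blast
      then show ?thesis using that(3,4)
        by (meson Max_ge Min_le finite_imageI finite_set_mset image_eqI order_trans)
    qed
    have mono: "pval x \<le> pval y" if "(i, j) \<in> ?A" "(i', j') \<in> ?A" "i \<le> i'" "j \<le> j'" "(i, j) \<noteq> (i', j')"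
      "x \<in># S (i, j)" "y \<in># S (i', j')" for i j i' j' x y
      using that
    proof (induction "(i' - i) + (j' - j)" arbitrary: i j x rule: less_induct)
      case less
      have ij: "1 \<le> i" "i \<le> j" "i' \<le> j'" using shifted_shape_bounds[OF sh] less.prems by auto
      show ?case
      proof (cases "j < j'")
        case True
        have in': "(i, Suc j) \<in> ?A" using shifted_shape_closed[OF sh less.prems(2)] ij less.prems True by auto
        obtain z where z: "z \<in># S (i, Suc j)" using on(1)[OF in'] by (meson multiset_nonemptyE)
        show ?thesis
        proof (cases "(i, Suc j) = (i', j')")
          case True then show ?thesis using right[OF less.prems(1) in'] less.prems by auto
        next
          case False
          then show ?thesis using less.hyps[of i "Suc j" z] right[OF less.prems(1) in' less.prems(6) z]
              in' z less.prems True by fastforce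
        qed
      next
        case False
        then have jj: "j = j'" and ii: "i < i'" using less.prems by auto
        have in': "(Suc i, j) \<in> ?A" using shifted_shape_closed[OF sh less.prems(2)] ij jj ii by auto
        obtain z where z: "z \<in># S (Suc i, j)" using on(1)[OF in'] by (meson multiset_nonemptyE)
        show ?thesis
        proof (cases "(Suc i, j) = (i', j')")
          case True then show ?thesis using down[OF less.prems(1) in'] less.prems by auto
        next
          case False
          then show ?thesis using less.hyps[of "Suc i" j z] down[OF less.prems(1) in' less.prems(6) z]
              in' z less.prems ii jj by fastforce
        qed
      qed
    qed
    have inA: "b \<in> ?A" if "x \<in># S b" for x b using off that by (metis empty_iff set_mset_empty)
    have c: "card {i. (i, j) \<in> ?A \<and> (n, False) \<in># S (i, j)} \<le> 1"
      and r: "card {j. (i, j) \<in> ?A \<and> (n, True) \<in># S (i, j)} \<le> 1" for n i j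
      using w unfolding weak_sv_tableau_def by blast+
    have colu: "i = i'" if "(n, False) \<in># S (i, j)" "(n, False) \<in># S (i', j)" for n i i' j
      using c[of j n] that inA unfolding card_le_one[OF fin(1)] by blast
    have rowu: "j = j'" if "(n, True) \<in># S (i, j)" "(n, True) \<in># S (i, j')" for n i j j'
      using r[of i n] that inA unfolding card_le_one[OF fin(2)] by blast
    have diag: "\<forall>i. \<forall>x\<in>#S (i, i). \<not> snd x" using w unfolding weak_sv_tableau_def by blast
    show ?thesis
    proof (rule svtI[OF sh])
      show "b \<in> ?A \<longleftrightarrow> S b \<noteq> {#}" for b using off on(1) by metis
      show "1 \<le> fst x" if "x \<in># S b" for x b using on(2) inA that by metis
      show "pval x \<le> pval y" if "i \<le> i'" "j \<le> j'" "(i, j) \<noteq> (i', j')" "x \<in># S (i, j)" "y \<in># S (i', j')" for i j i' j' x y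
        using mono[OF inA[OF that(4)] inA[OF that(5)] that] .
      show "\<not> snd x" if "x \<in># S (i, i)" for x i using diag that by metis
    qed (fact colu, fact rowu)
  qed
  show "weak_sv_tableau lam S" if s: "svt ?A S"
  proof -
    note d = svtD[OF s]
    have mm: "Max (pval ` set_mset (S b)) \<le> Min (pval ` set_mset (S b'))"
      if "b \<in> ?A" "b' \<in> ?A" "\<And>x y. x \<in># S b \<Longrightarrow> y \<in># S b' \<Longrightarrow> pval x \<le> pval y" for b b'
      using that d(2) by (subst Max_le_iff) (auto simp: Min_ge_iff)
    have "Max (pval ` set_mset (S (i, j))) \<le> Min (pval ` set_mset (S (i, Suc j)))"
      if "(i, j) \<in> ?A" "(i, Suc j) \<in> ?A" for i j
      using that by (intro mm) (auto intro: d(4)[of i i j "Suc j"])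
    moreover have "Max (pval ` set_mset (S (i, j))) \<le> Min (pval ` set_mset (S (Suc i, j)))"
      if "(i, j) \<in> ?A" "(Suc i, j) \<in> ?A" for i j
      using that by (intro mm) (auto intro: d(4)[of i "Suc i" j j])
    moreover have "card {i. (i, j) \<in> ?A \<and> (n, False) \<in># S (i, j)} \<le> 1"
      "card {j. (i, j) \<in> ?A \<and> (n, True) \<in># S (i, j)} \<le> 1" for n i j
      unfolding card_le_one[OF fin(1)] card_le_one[OF fin(2)] using d(6,7) by blast+
    ultimately show ?thesis unfolding weak_sv_tableau_def using d(2,3,5) by blast
  qed
qed

lemma occ_box: "svt A S \<Longrightarrow> occ S n r e \<Longrightarrow> tbox r e \<in> A \<and> 1 \<le> n"
  using svtD(2)[of A S "tbox r e"] svtD(3)[of A S "(n, e < r)" "tbox r e"] by (auto simp: occ_def)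

lemma ex_occ:
  assumes "svt A S" "(n, pr) \<in># S (i, j)"
  shows "if pr then i < j \<and> occ S n j i else occ S n i j"
proof -
  note b = svt_box[OF assms]
  show ?thesis
  proof (cases pr)
    case True
    then have "i \<noteq> j" using svtD(5)[OF assms(1)] assms(2) by fastforce
    then have "i < j" using b by simp
    then show ?thesis using True b assms(2) by (simp add: occ_def tbox_def min_def max_def)
  next
    case False
    then show ?thesis using b assms(2) by (simp add: occ_def tbox_def min_def max_def)
  qed
qed

lemma occ_cases:
  assumes "occ S n r e"
  obtains "r \<le> e" "(n, False) \<in># S (r, e)" | "e < r" "(n, True) \<in># S (e, r)"
  using assms unfolding occ_def tbox_def by (cases "r \<le> e") (auto simp: min_def max_def split: if_splits)

lemma pval_simps [simp]: "pval (n, False) = 2 * n" "pval (n, True) = 2 * n - 1"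
  by (simp_all add: pval_def)

text \<open>From i \<le> j \<le> e < r the box (i, j) lies weakly above and to the left of (e, r),
  which would force 2n \<le> 2n - 1.\<close>

lemma occ_col_mixed:
  assumes "svt A S" "(n, False) \<in># S (i, j)" "(n, True) \<in># S (e, r)" "j \<le> e"
  shows False
proof -
  have "1 \<le> n" using svtD(3)[OF assms(1,2)] by simp
  moreover have "i \<le> j" "e < r" using svt_box[OF assms(1,2)] ex_occ[OF assms(1,3)] by auto
  then have "pval (n, False) \<le> pval (n, True)" using svtD(4)[OF assms(1) _ _ _ assms(2,3)] assms(4) by auto
  ultimately show False by simp
qed

text \<open>A directed column e consists of column e, for unprimed letters, and row e, for primed
  ones. Each kind is unique by the tableau conditions, and \<open>occ_col_mixed\<close> excludes
  that both carry n.\<close>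

lemma occ_col_unique:
  assumes "svt A S" "occ S n r e" "occ S n r' e"
  shows "r = r'"
  using assms(2)
proof (cases rule: occ_cases)
  case 1
  from assms(3) show ?thesis
    by (cases rule: occ_cases) (use 1 svtD(6)[OF assms(1)] occ_col_mixed[OF assms(1) 1(2)] in blast)+
next
  case 2
  from assms(3) show ?thesis
    by (cases rule: occ_cases) (use 2 svtD(7)[OF assms(1)] occ_col_mixed[OF assms(1) _ 2(2)] in blast)+
qed

text \<open>Consecutive insertions with equal labels record weakly increasing directed columns, so
  this singles out the letter recorded last.\<close>

definition last_occ :: "(nat \<times> nat \<Rightarrow> pletter multiset) \<Rightarrow> nat \<Rightarrow> nat \<Rightarrow> nat \<Rightarrow> bool" where
  "last_occ S n r e \<longleftrightarrow> occ S n r e \<and> (\<forall>n' r' e'. occ S n' r' e' \<longrightarrow> n' < n \<or> n' = n \<and> e' \<le> e)"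

lemma last_occ_unique:
  assumes "svt A S" "last_occ S n r e" "last_occ S n' r' e'"
  shows "n = n' \<and> r = r' \<and> e = e'"
proof -
  have "n = n'" "e = e'" using assms(2,3) unfolding last_occ_def by (metis le_antisym less_asym)+
  then show ?thesis using occ_col_unique[OF assms(1)] assms(2,3) unfolding last_occ_def by blast
qed

lemma last_occ_exists:
  assumes s: "svt A S" and ne: "A \<noteq> {}"
  shows "\<exists>n r e. last_occ S n r e"
proof -
  let ?O = "{(n, r, e). occ S n r e}"
  have "?O \<subseteq> (\<lambda>(b, x). (fst x, if snd x then snd b else fst b, if snd x then fst b else snd b)) ` (SIGMA b:A. set_mset (S b))"
  proof clarify
    fix n r e assume o: "occ S n r e"
    then show "(n, r, e) \<in> (\<lambda>(b, x). (fst x, if snd x then snd b else fst b, if snd x then fst b else snd b)) ` (SIGMA b:A. set_mset (S b))"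
    proof (cases rule: occ_cases)
      case 1
      show ?thesis
        by (rule image_eqI[where x = "((r, e), (n, False))"]) (use 1 svt_box[OF s 1(2)] in auto)
    next
      case 2
      show ?thesis
        by (rule image_eqI[where x = "((e, r), (n, True))"]) (use 2 svt_box[OF s 2(2)] in auto)
    qed
  qed
  moreover have "finite (SIGMA b:A. set_mset (S b))"
    using svtD(1)[OF s] unfolding shifted_shape_def by auto
  ultimately have fin: "finite ?O" using finite_subset finite_imageI by blast
  obtain i j x where "(i, j) \<in> A" "x \<in># S (i, j)" using ne svtD(2)[OF s] by (metis multiset_nonemptyE all_not_in_conv surj_pair)
  then have "?O \<noteq> {}" using ex_occ[OF s, of "fst x" "snd x" i j] by (auto split: if_splits)
  define m where "m = Max (fst ` ?O)"
  have m: "n \<le> m" if "occ S n r e" for n r e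
    unfolding m_def using fin that by (intro Max_ge) force+
  have "m \<in> fst ` ?O" unfolding m_def using fin \<open>?O \<noteq> {}\<close> by (intro Max_in) auto
  then have ne2: "{e. \<exists>r. occ S m r e} \<noteq> {}" by force
  have "{e. \<exists>r. occ S m r e} \<subseteq> (\<lambda>(n, r, e). e) ` ?O" by force
  then have fin2: "finite {e. \<exists>r. occ S m r e}" using fin finite_subset finite_imageI by blast
  define e where "e = Max {e. \<exists>r. occ S m r e}"
  have "e \<in> {e. \<exists>r. occ S m r e}" unfolding e_def using fin2 ne2 by (rule Max_in)
  then obtain r where r: "occ S m r e" by blast
  have "e' \<le> e" if "occ S m r' e'" for r' e' unfolding e_def using fin2 that by (intro Max_ge) auto
  then show ?thesis using r m unfolding last_occ_def by (metis le_neq_implies_less)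
qed

definition corner :: "(nat \<times> nat) set \<Rightarrow> nat \<Rightarrow> nat \<Rightarrow> bool" where
  "corner A r e \<longleftrightarrow> 1 \<le> r \<and> 1 \<le> e \<and> tbox r e \<in> A \<and> tbox r (Suc e) \<notin> A \<and> tbox (Suc r) e \<notin> A"

text \<open>A box to the right of or below the directed box would contain a letter at least as
  large, hence again with label n. It would lie in a later directed column or violate uniqueness in
  its row or column.\<close>

lemma last_occ_corner:
  assumes s: "svt A S" and l: "last_occ S n r e"
  shows "corner A r e"
proof -
  have o: "occ S n r e" and n1: "1 \<le> n" using l occ_box[OF s] unfolding last_occ_def by blast+
  have mx: "m < n \<or> m = n \<and> (if pr then i else j) \<le> e" if "(m, pr) \<in># S (i, j)" for m pr i j
    using ex_occ[OF s that] l unfolding last_occ_def by (auto split: if_splits)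
  have pv: "m = n \<and> (pr \<longrightarrow> q)" if "m < n \<or> m = n" "2 * n - (if q then 1 else 0) \<le> pval (m, pr)" for m pr q
    using that n1 by (cases pr; cases q) auto
  have right: "tbox r (Suc e) \<notin> A"
  proof
    assume "tbox r (Suc e) \<in> A"
    then obtain m pr where y: "(m, pr) \<in># S (tbox r (Suc e))" using svtD(2)[OF s] by (metis multiset_nonemptyE surj_pair)
    from o show False
    proof (cases rule: occ_cases)
      case 1
      then have y': "(m, pr) \<in># S (r, Suc e)" using y by (simp add: tbox_def)
      then have "2 * n \<le> pval (m, pr)" using svtD(4)[OF s _ _ _ 1(2) y'] by simp
      then show False using pv[of m False pr] mx[OF y'] by auto
    next
      case 2
      then have "tbox r (Suc e) = (Suc e, r)" by (simp add: tbox_def)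
      then have y': "(m, pr) \<in># S (Suc e, r)" using y by simp
      then have "2 * n - 1 \<le> pval (m, pr)" using svtD(4)[OF s _ _ _ 2(2) y'] by simp
      then show False using pv[of m True pr] mx[OF y'] 2 by (auto split: if_splits)
    qed
  qed
  have down: "tbox (Suc r) e \<notin> A"
  proof
    assume "tbox (Suc r) e \<in> A"
    then obtain m pr where y: "(m, pr) \<in># S (tbox (Suc r) e)" using svtD(2)[OF s] by (metis multiset_nonemptyE surj_pair)
    from o show False
    proof (cases rule: occ_cases)
      case 1
      show False
      proof (cases "r = e")
        case True
        then have y': "(m, pr) \<in># S (e, Suc e)" using y by (simp add: tbox_def min_def max_def)
        then have "2 * n \<le> pval (m, pr)" using svtD(4)[OF s _ _ _ 1(2) y'] True by simp
        then show False using pv[of m False pr] mx[OF y'] by auto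
      next
        case False
        then have y': "(m, pr) \<in># S (Suc r, e)" using y 1 by (simp add: tbox_def)
        then have "2 * n \<le> pval (m, pr)" using svtD(4)[OF s _ _ _ 1(2) y'] by simp
        then have "m = n \<and> \<not> pr" using pv[of m False pr] mx[OF y'] by auto
        then show False using svtD(6)[OF s, of n r e "Suc r"] y' 1 by auto
      qed
    next
      case 2
      then have y': "(m, pr) \<in># S (e, Suc r)" using y by (simp add: tbox_def min_def max_def)
      then have "2 * n - 1 \<le> pval (m, pr)" using svtD(4)[OF s _ _ _ 2(2) y'] by simp
      then have "m = n" using pv[of m True pr] mx[OF y'] by auto
      then show False using svtD(7)[OF s, of n e r "Suc r"] y' 2 mx[OF y'] by (cases pr) auto
    qed
  qed
  show ?thesis using o occ_box[OF s o] right down unfolding corner_def occ_def by blast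
qed

definition put :: "(nat \<times> nat \<Rightarrow> pletter multiset) \<Rightarrow> nat \<Rightarrow> nat \<Rightarrow> nat \<Rightarrow> nat \<times> nat \<Rightarrow> pletter multiset" where
  "put S n r e = S(tbox r e := add_mset (n, e < r) (S (tbox r e)))"

definition take_away :: "(nat \<times> nat \<Rightarrow> pletter multiset) \<Rightarrow> nat \<Rightarrow> nat \<Rightarrow> nat \<Rightarrow> nat \<times> nat \<Rightarrow> pletter multiset" where
  "take_away S n r e = S(tbox r e := S (tbox r e) - {#(n, e < r)#})"

lemma take_away_put [simp]: "take_away (put S n r e) n r e = S"
  by (simp add: take_away_def put_def)

lemma put_take_away: "occ S n r e \<Longrightarrow> put (take_away S n r e) n r e = S"
  by (simp add: take_away_def put_def occ_def)

lemma take_away_subset: "take_away S n r e b \<subseteq># S b"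
  by (simp add: take_away_def)

lemma corner_beyond:
  assumes sh: "shifted_shape A" and c: "corner A r e" and b: "(i, j) \<in> A" "fst (tbox r e) \<le> i" "snd (tbox r e) \<le> j"
  shows "(i, j) = tbox r e"
proof (rule ccontr)
  assume ne: "(i, j) \<noteq> tbox r e"
  have ij: "i \<le> j" and re: "1 \<le> r" "1 \<le> e" using shifted_shape_bounds[OF sh b(1)] c by (auto simp: corner_def)
  have "tbox r (Suc e) \<in> A \<or> tbox (Suc r) e \<in> A"
  proof (cases "r \<le> e")
    case True
    then have "r \<le> i" "e \<le> j" "r < i \<or> e < j" using b ne by (auto simp: tbox_def)
    moreover have "tbox r (Suc e) = (r, Suc e)" "r < e \<Longrightarrow> tbox (Suc r) e = (Suc r, e)"
      using True by (simp_all add: tbox_def)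
    ultimately show ?thesis
      using True ij re shifted_shape_closed[OF sh b(1), of r "Suc e"]
        shifted_shape_closed[OF sh b(1), of "Suc r" e]
      by (cases "e < j") auto
  next
    case False
    then have "e \<le> i" "r \<le> j" "e < i \<or> r < j" using b ne by (auto simp: tbox_def)
    moreover have "tbox r (Suc e) = (Suc e, r)" "tbox (Suc r) e = (e, Suc r)"
      using False by (simp_all add: tbox_def)
    ultimately show ?thesis
      using False ij re shifted_shape_closed[OF sh b(1), of e "Suc r"]
        shifted_shape_closed[OF sh b(1), of "Suc e" r]
      by (cases "r < j") auto
  qed
  then show False using c by (simp add: corner_def)
qed

lemma svt_take_away:
  assumes s: "svt A S" and l: "last_occ S n r e"
  shows "svt (if take_away S n r e (tbox r e) = {#} then A - {tbox r e} else A) (take_away S n r e)"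
    (is "svt ?A ?S")
proof -
  note d = svtD[OF s]
  have sub: "x \<in># S b" if "x \<in># ?S b" for x b using that take_away_subset mset_subset_eqD by metis
  have c: "corner A r e" using last_occ_corner[OF s l] .
  have "shifted_shape (A - {tbox r e})" unfolding shifted_shape_def
  proof (intro conjI allI impI)
    show "finite (A - {tbox r e})" "\<forall>(i, j)\<in>A - {tbox r e}. 1 \<le> i \<and> i \<le> j"
      using d(1) unfolding shifted_shape_def by auto
    fix i j i' j' assume h: "(i', j') \<in> A - {tbox r e}" "1 \<le> i" "i \<le> j" "i \<le> i'" "j \<le> j'"
    then have "(i, j) \<in> A" using shifted_shape_closed[OF d(1)] by blast
    moreover have "(i, j) \<noteq> tbox r e"
      using corner_beyond[OF d(1) c, of i' j'] h by (cases "tbox r e") auto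
    ultimately show "(i, j) \<in> A - {tbox r e}" by blast
  qed
  then have "shifted_shape ?A" using d(1) by simp
  moreover have "b \<in> ?A \<longleftrightarrow> ?S b \<noteq> {#}" for b
    using d(2)[of b] c by (cases "b = tbox r e") (auto simp: take_away_def corner_def)
  ultimately show ?thesis
  proof (rule svtI)
    show "1 \<le> fst x" if "x \<in># ?S b" for x b using d(3) sub that by metis
    show "pval x \<le> pval y" if "i \<le> i'" "j \<le> j'" "(i, j) \<noteq> (i', j')" "x \<in># ?S (i, j)" "y \<in># ?S (i', j')" for i j i' j' x y
      using d(4)[OF that(1-3) sub[OF that(4)] sub[OF that(5)]] .
    show "\<not> snd x" if "x \<in># ?S (i, i)" for x i using d(5)[OF sub[OF that]] .
    show "i = i'" if "(n, False) \<in># ?S (i, j)" "(n, False) \<in># ?S (i', j)" for n i i' j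
      using d(6)[OF sub[OF that(1)] sub[OF that(2)]] .
    show "j = j'" if "(n, True) \<in># ?S (i, j)" "(n, True) \<in># ?S (i, j')" for n i j j'
      using d(7)[OF sub[OF that(1)] sub[OF that(2)]] .
  qed
qed

text \<open>By \<open>mx\<close> the new letter comes last in the recording order. The point is that
  it is also at least as large as all others in the order of primed letters.\<close>

lemma svt_put:
  assumes s: "svt A' S" and sh: "shifted_shape A" and c: "corner A r e" and n: "1 \<le> n"
    and A: "A = insert (tbox r e) A'"
    and mx: "\<And>n' r' e'. occ S n' r' e' \<Longrightarrow> n' < n \<or> n' = n \<and> (e' < e \<or> (r', e') = (r, e))"
  shows "svt A (put S n r e)" "last_occ (put S n r e) n r e"
proof -
  let ?S = "put S n r e" and ?b = "tbox r e" and ?x = "(n, e < r)"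
  note d = svtD[OF s]
  have re: "1 \<le> r" "1 \<le> e" using c by (auto simp: corner_def)
  have mem: "x \<in># ?S b \<longleftrightarrow> x \<in># S b \<or> (b = ?b \<and> x = ?x)" for x b by (auto simp: put_def)
  have mono: "pval x \<le> pval ?x" if x: "x \<in># S (i, j)" for x i j
  proof -
    obtain m pr where x': "x = (m, pr)" by fastforce
    have o: "if pr then i < j \<and> occ S m j i else occ S m i j" using ex_occ[OF s] x x' by simp
    then have mn: "m \<le> n" using mx by (fastforce split: if_splits)
    show ?thesis
    proof (cases "m = n \<and> \<not> pr \<and> e < r")
      \<comment> \<open>A new primed n would be smaller than the old unprimed n. The last letter of
        S also has label n. If primed, it contradicts \<open>occ_col_mixed\<close>; if unprimed, it
        sits at a corner (r', e') with e' < e, although the directed box below it is in the shape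
        because (e, r) is.\<close>
      case True
      then have o: "occ S n i j" and x1: "(n, False) \<in># S (i, j)" using o x x' by auto
      have ij: "i \<le> j" using svt_box[OF s x1] by simp
      then have je: "j < e" using mx[OF o] True by auto
      have "A' \<noteq> {}" using svt_box[OF s x1] by blast
      then obtain m r' e' where l: "last_occ S m r' e'" using last_occ_exists[OF s] by blast
      have m: "m = n" "j \<le> e'" using l o mx unfolding last_occ_def by (metis less_asym less_irrefl)+
      have oe: "occ S n r' e'" using l m unfolding last_occ_def by simp
      from oe have False
      proof (cases rule: occ_cases)
        case 1
        then have e': "e' < e" using mx[OF oe] True by auto
        have "corner A' r' e'" using last_occ_corner[OF s l] .
        then have nc: "tbox (Suc r') e' \<notin> A'" and r': "1 \<le> r'" "1 \<le> e'" by (auto simp: corner_def)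
        have "?b = (e, r)" "(e, r) \<in> A" using True c by (auto simp: tbox_def corner_def min_def max_def)
        moreover obtain p q where pq: "tbox (Suc r') e' = (p, q)" "1 \<le> p" "p \<le> q" "p \<le> e" "q \<le> e"
          using 1 e' r' by (auto simp: tbox_def min_def max_def split: if_splits)
        ultimately have "(p, q) \<in> A" "(p, q) \<noteq> ?b"
          using shifted_shape_closed[OF sh, of e r p q] True by auto
        then show False using nc pq A by auto
      next
        case 2
        then show False using occ_col_mixed[OF s x1 2(2) m(2)] by simp
      qed
      then show ?thesis ..
    next
      case False
      then show ?thesis using mn n x' by (cases "m = n"; cases pr; cases "e < r") auto
    qed
  qed
  have Ab: "\<not> (?b \<noteq> (i', j') \<and> fst ?b \<le> i' \<and> snd ?b \<le> j' \<and> (i', j') \<in> A)" for i' j'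
    using corner_beyond[OF sh c] by metis
  have mono2: "pval x \<le> pval y" if "i \<le> i'" "j \<le> j'" "(i, j) \<noteq> (i', j')" "x \<in># ?S (i, j)" "y \<in># ?S (i', j')" for i j i' j' x y
  proof -
    have "(i', j') \<in> A" using that(5) A d(2)[of "(i', j')"] unfolding mem by auto
    then have "x \<in># S (i, j)" using that Ab[of i' j'] unfolding mem by (cases ?b) auto
    then show ?thesis using that d(4) mono unfolding mem by blast
  qed
  show "svt A ?S"
  proof (rule svtI[OF sh])
    show "b \<in> A \<longleftrightarrow> ?S b \<noteq> {#}" for b using d(2)[of b] A by (auto simp: put_def)
    show "1 \<le> fst x" if "x \<in># ?S b" for x b using that d(3)[of x b] n unfolding mem by auto
    show "\<not> snd x" if "x \<in># ?S (i, i)" for x i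
      using that d(5)[of x i] unfolding mem by (auto simp: tbox_def min_def max_def split: if_splits)
    show "i = i'" if "(m, False) \<in># ?S (i, j)" "(m, False) \<in># ?S (i', j)" for m i i' j
    proof -
      have *: "i = k" if "(n, False) \<in># S (i, j)" "(k, j) = ?b" "\<not> e < r" for i k
        using ex_occ[OF s that(1)] mx[of n i j] that(2,3) by (auto simp: tbox_def min_def max_def split: if_splits)
      show ?thesis using that d(6)[of m i j i'] *[of i i'] *[of i' i] unfolding mem by (cases ?b) auto
    qed
    show "j = j'" if "(m, True) \<in># ?S (i, j)" "(m, True) \<in># ?S (i, j')" for m i j j'
    proof -
      have *: "j = k" if "(n, True) \<in># S (i, j)" "(i, k) = ?b" "e < r" for j k
        using ex_occ[OF s that(1)] mx[of n j i] that(2,3) by (auto simp: tbox_def min_def max_def split: if_splits)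
      show ?thesis using that d(7)[of m i j j'] *[of j j'] *[of j' j] unfolding mem by (cases ?b) auto
    qed
  qed (fact mono2)
  have occ': "occ ?S n' r' e' \<Longrightarrow> occ S n' r' e' \<or> (n', r', e') = (n, r, e)" for n' r' e'
    unfolding occ_def mem by (auto simp: tbox_def min_def max_def split: if_splits)
  have "occ ?S n r e" unfolding occ_def mem using re by simp
  then show "last_occ ?S n r e" unfolding last_occ_def using occ' mx
    by (metis Pair_inject le_refl less_imp_le)
qed

definition content :: "(nat \<times> nat) set \<Rightarrow> (nat \<times> nat \<Rightarrow> pletter multiset) \<Rightarrow> nat multiset" where
  "content A S = (\<Sum>b\<in>A. image_mset fst (S b))"

lemma content_put:
  assumes "svt A' S" "A = insert (tbox r e) A'"
  shows "content A (put S n r e) = add_mset n (content A' S)"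
proof -
  let ?b = "tbox r e"
  have fin: "finite A'" using svtD(1)[OF assms(1)] unfolding shifted_shape_def by blast
  have finA: "finite A" "?b \<in> A" using fin assms(2) by auto
  have "content A' S = content A S"
  proof (cases "?b \<in> A'")
    case False
    then have "S ?b = {#}" using svtD(2)[OF assms(1)] by blast
    then show ?thesis using assms(2) fin False by (simp add: content_def)
  qed (simp add: assms(2) insert_absorb)
  also have "content A S = image_mset fst (S ?b) + (\<Sum>b\<in>A - {?b}. image_mset fst (S b))"
    unfolding content_def by (rule sum.remove[OF finA])
  finally have 1: "content A' S = image_mset fst (S ?b) + (\<Sum>b\<in>A - {?b}. image_mset fst (S b))" .
  have "content A (put S n r e) = image_mset fst (put S n r e ?b) + (\<Sum>b\<in>A - {?b}. image_mset fst (put S n r e b))"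
    unfolding content_def by (rule sum.remove[OF finA])
  also have "(\<Sum>b\<in>A - {?b}. image_mset fst (put S n r e b)) = (\<Sum>b\<in>A - {?b}. image_mset fst (S b))"
    by (rule sum.cong) (auto simp: put_def)
  moreover have "image_mset fst (put S n r e ?b) = add_mset n (image_mset fst (S ?b))" by (simp add: put_def)
  ultimately show ?thesis using 1 by simp
qed

lemma content_mem: "svt A S \<Longrightarrow> n \<in># content A S \<longleftrightarrow> (\<exists>b pr. (n, pr) \<in># S b)"
proof -
  assume s: "svt A S"
  have fin: "finite A" using svtD(1)[OF s] unfolding shifted_shape_def by blast
  have "n \<in># content A S \<longleftrightarrow> (\<exists>b\<in>A. n \<in># image_mset fst (S b))"
    unfolding content_def using fin by (induction A) auto
  also have "\<dots> \<longleftrightarrow> (\<exists>b\<in>A. \<exists>pr. (n, pr) \<in># S b)" by force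
  also have "\<dots> \<longleftrightarrow> (\<exists>b pr. (n, pr) \<in># S b)" using svtD(2)[OF s] by (metis empty_iff set_mset_empty)
  finally show ?thesis .
qed

section \<open>Recording tableaux\<close>

definition shape :: "array \<Rightarrow> (nat \<times> nat) set" where
  "shape D = {(i, j). 1 \<le> i \<and> i \<le> j \<and> D i j \<noteq> \<infinity>}"

lemma shape_shifted: "symarr D \<Longrightarrow> shifted_shape (shape D)"
  unfolding shifted_shape_def
proof (intro conjI allI impI)
  assume D: "symarr D"
  obtain N where N: "\<forall>i j. 1 \<le> i \<and> 1 \<le> j \<and> (N \<le> i \<or> N \<le> j) \<longrightarrow> D i j = \<infinity>" using symarr_bound[OF D] by blast
  have "shape D \<subseteq> {..<N} \<times> {..<N}"
  proof clarify
    fix i j assume "(i, j) \<in> shape D"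
    then have "1 \<le> i" "1 \<le> j" "D i j \<noteq> \<infinity>" by (auto simp: shape_def)
    then show "i \<in> {..<N} \<and> j \<in> {..<N}" using N by (meson lessThan_iff not_le)
  qed
  then show "finite (shape D)" using finite_subset by blast
  show "\<forall>(i, j)\<in>shape D. 1 \<le> i \<and> i \<le> j" by (auto simp: shape_def)
  show "(i, j) \<in> shape D" if "(i', j') \<in> shape D" "1 \<le> i" "i \<le> j" "i \<le> i'" "j \<le> j'" for i j i' j'
    using that enat_le_fin[OF symarr_mono[OF D that(4,5)]] by (auto simp: shape_def)
qed

lemma tbox_shape: "symarr D \<Longrightarrow> 1 \<le> r \<Longrightarrow> 1 \<le> e \<Longrightarrow> tbox r e \<in> shape D \<longleftrightarrow> D r e \<noteq> \<infinity>"
  using symarr_sym[of D r e] by (auto simp: tbox_def shape_def min_def max_def)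

text \<open>This matches the corners of the shape with the columns that an insertion can
  record.\<close>

lemma corner_len:
  assumes "symarr D"
  shows "corner (shape D) r e \<longleftrightarrow> 1 \<le> e \<and> D 1 e \<noteq> \<infinity> \<and> r = len D e \<and> D (len D e) (Suc e) = \<infinity>"
proof
  assume c: "corner (shape D) r e"
  then have re: "1 \<le> r" "1 \<le> e" by (auto simp: corner_def)
  then have v: "D r e \<noteq> \<infinity>" "D r (Suc e) = \<infinity>" "D (Suc r) e = \<infinity>"
    using c tbox_shape[OF assms] by (auto simp: corner_def)
  have "len D e = r" using len_eqI[OF assms re(2)] v symarr_sym[OF assms] by metis
  moreover have "D 1 e \<noteq> \<infinity>" using enat_le_fin[OF symarr_mono[OF assms re(1) order_refl] v(1)] .
  ultimately show "1 \<le> e \<and> D 1 e \<noteq> \<infinity> \<and> r = len D e \<and> D (len D e) (Suc e) = \<infinity>" using re v by simp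
next
  assume a: "1 \<le> e \<and> D 1 e \<noteq> \<infinity> \<and> r = len D e \<and> D (len D e) (Suc e) = \<infinity>"
  then have e: "1 \<le> e" and r: "r = len D e" by auto
  have r1: "1 \<le> r" using len_le_iff[OF assms e, of 1] a symarr_sym[OF assms, of 1 e] r by simp
  have "D r e \<noteq> \<infinity>" "D (Suc r) e = \<infinity>"
    using len_le_iff[OF assms e, of r] len_less_iff[OF assms e, of "Suc r"] r
      symarr_sym[OF assms, of r e] symarr_sym[OF assms, of "Suc r" e] by auto
  then show "corner (shape D) r e" using a e r1 r tbox_shape[OF assms] by (auto simp: corner_def)
qed

lemma inserts_shape:
  assumes "inserts D x E e b"
  shows "corner (shape E) (len E e) e" "shape E = insert (tbox (len E e) e) (shape D)"
    "tbox (len E e) e \<notin> shape D \<longleftrightarrow> b"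
proof -
  note c = inserts_corner[OF assms]
  have D: "symarr D" and E: "symarr E" using inserts_symarr[OF assms] by auto
  show cr: "corner (shape E) (len E e) e" using corner_len[OF E] c by blast
  then have r: "1 \<le> len E e" and tE: "tbox (len E e) e \<in> shape E" by (auto simp: corner_def)
  have "D (len E e) e = \<infinity> \<longleftrightarrow> b" using c(4)[of "len E e" e] tE tbox_shape[OF E r c(1)] by auto
  then show "tbox (len E e) e \<notin> shape D \<longleftrightarrow> b" using tbox_shape[OF D r c(1)] by simp
  show "shape E = insert (tbox (len E e) e) (shape D)"
  proof (rule set_eqI, clarify)
    fix i j
    have "(i, j) \<in> shape E \<longleftrightarrow> (i, j) \<in> shape D \<or> (1 \<le> i \<and> i \<le> j \<and> b \<and> ((i, j) = (len E e, e) \<or> (i, j) = (e, len E e)))"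
      using c(4)[of i j] tE tbox_shape[OF E r c(1)] symarr_sym[OF E, of e "len E e"] by (auto simp: shape_def)
    also have "\<dots> \<longleftrightarrow> (i, j) \<in> shape D \<or> (b \<and> (i, j) = tbox (len E e) e)"
      using r c(1) by (auto simp: tbox_def min_def max_def)
    also have "\<dots> \<longleftrightarrow> (i, j) \<in> insert (tbox (len E e) e) (shape D)"
      using \<open>tbox (len E e) e \<notin> shape D \<longleftrightarrow> b\<close> by auto
    finally show "(i, j) \<in> shape E \<longleftrightarrow> (i, j) \<in> insert (tbox (len E e) e) (shape D)" .
  qed
qed

definition emptyD :: "nat \<Rightarrow> nat \<Rightarrow> enat" where
  "emptyD i j = (if i = 0 \<or> j = 0 then 0 else \<infinity>)"

lemma emptyD_symarr: "symarr emptyD"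
  by (auto simp: symarr_def emptyD_def)

lemma shape_emptyD: "symarr D \<Longrightarrow> shape D = {} \<longleftrightarrow> D = emptyD"
proof
  assume D: "symarr D" and s: "shape D = {}"
  have "D i j = emptyD i j" for i j
  proof (cases "i = 0 \<or> j = 0")
    case False
    then have "(min i j, max i j) \<notin> shape D" using s by simp
    then have "D i j = \<infinity>" using False symarr_sym[OF D, of i j] by (auto simp: shape_def min_def max_def split: if_splits)
    then show ?thesis using False by (simp add: emptyD_def)
  qed (use D in \<open>auto simp: emptyD_def\<close>)
  then show "D = emptyD" by blast
qed (auto simp: shape_def emptyD_def)

text \<open>The second list holds the labels, one for each inserted letter. By symmetry
  \<open>len E e\<close> is also the length of column e, so (\<open>len E e\<close>, e) is its
  bottom box.\<close>

inductive recording :: "nat list \<Rightarrow> nat list \<Rightarrow> array \<Rightarrow> (nat \<times> nat \<Rightarrow> pletter multiset) \<Rightarrow> bool" where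
  rec_Nil: "recording [] [] emptyD (\<lambda>_. {#})"
| rec_snoc: "recording w I D S \<Longrightarrow> inserts D (enat x) E e b
    \<Longrightarrow> recording (w @ [x]) (I @ [n]) E (put S n (len E e) e)"

text \<open>The labels are the indices of a monomial of the fundamental function of w; their
  sortedness and positivity are carried separately.\<close>

definition compatible :: "nat list \<Rightarrow> nat list \<Rightarrow> bool" where
  "compatible w I \<longleftrightarrow> length w = length I \<and> (\<forall>x\<in>set w. 1 \<le> x)
     \<and> (\<forall>j. Suc j < length w \<longrightarrow> w ! j > w ! Suc j \<longrightarrow> I ! j < I ! Suc j)"

lemma compatible_snoc:
  "compatible (w @ [x]) (I @ [n]) \<longleftrightarrow> compatible w I \<and> 1 \<le> x \<and> (w \<noteq> [] \<longrightarrow> last w > x \<longrightarrow> last I < n)"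
proof -
  have "(\<forall>j. Suc j < length (w @ [x]) \<longrightarrow> (w @ [x]) ! j > (w @ [x]) ! Suc j \<longrightarrow> (I @ [n]) ! j < (I @ [n]) ! Suc j)
    \<longleftrightarrow> (\<forall>j. Suc j < length w \<longrightarrow> w ! j > w ! Suc j \<longrightarrow> I ! j < I ! Suc j) \<and> (w \<noteq> [] \<longrightarrow> last w > x \<longrightarrow> last I < n)"
    (is "?L \<longleftrightarrow> ?R") if l: "length w = length I"
  proof
    assume L: ?L
    show ?R
    proof (intro conjI allI impI)
      fix j assume "Suc j < length w" "w ! j > w ! Suc j"
      then show "I ! j < I ! Suc j" using L[rule_format, of j] l by (simp add: nth_append)
    next
      assume "w \<noteq> []" "last w > x"
      moreover then have "I \<noteq> []" using l by auto
      ultimately show "last I < n" using L[rule_format, of "length w - 1"] l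
        by (simp add: nth_append last_conv_nth)
    qed
  next
    assume R: ?R
    show ?L
    proof (intro allI impI)
      fix j assume j: "Suc j < length (w @ [x])" "(w @ [x]) ! j > (w @ [x]) ! Suc j"
      show "(I @ [n]) ! j < (I @ [n]) ! Suc j"
      proof (cases "Suc j < length w")
        case True then show ?thesis using R j l by (simp add: nth_append)
      next
        case False
        then have jw: "Suc j = length w" using j by simp
        then have ne: "w \<noteq> []" "I \<noteq> []" using l by auto
        have "last w = w ! j" "last I = I ! j" using jw l ne by (metis diff_Suc_1 last_conv_nth)+
        then show ?thesis using R j jw l ne by (simp add: nth_append)
      qed
    qed
  qed
  then show ?thesis by (auto simp: compatible_def)
qed

lemma recording_snocE:
  assumes "recording w' (I @ [n]) E S'"
  obtains w x D S e b where "w' = w @ [x]" "recording w I D S" "inserts D (enat x) E e b" "S' = put S n (len E e) e"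
  using assms by (cases) auto

lemma recording_total:
  "\<lbrakk>length w = length I; \<forall>x\<in>set w. 1 \<le> x\<rbrakk> \<Longrightarrow> \<exists>D S. recording w I D S \<and> symarr D"
proof (induction w arbitrary: I rule: rev_induct)
  case Nil then show ?case using rec_Nil emptyD_symarr by auto
next
  case (snoc x w)
  then obtain I' n where I: "I = I' @ [n]" by (metis length_0_conv rev_exhaust snoc_eq_iff_butlast)
  have "length w = length I'" "\<forall>x\<in>set w. 1 \<le> x" using snoc.prems I by auto
  then obtain D S where D: "recording w I' D S" "symarr D" using snoc.IH by blast
  have "0 < enat x" using snoc.prems(2) by (simp add: zero_enat_def)
  then obtain E e b where "inserts D (enat x) E e b" using inserts_total[OF D(2)] by blast
  then show ?case using rec_snoc[OF D(1)] inserts_symarr I by blast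
qed

lemma recording_det: "recording w I D S \<Longrightarrow> recording w I D' S' \<Longrightarrow> D = D' \<and> S = S'"
proof (induction arbitrary: D' S' rule: recording.induct)
  case rec_Nil then show ?case by (auto elim: recording.cases)
next
  case (rec_snoc w I D S x E e b n)
  from rec_snoc.prems obtain D1 S1 e1 b1 where
    r: "recording w I D1 S1" "inserts D1 (enat x) D' e1 b1" "S' = put S1 n (len D' e1) e1"
    by (elim recording_snocE) auto
  then show ?case using rec_snoc.IH[OF r(1)] inserts_det rec_snoc.hyps(2) by metis
qed

lemma recording_weq: "recording w I D S \<Longrightarrow> bounded_by D N \<Longrightarrow> weq w (rows D N 1 N)"
proof (induction rule: recording.induct)
  case rec_Nil
  have "rows emptyD N 1 N = []" unfolding rows_def by (auto simp: rword_def fseg_def emptyD_def)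
  then show ?case by (simp add: weq_refl)
next
  case (rec_snoc w I D S x E e b n)
  have "E p q = \<infinity> \<Longrightarrow> D p q = \<infinity>" for p q using inserts_corner(4)[OF rec_snoc.hyps(2)] by blast
  then have "bounded_by D N" using rec_snoc.prems by (simp add: bounded_by_def)
  then have "weq (w @ [x]) (rows D N 1 N @ [x])" using rec_snoc.IH weq_append by blast
  also have "weq \<dots> (rows E N 1 N)" using inserts_weq[OF rec_snoc.hyps(2) rec_snoc.prems] by simp
  finally show ?case .
qed

text \<open>The invariant of the construction. Its last clause says that the corner of the most
  recent insertion carries the last letter, from which the insertion can be undone.\<close>

definition recorded :: "nat list \<Rightarrow> nat list \<Rightarrow> array \<Rightarrow> (nat \<times> nat \<Rightarrow> pletter multiset) \<Rightarrow> bool" where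
  "recorded w I D S \<longleftrightarrow> symarr D \<and> svt (shape D) S \<and> content (shape D) S = mset I \<and> length w = length I
    \<and> (w \<noteq> [] \<longrightarrow> (\<exists>D0 e b. inserts D0 (enat (last w)) D e b \<and> last_occ S (last I) (len D e) e))"

text \<open>The bound required by \<open>svt_put\<close> comes from the previous corner: if the
  label is repeated, the word does not descend, and by \<open>inserts_compare\<close> the new corner
  is the old one or lies in a later directed column.\<close>

lemma recorded_snoc:
  assumes r: "recorded w I D S" and ins: "inserts D (enat x) E e b"
    and c: "compatible (w @ [x]) (I @ [n])" and I: "sorted (I @ [n])" "\<forall>m\<in>set (I @ [n]). 1 \<le> m"
  shows "recorded (w @ [x]) (I @ [n]) E (put S n (len E e) e)"
    "last_occ (put S n (len E e) e) n (len E e) e"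
proof -
  have n1: "1 \<le> n" and In: "\<forall>m\<in>set I. m \<le> n" using I by (auto simp: sorted_append)
  have cw: "w \<noteq> [] \<longrightarrow> last w > x \<longrightarrow> last I < n" using c unfolding compatible_snoc by blast
  have IH: "symarr D" "svt (shape D) S" "content (shape D) S = mset I" "length w = length I"
    "w \<noteq> [] \<longrightarrow> (\<exists>D0 e b. inserts D0 (enat (last w)) D e b \<and> last_occ S (last I) (len D e) e)"
    using r unfolding recorded_def by auto
  have E: "symarr E" using inserts_symarr[OF ins] by blast
  note sh = inserts_shape[OF ins]
  have mx: "n' < n \<or> n' = n \<and> (e' < e \<or> (r', e') = (len E e, e))" if o: "occ S n' r' e'" for n' r' e'
  proof -
    have "(n', e' < r') \<in># S (tbox r' e')" using o by (simp add: occ_def)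
    then have "n' \<in># content (shape D) S" using content_mem[OF IH(2)] by blast
    then have nI: "n' \<in> set I" using IH(3) by simp
    then have wne: "w \<noteq> []" using IH(4) by auto
    then obtain D0 e0 b0 where i0: "inserts D0 (enat (last w)) D e0 b0" and l0: "last_occ S (last I) (len D e0) e0"
      using IH(5) by blast
    show ?thesis
    proof (cases "n' < n")
      case False
      then have nn: "n' = n" using nI In by force
      have "n' < last I \<or> n' = last I \<and> e' \<le> e0" using l0 o unfolding last_occ_def by blast
      moreover have "last I \<le> n" using In nI by (cases I rule: rev_cases) auto
      ultimately have li: "last I = n" and ee: "e' \<le> e0" using nn by auto
      then have "last w \<le> x" using cw wne by force
      then have cmp: "e0 < e \<or> e0 = e \<and> len D e0 = len E e" using inserts_compare[OF i0 ins] by simp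
      have "r' = len D e0" if "e' = e0"
      proof -
        have "occ S n (len D e0) e0" using l0 li by (simp add: last_occ_def)
        then show ?thesis using occ_col_unique[OF IH(2)] o that nn by blast
      qed
      then show ?thesis using cmp ee nn by (cases "e' = e0") auto
    qed simp
  qed
  note put = svt_put[OF IH(2) shape_shifted[OF E] sh(1) n1 sh(2) mx]
  show l: "last_occ (put S n (len E e) e) n (len E e) e" by (rule put(2))
  have "content (shape E) (put S n (len E e) e) = mset (I @ [n])"
    using content_put[OF IH(2) sh(2)] IH(3) by simp
  moreover have "\<exists>D0 e' b. inserts D0 (enat (last (w @ [x]))) E e' b \<and> last_occ (put S n (len E e) e) (last (I @ [n])) (len E e') e'"
    using ins l by auto
  ultimately show "recorded (w @ [x]) (I @ [n]) E (put S n (len E e) e)"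
    unfolding recorded_def using E put(1) IH(4) by simp
qed

lemma recording_recorded:
  "\<lbrakk>recording w I D S; compatible w I; sorted I; \<forall>n\<in>set I. 1 \<le> n\<rbrakk> \<Longrightarrow> recorded w I D S"
proof (induction rule: recording.induct)
  case rec_Nil
  have "svt {} (\<lambda>_. {#})" by (rule svtI) (auto simp: shifted_shape_def)
  then show ?case using emptyD_symarr shape_emptyD[OF emptyD_symarr] by (simp add: content_def recorded_def)
next
  case (rec_snoc w I D S x E e b n)
  have "recorded w I D S"
    using rec_snoc by (simp add: compatible_snoc sorted_append)
  then show ?case using recorded_snoc(1)[OF _ rec_snoc.hyps(2) rec_snoc.prems] by blast
qed

text \<open>The last letter of the recording tableau gives the corner. Removing it gives the earlier
  recording tableau, which shows whether the corner was a new box; then \<open>inserts_inj\<close>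
  recovers the inserted letter and the earlier array.\<close>

lemma recording_inj:
  "\<lbrakk>recording w I D S; recording w' I D S; compatible w I; compatible w' I; sorted I; \<forall>n\<in>set I. 1 \<le> n\<rbrakk> \<Longrightarrow> w = w'"
proof (induction arbitrary: w' rule: recording.induct)
  case rec_Nil then show ?case by (auto elim: recording.cases)
next
  case (rec_snoc w I D S x E e b n)
  let ?S = "put S n (len E e) e"
  note ins = rec_snoc.hyps(2)
  from rec_snoc.prems(1) obtain w1 x1 D1 S1 e1 b1 where
    r: "w' = w1 @ [x1]" "recording w1 I D1 S1" "inserts D1 (enat x1) E e1 b1"
      "?S = put S1 n (len E e1) e1" by (elim recording_snocE) auto
  have I: "sorted I" "\<forall>n\<in>set I. 1 \<le> n" using rec_snoc.prems by (auto simp: sorted_append)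
  have c: "compatible w I" "compatible w1 I" using rec_snoc.prems(2,3) r(1) compatible_snoc by blast+
  have rd: "recorded w I D S" "recorded w1 I D1 S1"
    using recording_recorded[OF _ _ I] rec_snoc.hyps(1) r(2) c by blast+
  note s = recorded_snoc[OF rd(1) ins rec_snoc.prems(2,4,5)]
  note s1 = recorded_snoc[OF rd(2) r(3) rec_snoc.prems(3)[unfolded r(1)] rec_snoc.prems(4,5)]
  have ee: "e = e1"
    using last_occ_unique[of "shape E" ?S] s s1 r(4) by (auto simp: recorded_def)
  then have SS: "S = S1" using r(4) take_away_put by metis
  have "b = b1"
    using inserts_shape(3)[OF ins] inserts_shape(3)[OF r(3)] rd svtD(2)[of "shape D" S] svtD(2)[of "shape D1" S1] ee SS
    by (simp add: recorded_def)
  then have "D = D1 \<and> enat x = enat x1" using inserts_inj ins r(3) ee by blast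
  then show ?case using rec_snoc.IH[of w1] r c I SS by simp
qed

lemma recording_surj:
  "\<lbrakk>symarr E; svt (shape E) S; content (shape E) S = mset I; sorted I; \<forall>n\<in>set I. 1 \<le> n\<rbrakk>
    \<Longrightarrow> \<exists>w. compatible w I \<and> recording w I E S"
proof (induction I arbitrary: E S rule: rev_induct)
  case Nil
  have S0: "S b = {#}" for b
  proof (rule ccontr)
    assume "S b \<noteq> {#}"
    then obtain x where "x \<in># S b" by (meson multiset_nonemptyE)
    then have "fst x \<in># content (shape E) S" using content_mem[OF Nil(2)] by (metis prod.collapse)
    then show False using Nil(3) by simp
  qed
  then have "shape E = {}" using svtD(2)[OF Nil(2)] by blast
  then have "E = emptyD" using shape_emptyD[OF Nil(1)] by simp
  moreover have "S = (\<lambda>_. {#})" using S0 by blast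
  ultimately show ?case using rec_Nil by (auto simp: compatible_def intro!: exI[of _ "[]"])
next
  case (snoc n I)
  have E: "symarr E" and s: "svt (shape E) S" by fact+
  have cont: "m \<in># content (shape E) S \<longleftrightarrow> m \<in> set (I @ [n])" for m using snoc.prems(3) by simp
  have "n \<in># content (shape E) S" using cont by simp
  then obtain b pr where np: "(n, pr) \<in># S b" using content_mem[OF s] by blast
  then have "shape E \<noteq> {}" using svtD(2)[OF s] by (metis empty_iff set_mset_empty)
  then obtain m r e where l: "last_occ S m r e" using last_occ_exists[OF s] by blast
  have "m \<in># content (shape E) S" using l content_mem[OF s] unfolding last_occ_def occ_def by blast
  then have "m \<le> n" using cont snoc.prems(4) by (auto simp: sorted_append)
  moreover obtain i j where b: "b = (i, j)" by fastforce
  have "\<exists>r' e'. occ S n r' e'" using ex_occ[OF s np[unfolded b]] by (auto split: if_splits)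
  then have "n \<le> m" using l unfolding last_occ_def by (metis less_imp_le order_refl)
  ultimately have l: "last_occ S n r e" using l by simp
  have c: "corner (shape E) r e" using last_occ_corner[OF s l] .
  then have re: "1 \<le> e" "E 1 e \<noteq> \<infinity>" "r = len E e" "E (len E e) (Suc e) = \<infinity>" using corner_len[OF E] by auto
  let ?S = "take_away S n r e"
  \<comment> \<open>The insertion to be undone added a box exactly if the last letter is alone in
    its box.\<close>
  define f where "f \<longleftrightarrow> ?S (tbox r e) = {#}"
  obtain D x where ins: "inserts D x E e f" using inserts_surj[OF E re(1,2,4)] by blast
  then have "0 < x \<and> x \<noteq> \<infinity>" unfolding inserts_def insertable_one_iff by blast
  then obtain k where k: "x = enat k" "1 \<le> k" by (cases x) (auto simp: zero_enat_def)
  have D: "symarr D" using inserts_symarr[OF ins] by blast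
  note sh = inserts_shape[OF ins]
  have shD: "shape D = (if ?S (tbox r e) = {#} then shape E - {tbox r e} else shape E)"
    using sh re(3) by (auto simp: f_def)
  have sD: "svt (shape D) ?S" unfolding shD by (rule svt_take_away[OF s l])
  have Sput: "S = put ?S n (len E e) e" using put_take_away[of S n r e] l re(3) by (simp add: last_occ_def)
  have "add_mset n (content (shape D) ?S) = mset (I @ [n])"
    using content_put[OF sD sh(2), of n] Sput snoc.prems(3) by simp
  then have "content (shape D) ?S = mset I" by simp
  then obtain w where w: "compatible w I" "recording w I D ?S"
    using snoc.IH[OF D sD] snoc.prems(4,5) by (auto simp: sorted_append)
  have rd: "recorded w I D ?S" using recording_recorded[OF w(2,1)] snoc.prems(4,5) by (auto simp: sorted_append)
  \<comment> \<open>If the label n is repeated, the previous corner carries n in S as well. So it is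
    the corner at e or lies in an earlier directed column, and \<open>inserts_compare\<close> rules
    out a descent.\<close>
  have "last I < n" if wne: "w \<noteq> []" and lt: "last w > k"
  proof (rule ccontr)
    assume "\<not> last I < n"
    moreover have "I \<noteq> []" using wne w(1) by (auto simp: compatible_def)
    then have "last I \<le> n" using snoc.prems(4) by (auto simp: sorted_append)
    ultimately have li: "last I = n" by simp
    obtain D0 e0 b0 where i0: "inserts D0 (enat (last w)) D e0 b0" and l0: "last_occ ?S n (len D e0) e0"
      using rd wne li unfolding recorded_def by auto
    have "occ ?S n (len D e0) e0" using l0 unfolding last_occ_def by blast
    then have o: "occ S n (len D e0) e0" using take_away_subset unfolding occ_def by (metis mset_subset_eqD)
    then have "e0 \<le> e" using l unfolding last_occ_def by blast
    moreover have "len D e0 = len E e" if "e0 = e"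
      using occ_col_unique[OF s o[unfolded that]] l re(3) that unfolding last_occ_def by blast
    ultimately have "enat (last w) \<le> x" using inserts_compare[OF i0 ins] by (cases "e0 = e") auto
    then show False using lt k by simp
  qed
  then have "compatible (w @ [k]) (I @ [n])" unfolding compatible_snoc using w(1) k by blast
  moreover have "recording (w @ [k]) (I @ [n]) E S"
    using recording.rec_snoc[OF w(2) ins[unfolded k]] Sput by metis
  ultimately show ?case by blast
qed

section \<open>Tableaux and symmetric arrays\<close>

definition of_tableau :: "nat list \<Rightarrow> (nat \<times> nat \<Rightarrow> nat) \<Rightarrow> nat \<Rightarrow> nat \<Rightarrow> enat" where
  "of_tableau lam T i j = (if i = 0 \<or> j = 0 then 0
     else if tbox i j \<in> shifted_diagram lam then enat (T (tbox i j)) else \<infinity>)"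

lemma shifted_diagram_Sigma: "shifted_diagram lam = (SIGMA i:{1..length lam}. {i..<i + lam ! (i - 1)})"
  by (auto simp: shifted_diagram_def)

text \<open>The strict decrease of the parts compensates the shift by one box per row, so the right
  ends of the rows never move outwards.\<close>

lemma strict_partition_drop:
  assumes "strict_partition lam" "p \<le> q" "q < length lam"
  shows "lam ! q + q \<le> lam ! p + p"
  using assms(2,3)
proof (induction q rule: dec_induct)
  case (step q)
  have "lam ! q > lam ! Suc q"
    using assms(1) step by (auto simp: strict_partition_def intro: sorted_wrt_nth_less)
  then show ?case using step by simp
qed simp

lemma shifted_diagram_shape:
  assumes "strict_partition lam"
  shows "shifted_shape (shifted_diagram lam)"
  unfolding shifted_shape_def
proof (intro conjI allI impI)
  show "finite (shifted_diagram lam)" unfolding shifted_diagram_Sigma by auto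
  show "\<forall>(i, j)\<in>shifted_diagram lam. 1 \<le> i \<and> i \<le> j" by (auto simp: shifted_diagram_def)
  fix i j i' j' assume h: "(i', j') \<in> shifted_diagram lam" "1 \<le> i" "i \<le> j" "i \<le> i'" "j \<le> j'"
  then have "lam ! (i' - 1) + (i' - 1) \<le> lam ! (i - 1) + (i - 1)"
    by (intro strict_partition_drop[OF assms]) (auto simp: shifted_diagram_def)
  then show "(i, j) \<in> shifted_diagram lam" using h by (auto simp: shifted_diagram_def)
qed

lemma tbox_sym: "tbox i j = tbox j i"
  by (simp add: tbox_def min.commute max.commute)

lemma of_tableau_symarr:
  assumes lam: "strict_partition lam" and T: "inc_shifted_tableau lam T"
  shows "symarr (of_tableau lam T)"
  unfolding symarr_def
proof (intro conjI allI impI)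
  note sh = shifted_diagram_shape[OF lam]
  let ?D = "of_tableau lam T"
  show "?D i 0 = 0" for i by (simp add: of_tableau_def)
  show "?D i j = ?D j i" for i j using tbox_sym[of i j] by (auto simp: of_tableau_def)
  show "?D i j < ?D i (Suc j) \<or> ?D i (Suc j) = \<infinity>" if i: "1 \<le> i" for i j
  proof (cases "tbox i (Suc j) \<in> shifted_diagram lam")
    case True
    have pos: "1 \<le> T (tbox i (Suc j))" using T True unfolding inc_shifted_tableau_def by blast
    show ?thesis
    proof (cases "j = 0")
      case True
      then show ?thesis using pos i \<open>tbox i (Suc j) \<in> _\<close> by (auto simp: of_tableau_def zero_enat_def)
    next
      case j: False
      have "T (tbox i j) < T (tbox i (Suc j)) \<and> tbox i j \<in> shifted_diagram lam"
      proof (cases "i \<le> j")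
        case le: True
        then have b: "tbox i j = (i, j)" "tbox i (Suc j) = (i, Suc j)" by (auto simp: tbox_def)
        then have "(i, j) \<in> shifted_diagram lam"
          using shifted_shape_closed[OF sh, of i "Suc j" i j] True i le by simp
        then show ?thesis using T True b unfolding inc_shifted_tableau_def by (metis lessI)
      next
        case False
        then have b: "tbox i j = (j, i)" "tbox i (Suc j) = (Suc j, i)" by (auto simp: tbox_def)
        then have "(j, i) \<in> shifted_diagram lam"
          using shifted_shape_closed[OF sh, of "Suc j" i j i] True j False by simp
        then show ?thesis using T True b unfolding inc_shifted_tableau_def by (metis lessI)
      qed
      then show ?thesis using True i j by (simp add: of_tableau_def)
    qed
  qed (use i in \<open>simp add: of_tableau_def\<close>)
  have "finite (insert 0 (snd ` shifted_diagram lam))" using sh unfolding shifted_shape_def by simp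
  then obtain N where N: "N \<notin> insert 0 (snd ` shifted_diagram lam)"
    using ex_new_if_finite infinite_UNIV_nat by blast
  have "(1, N) \<notin> shifted_diagram lam"
  proof
    assume "(1, N) \<in> shifted_diagram lam"
    from imageI[OF this, of snd] N show False by simp
  qed
  moreover have "tbox 1 N = (1, N)" using N by (cases N) (auto simp: tbox_def)
  ultimately have "?D 1 N = \<infinity>" using N by (simp add: of_tableau_def)
  then show "\<exists>N. ?D 1 N = \<infinity>" ..
qed

lemma shape_of_tableau: "strict_partition lam \<Longrightarrow> shape (of_tableau lam T) = shifted_diagram lam"
proof -
  assume lam: "strict_partition lam"
  have "(i, j) \<in> shape (of_tableau lam T) \<longleftrightarrow> (i, j) \<in> shifted_diagram lam" for i j
    using shifted_shape_bounds[OF shifted_diagram_shape[OF lam], of i j]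
    by (auto simp: shape_def of_tableau_def tbox_def min_def max_def)
  then show ?thesis by auto
qed

text \<open>The constant N exceeds the number of rows and the last column of every row, as no part
  is larger than the sum of all parts.\<close>

lemma rows_of_tableau:
  fixes lam T
  defines "N \<equiv> Suc (length lam) + sum_list lam"
  shows "rows (of_tableau lam T) N 1 N = row_word lam T" "bounded_by (of_tableau lam T) N"
proof -
  let ?D = "of_tableau lam T"
  have le: "i + lam ! (i - 1) \<le> N" if "1 \<le> i" "i \<le> length lam" for i
  proof -
    have "i - 1 < length lam" using that by simp
    then show ?thesis using elem_le_sum_list[of "i - 1" lam] that by (simp add: N_def)
  qed
  have fin: "?D i j \<noteq> \<infinity> \<longleftrightarrow> i \<le> length lam \<and> j < i + lam ! (i - 1)" if "1 \<le> i" "i \<le> j" for i j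
    using that by (auto simp: of_tableau_def tbox_def shifted_diagram_def)
  have row: "fseg ?D i i N = (if i \<le> length lam then map (\<lambda>j. T (i, j)) [i..<i + lam ! (i - 1)] else [])"
    if i: "1 \<le> i" for i
  proof (cases "i \<le> length lam")
    case True
    let ?e = "i + lam ! (i - 1)" and ?F = "filter (\<lambda>j. ?D i j \<noteq> \<infinity>)"
    have sp: "[i..<N] = [i..<?e] @ [?e..<N]"
      using le[OF i True] upt_add_eq_append[of i ?e "N - ?e"] by simp
    have "?F [i..<N] = ?F [i..<?e] @ ?F [?e..<N]" by (subst sp) (rule filter_append)
    also have "?F [i..<?e] = [i..<?e]" using fin[OF i] True by (simp add: filter_id_conv)
    also have "?F [?e..<N] = []" using fin[OF i] by (auto simp: filter_empty_conv)
    finally have "?F [i..<N] = [i..<?e]" by simp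
    moreover have "the_enat (?D i j) = T (i, j)" if "j \<in> set [i..<i + lam ! (i - 1)]" for j
      using that i True by (auto simp: of_tableau_def tbox_def shifted_diagram_def)
    ultimately show ?thesis using True by (simp add: fseg_def)
  next
    case False
    then show ?thesis using fin[OF i] by (auto simp: fseg_def filter_empty_conv)
  qed
  have u: "[1..<N] = [1..<Suc (length lam)] @ [Suc (length lam)..<N]"
    using upt_add_eq_append[of 1 "Suc (length lam)" "sum_list lam"] by (simp add: N_def)
  have v: "rword (map (\<lambda>j. fseg ?D j j N) [Suc (length lam)..<N]) = []"
    using row by (auto simp: rword_def)
  have "rows ?D N 1 N = rword (map (\<lambda>j. fseg ?D j j N) [1..<Suc (length lam)])"
    unfolding rows_def u map_append rword_simps(3) v by simp
  also have "map (\<lambda>j. fseg ?D j j N) [1..<Suc (length lam)]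
      = map (\<lambda>i. map (\<lambda>j. T (i, j)) [i..<i + lam ! (i - 1)]) [1..<Suc (length lam)]"
    using row by (intro map_cong) auto
  finally show "rows ?D N 1 N = row_word lam T" by (simp add: rword_def row_word_def rev_map)
  show "bounded_by ?D N" unfolding bounded_by_def
  proof (intro allI impI)
    fix p q :: nat assume pq: "1 \<le> p" "N \<le> q"
    have "tbox p q \<notin> shifted_diagram lam"
    proof
      assume "tbox p q \<in> shifted_diagram lam"
      then have "max p q < min p q + lam ! (min p q - 1)" "1 \<le> min p q" "min p q \<le> length lam"
        by (auto simp: shifted_diagram_def tbox_def)
      then show False using le[of "min p q"] pq by linarith
    qed
    then show "?D p q = \<infinity>" using pq by (simp add: of_tableau_def N_def)
  qed
qed

text \<open>A nonzero last part leaves a diagonal box in its row, so the diagram shows the number of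
  rows.\<close>

lemma shifted_diagram_inj:
  assumes "strict_partition lam" "strict_partition lam'" "shifted_diagram lam = shifted_diagram lam'"
  shows "lam = lam'"
proof -
  have len: "length l \<le> length l'" if "strict_partition l" "shifted_diagram l = shifted_diagram l'" for l l'
  proof (cases "length l = 0")
    case False
    then have "l ! (length l - 1) \<noteq> 0" using that(1) unfolding strict_partition_def
      by (metis diff_less length_0_conv length_greater_0_conv less_numeral_extra(1) nth_mem)
    then have "(length l, length l) \<in> shifted_diagram l" using False by (auto simp: shifted_diagram_def Suc_le_eq)
    then have "(length l, length l) \<in> shifted_diagram l'" using that(2) by simp
    then show ?thesis by (simp add: shifted_diagram_def)
  qed simp
  have nth: "l ! i \<le> l' ! i" if "shifted_diagram l = shifted_diagram l'" "i < length l" "i < length l'" for l l' :: "nat list" and i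
  proof (rule ccontr)
    assume "\<not> l ! i \<le> l' ! i"
    then have "(Suc i, Suc i + l' ! i) \<in> shifted_diagram l" using that(2) by (simp add: shifted_diagram_def)
    moreover have "(Suc i, Suc i + l' ! i) \<notin> shifted_diagram l'" by (simp add: shifted_diagram_def)
    ultimately show False using that(1) by simp
  qed
  have "length lam = length lam'" using len assms by (metis le_antisym)
  then show ?thesis using nth assms(3) by (intro nth_equalityI) (auto intro: le_antisym)
qed

lemma of_tableau_inj:
  assumes "strict_partition lam" "inc_shifted_tableau lam T" "strict_partition lam'" "inc_shifted_tableau lam' T'"
    "of_tableau lam T = of_tableau lam' T'"
  shows "lam = lam' \<and> T = T'"
proof -
  have sd: "shifted_diagram lam = shifted_diagram lam'"
    using assms(5) shape_of_tableau[OF assms(1), of T] shape_of_tableau[OF assms(3), of T'] by simp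
  then have l: "lam = lam'" using shifted_diagram_inj assms(1,3) by blast
  have "T (i, j) = T' (i, j)" for i j
  proof (cases "(i, j) \<in> shifted_diagram lam")
    case True
    then have "1 \<le> i" "i \<le> j" by (auto simp: shifted_diagram_def)
    then show ?thesis using True l fun_cong[OF fun_cong[OF assms(5)], of i j]
      by (simp add: of_tableau_def tbox_def)
  next
    case False
    then show ?thesis using assms(2,4) l unfolding inc_shifted_tableau_def by metis
  qed
  then show ?thesis using l by auto
qed

lemma of_tableau_surj:
  assumes D: "symarr D"
  shows "\<exists>lam T. strict_partition lam \<and> inc_shifted_tableau lam T \<and> of_tableau lam T = D"
proof -
  obtain N where "\<forall>i j. 1 \<le> i \<and> 1 \<le> j \<and> (N \<le> i \<or> N \<le> j) \<longrightarrow> D i j = \<infinity>" using symarr_bound[OF D] by blast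
  then have ex: "D (Suc N) (Suc N) = \<infinity>" by simp
  \<comment> \<open>The number of finite diagonal entries, which is the number of rows of the
    shifted shape.\<close>
  define m where "m = (LEAST m. D (Suc m) (Suc m) = \<infinity>)"
  have minf: "D (Suc m) (Suc m) = \<infinity>" unfolding m_def using ex by (rule LeastI)
  have diag: "D i i \<noteq> \<infinity> \<longleftrightarrow> i \<le> m" if "1 \<le> i" for i
  proof
    show "i \<le> m" if "D i i \<noteq> \<infinity>"
    proof (rule ccontr)
      assume "\<not> i \<le> m"
      then have "D (Suc m) (Suc m) \<le> D i i" using symarr_mono[OF D] by simp
      then show False using minf that by simp
    qed
    show "D i i \<noteq> \<infinity>" if "i \<le> m"
    proof -
      have "i - 1 < m" using that \<open>1 \<le> i\<close> by simp
      then show ?thesis using not_less_Least[of "i - 1" "\<lambda>m. D (Suc m) (Suc m) = \<infinity>"] \<open>1 \<le> i\<close>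
        unfolding m_def by simp
    qed
  qed
  \<comment> \<open>Row i of the tableau occupies the columns from i to
    \<open>len D i\<close>.\<close>
  define lam where "lam = map (\<lambda>i. Suc (len D i) - i) [1..<Suc m]"
  have lam: "length lam = m" "\<And>p. p < m \<Longrightarrow> lam ! p = Suc (len D (Suc p)) - Suc p"
    by (auto simp: lam_def simp del: upt_Suc)
  have ge: "p \<le> len D p" if "1 \<le> p" "p \<le> m" for p using len_le_iff[OF D that(1)] diag[OF that(1)] that(2) by blast
  have anti: "len D q \<le> len D p" if "1 \<le> p" "p \<le> q" for p q
  proof -
    have "D q (len D q) \<noteq> \<infinity>" using len_le_iff[OF D] that by (meson order_refl order_trans)
    then have "D p (len D q) \<noteq> \<infinity>" using enat_le_fin[OF symarr_mono[OF D that(2) order_refl]] by blast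
    then show ?thesis using len_le_iff[OF D that(1)] by blast
  qed
  have sp: "strict_partition lam" unfolding strict_partition_def
  proof
    show "sorted_wrt (>) lam" unfolding sorted_wrt_iff_nth_less
    proof (intro allI impI)
      fix p q assume "p < q" "q < length lam"
      then show "lam ! p > lam ! q" using lam ge[of "Suc q"] anti[of "Suc p" "Suc q"] by simp
    qed
    have "lam ! p \<noteq> 0" if "p < m" for p using lam(2)[OF that] ge[of "Suc p"] that by simp
    then show "0 \<notin> set lam" using lam(1) by (metis in_set_conv_nth)
  qed
  have sd: "shifted_diagram lam = shape D"
  proof (rule set_eqI, clarify)
    fix i j
    have "(i, j) \<in> shifted_diagram lam \<longleftrightarrow> 1 \<le> i \<and> i \<le> m \<and> i \<le> j \<and> j \<le> len D i"
      using lam ge[of i] by (auto simp: shifted_diagram_def)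
    also have "\<dots> \<longleftrightarrow> (i, j) \<in> shape D"
    proof -
      have "D i j \<noteq> \<infinity> \<Longrightarrow> i \<le> j \<Longrightarrow> D i i \<noteq> \<infinity>" using enat_le_fin[OF symarr_mono_row[OF D]] by blast
      then show ?thesis using len_le_iff[OF D, of i j] diag[of i] by (auto simp: shape_def)
    qed
    finally show "(i, j) \<in> shifted_diagram lam \<longleftrightarrow> (i, j) \<in> shape D" .
  qed
  define T where "T = (\<lambda>(i, j). if (i, j) \<in> shape D then the_enat (D i j) else 0)"
  have "inc_shifted_tableau lam T" unfolding inc_shifted_tableau_def sd
  proof (intro conjI allI impI ballI)
    show "T b = 0" if "b \<notin> shape D" for b using that by (cases b) (simp add: T_def)
    show "1 \<le> T b" if "b \<in> shape D" for b
    proof -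
      obtain i j where b: "b = (i, j)" by fastforce
      then have "1 \<le> i" "0 < j" "D i j \<noteq> \<infinity>" using that by (auto simp: shape_def)
      then show ?thesis using symarr_strict_the[OF D, of i 0 j] that b D by (simp add: T_def)
    qed
    show "T (i, j) < T (i, j')" if "(i, j) \<in> shape D" "(i, j') \<in> shape D" "j < j'" for i j j'
      using that symarr_strict_the[OF D, of i j j'] by (auto simp: T_def shape_def)
    show "T (i, j) < T (i', j)" if "(i, j) \<in> shape D" "(i', j) \<in> shape D" "i < i'" for i i' j
      using that symarr_strict_the[OF D, of j i i'] symarr_sym[OF D, of j] by (auto simp: T_def shape_def)
  qed
  moreover have "of_tableau lam T i j = D i j" for i j
  proof (cases "i = 0 \<or> j = 0")
    case False
    have "D (fst (tbox i j)) (snd (tbox i j)) = D i j" using symarr_sym[OF D, of i j] by (auto simp: tbox_def min_def max_def)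
    moreover have "tbox i j \<in> shape D \<longleftrightarrow> D i j \<noteq> \<infinity>" using tbox_shape[OF D] False by simp
    moreover have "D i j \<noteq> \<infinity> \<Longrightarrow> enat (the_enat (D i j)) = D i j" by (cases "D i j") auto
    ultimately show ?thesis using False by (cases "tbox i j") (auto simp: of_tableau_def sd T_def)
  qed (use D in \<open>auto simp: of_tableau_def\<close>)
  then have "of_tableau lam T = D" by blast
  ultimately show ?thesis using sp by blast
qed

text \<open>Used for two consequences: words equivalent to an initial word have positive letters,
  and a class contains finitely many words of each length.\<close>

lemma weq_set: "weq u v \<Longrightarrow> set u = set v"
proof -
  have step: "set u = set v" if "kk_step u v" for u v using that by (induction rule: kk_step.induct) auto
  show "weq u v \<Longrightarrow> set u = set v"
    unfolding weak_kk_equiv_def by (induction rule: equivclp_induct) (use step in auto)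
qed

section \<open>Coefficients and the counting bijection\<close>

lemma fsum_indicator: "fsum X (\<lambda>i M. if f i = M then 1 else 0) M = card {i \<in> X. f i = M}"
proof -
  have "{i \<in> X. (if f i = M then 1 else 0::nat) \<noteq> 0} = {i \<in> X. f i = M}" by auto
  then show ?thesis by (simp add: fsum_def)
qed

text \<open>A monomial has a single sorted index list, so its coefficient in a fundamental function
  is 0 or 1.\<close>

lemma fundamental_compatible:
  assumes "\<forall>x\<in>set w. 1 \<le> x"
  shows "fundamental (length w) (descents w) M
    = (if 0 \<notin># M \<and> compatible w (sorted_list_of_multiset M) then 1 else 0)"
proof -
  let ?I = "sorted_list_of_multiset M"
  have "{i \<in> {i. length i = length w \<and> sorted i \<and> (\<forall>x\<in>set i. 1 \<le> x)
        \<and> (\<forall>j\<in>descents w. Suc j < length w \<longrightarrow> i ! j < i ! Suc j)}. mset i = M}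
    = (if 0 \<notin># M \<and> compatible w ?I then {?I} else {})"
  proof -
    have "i = ?I" if "sorted i" "mset i = M" for i
      using that by (metis sorted_list_of_multiset_mset sorted_sort_id)
    moreover have "compatible w ?I \<longleftrightarrow> length ?I = length w \<and> (\<forall>j\<in>descents w. Suc j < length w \<longrightarrow> ?I ! j < ?I ! Suc j)"
      using assms by (auto simp: compatible_def descents_def)
    moreover have "(\<forall>x\<in>set ?I. 1 \<le> x) \<longleftrightarrow> 0 \<notin># M"
      by (auto simp: Suc_le_eq) (metis gr0I)
    ultimately show ?thesis by auto
  qed
  then show ?thesis by (simp add: fundamental_def fsum_indicator)
qed

theorem theorem4:
  fixes h :: "nat list"
  assumes "initial_word h"
  shows "phi_class h =
    fsum {(lam, T). strict_partition lam \<and> inc_shifted_tableau lam T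
                    \<and> weak_kk_equiv (row_word lam T) h}
         (\<lambda>(lam, T). K_shifted lam)"
proof
  fix M :: "nat multiset"
  let ?I = "sorted_list_of_multiset M"
  let ?P = "{(lam, T). strict_partition lam \<and> inc_shifted_tableau lam T \<and> weak_kk_equiv (row_word lam T) h}"
  let ?Q = "\<lambda>lam. {S. weak_sv_tableau lam S \<and> sv_content lam S = M}"
  have hpos: "\<forall>x\<in>set w. 1 \<le> x" if "weq w h" for w
    using assms weq_set[OF that] by (auto simp: initial_word_def)
  \<comment> \<open>The monomial M fixes the list of labels \<open>?I\<close>, so its coefficient on
    the left is the number of words in the class that are compatible with \<open>?I\<close>.\<close>
  define W where "W = {w. weq w h \<and> 0 \<notin># M \<and> compatible w ?I}"
  have fc: "fundamental (length w) (descents w) M = (if 0 \<notin># M \<and> compatible w ?I then 1 else 0)"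
    if "weq w h" for w using fundamental_compatible[OF hpos[OF that]] .
  then have "{w \<in> {w. weq w h}. fundamental (length w) (descents w) M \<noteq> 0} = W"
    by (auto simp: W_def split: if_splits)
  moreover have "fundamental (length w) (descents w) M = 1" if "w \<in> W" for w
    using that fc by (simp add: W_def)
  ultimately have L: "phi_class h M = card W" by (simp add: phi_class_def fsum_def)
  have "W \<subseteq> {w. set w \<subseteq> set h \<and> length w = length ?I}"
    using weq_set by (auto simp: W_def compatible_def)
  then have finW: "finite W" using finite_lists_length_eq[of "set h"] finite_subset by blast
  have K: "K_shifted lam M = card (?Q lam)" for lam
    by (simp add: K_shifted_def fsum_indicator)
  \<comment> \<open>For fixed M both sides become cardinalities; the relation R, given by recording,
    matches these pairs with the words in W.\<close>
  define Y where "Y = (SIGMA p:?P. ?Q (fst p))"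
  define R where "R = (\<lambda>((lam, T), S) w. recording w ?I (of_tableau lam T) S \<and> compatible w ?I)"
  have sI: "sorted ?I" and mI: "mset ?I = M" by simp_all
  have Y: "y \<in> Y \<longleftrightarrow> (\<exists>lam T S. y = ((lam, T), S) \<and> strict_partition lam \<and> inc_shifted_tableau lam T
      \<and> weq (row_word lam T) h \<and> svt (shape (of_tableau lam T)) S \<and> content (shape (of_tableau lam T)) S = M)" for y
    unfolding Y_def using weak_sv_tableau_svt[OF shifted_diagram_shape] shape_of_tableau
    by (cases y) (auto simp: content_def sv_content_def)
  have Ypos: "0 \<notin># M" if "y \<in> Y" for y
  proof -
    obtain A S where "svt A S" "content A S = M" using \<open>y \<in> Y\<close> unfolding Y by blast
    then show ?thesis using content_mem[of A S 0] svtD(3) by fastforce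
  qed
  have ex: "\<exists>w. w \<in> W \<and> R y w" if y: "y \<in> Y" for y
  proof -
    obtain lam T S where y': "y = ((lam, T), S)" "strict_partition lam" "inc_shifted_tableau lam T"
      "weq (row_word lam T) h" "svt (shape (of_tableau lam T)) S" "content (shape (of_tableau lam T)) S = M"
      using y unfolding Y by blast
    have pos: "\<forall>n\<in>set ?I. 1 \<le> n" using Ypos[OF y] by (auto simp: Suc_le_eq) (metis gr0I)
    obtain w where w: "compatible w ?I" "recording w ?I (of_tableau lam T) S"
      using recording_surj[OF of_tableau_symarr[OF y'(2,3)] y'(5) _ sI pos] y'(6) mI by auto
    have "weq w (row_word lam T)"
      using recording_weq[OF w(2) rows_of_tableau(2)] rows_of_tableau(1) by metis
    then have "w \<in> W" using w Ypos[OF y] y'(4) weq_trans by (auto simp: W_def)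
    then show ?thesis using w y' by (auto simp: R_def)
  qed
  have uniq: "w = w'" if "R y w" "R y w'" "y \<in> Y" for y w w'
  proof -
    have pos: "\<forall>n\<in>set ?I. 1 \<le> n" using Ypos[OF that(3)] by (auto simp: Suc_le_eq) (metis gr0I)
    show ?thesis using that(1,2) recording_inj[OF _ _ _ _ sI pos] by (cases y) (auto simp: R_def)
  qed
  have inj: "y = y'" if a: "R y w" "R y' w" "y \<in> Y" "y' \<in> Y" for y y' w
  proof -
    obtain lam T S lam' T' S' where y: "y = ((lam, T), S)" "strict_partition lam" "inc_shifted_tableau lam T"
      "y' = ((lam', T'), S')" "strict_partition lam'" "inc_shifted_tableau lam' T'"
      using a(3,4) unfolding Y by blast
    then have "of_tableau lam T = of_tableau lam' T'" "S = S'" using a(1,2) recording_det by (auto simp: R_def)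
    then show ?thesis using y of_tableau_inj by blast
  qed
  have surj: "\<exists>y\<in>Y. R y w" if w: "w \<in> W" for w
  proof -
    have c: "compatible w ?I" and wh: "weq w h" and pos: "\<forall>n\<in>set ?I. 1 \<le> n"
      using w by (auto simp: W_def Suc_le_eq) (metis gr0I)
    have "length w = length ?I" "\<forall>x\<in>set w. 1 \<le> x" using c unfolding compatible_def by blast+
    then obtain D S where D: "recording w ?I D S" "symarr D" using recording_total by blast
    have rd: "recorded w ?I D S" using recording_recorded[OF D(1) c sI pos] .
    obtain lam T where lam: "strict_partition lam" "inc_shifted_tableau lam T" "of_tableau lam T = D"
      using of_tableau_surj[OF D(2)] by blast
    have "weq w (row_word lam T)"
      using recording_weq[OF D(1)] rows_of_tableau[of lam T] lam(3) by metis
    then have "weq (row_word lam T) h" using wh weq_sym weq_trans by blast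
    then have "((lam, T), S) \<in> Y" unfolding Y using lam rd mI by (auto simp: recorded_def)
    moreover have "R ((lam, T), S) w" using D(1) c lam(3) by (simp add: R_def)
    ultimately show ?thesis by blast
  qed
  define g where "g y = (THE w. R y w)" for y
  have g: "R y (g y)" "g y \<in> W" if yY: "y \<in> Y" for y
  proof -
    obtain w where w: "w \<in> W" "R y w" using ex[OF yY] by blast
    then have "g y = w" unfolding g_def using uniq yY by (intro the_equality) blast+
    then show "R y (g y)" "g y \<in> W" using w by auto
  qed
  have bij: "bij_betw g Y W" unfolding bij_betw_def
  proof
    show "inj_on g Y" using g(1) inj by (intro inj_onI) metis
    show "g ` Y = W"
    proof
      show "g ` Y \<subseteq> W" using g(2) by blast
      show "W \<subseteq> g ` Y"
      proof
        fix w assume "w \<in> W"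
        then obtain y where "y \<in> Y" "R y w" using surj by blast
        then have "w = g y" using g(1) uniq by blast
        then show "w \<in> g ` Y" using \<open>y \<in> Y\<close> by blast
      qed
    qed
  qed
  have finY: "finite Y" using bij finW bij_betw_finite by blast
  \<comment> \<open>The formal sum runs over the tableaux with a nonzero coefficient at M. That
    these are finitely many follows from the finiteness of W through the bijection.\<close>
  let ?P' = "{p \<in> ?P. K_shifted (fst p) M \<noteq> 0}"
  have finQ: "finite (?Q (fst p))" if "p \<in> ?P" for p
  proof -
    have "Pair p ` ?Q (fst p) \<subseteq> Y" using that unfolding Y_def by blast
    then show ?thesis using finY finite_subset finite_imageD[of "Pair p"] by (meson Pair_inject inj_onI)
  qed
  have "?P' \<subseteq> fst ` Y"
  proof
    fix p assume p: "p \<in> ?P'"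
    then have "card (?Q (fst p)) \<noteq> 0" unfolding K by blast
    then have "?Q (fst p) \<noteq> {}" by (metis card.empty)
    then obtain S where "S \<in> ?Q (fst p)" by blast
    then have "(p, S) \<in> Y" using p unfolding Y_def by blast
    then show "p \<in> fst ` Y" by force
  qed
  then have finP': "finite ?P'" using finY finite_subset by blast
  have "Y = (SIGMA p:?P'. ?Q (fst p))"
  proof
    show "Y \<subseteq> (SIGMA p:?P'. ?Q (fst p))"
    proof
      fix y assume y: "y \<in> Y"
      then obtain p S where pS: "y = (p, S)" "p \<in> ?P" "S \<in> ?Q (fst p)" unfolding Y_def by blast
      then have "card (?Q (fst p)) \<noteq> 0" using finQ[OF pS(2)] by (metis card_0_eq empty_iff)
      then have "p \<in> ?P'" using pS(2) unfolding K by blast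
      then show "y \<in> (SIGMA p:?P'. ?Q (fst p))" unfolding pS(1) using pS(3) by (rule SigmaI)
    qed
  qed (auto simp: Y_def)
  then have "card Y = (\<Sum>p\<in>?P'. K_shifted (fst p) M)"
    using finP' finQ by (simp add: K)
  moreover have "fsum ?P (\<lambda>(lam, T). K_shifted lam) M = (\<Sum>p\<in>?P'. K_shifted (fst p) M)"
    unfolding fsum_def by (intro sum.cong) (auto simp: case_prod_beta)
  ultimately show "phi_class h M = fsum ?P (\<lambda>(lam, T). K_shifted lam) M"
    using L bij_betw_same_card[OF bij] by simp
qed

end
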